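(* There exists a displacement $y:\Lambda\to\mathbb{R}$ which is a globally stable equilibrium and has net Burgers vector $B[y]=1$.
   Context: Let $\mathsf R_6$ denote rotation of $\mathbb R^2$ through angle $\pi/3$, $a_1=(1,0)^T$, $a_i=\mathsf R_6^{i-1}a_1$ (indices mod 6), and $\Lambda:=(\tfrac12,\tfrac{\sqrt3}{6})^T+\{m a_1+n a_2: m,n\in\mathbb Z\}$ (a triangular lattice; the origin is the barycentre of one of its elementary triangles). The set of bonds is $\mathcal B=\{(\xi,\eta)\in\Lambda^2:|\xi-\eta|=1\}$ (ordered pairs); for $b=(\xi,\eta)$, $-b=(\eta,\xi)$ and for $y:\Lambda\to\mathbb R$, $Dy_b=y(\eta)-y(\xi)$. For a bond $b$, $|b|$ denotes the distance from the origin to the closed segment $b$. A cell is a triple $C=(\xi,\zeta,\eta)$ of lattice points with $(\xi,\zeta),(\zeta,\eta),(\eta,\xi)\in\mathcal B$; it is positively oriented if the vertices are in counterclockwise order, and $\partial C=(\xi,\zeta)+(\zeta,\eta)+(\eta,\xi)$. For $\alpha:\mathcal B\to\mathbb R$ and a formal sum of bonds $\Gamma=\sum_k b_k$, $\int_\Gamma\alpha=\sum_k\alpha_{b_k}$. For $y:\Lambda\to\mathbb R$, $[Dy]$ is the set of $\alpha:\mathcal B\to[-\tfrac12,\tfrac12]$ with $\alpha_{-b}=-\alpha_b$ and $Dy_b-\alpha_b\in\mathbb Z$ for all $b$. A dislocation core of $\alpha$ is a positively oriented cell $C$ with $\int_{\partial C}\alpha\neq0$; $\mathcal C^\pm[\alpha]$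 denotes the set of dislocation cores. If $y$ admits some $\alpha\in[Dy]$ with $\alpha_b\to0$ as $|b|\to\infty$, the net Burgers vector is $B[y]:=\sum_{C\in\mathcal C^\pm[\alpha]}\int_{\partial C}\alpha$ (this is finite and independent of the choice of $\alpha\in[Dy]$). The pair potential $\psi\in C(\mathbb R)\cap C^4(\mathbb R\setminus(\mathbb Z+\tfrac12))$ satisfies: ($\psi$1) $\psi$ is 1-periodic; ($\psi$2) $\psi$ and $\psi(\tfrac12+\cdot)$ are even; ($\psi$3) $\psi(r)=0$ iff $r\in\mathbb Z$; ($\psi$4) $\psi''(0)=\mu>0$; ($\psi$5) $\psi(x)\ge\tfrac12\psi''(0)x^2$ for all $x\in[-\tfrac12,\tfrac12]$. Let $\xi_0=(0,\sqrt3/3)^T$ and $\mathscr W_0=\{v:\Lambda\to\mathbb R: v(\xi_0)=0,\ \{b: Dv_b\ne0\}\text{ bounded}\}$. For $y$ and $u\in\mathscr W_0$, $E(y+u;y):=\sum_{b\in\mathcal B}[\psi(Dy_b+Du_b)-\psi(Dy_b)]$ (a finite sum). A displacement $y$ is a globally stable equilibrium if $E(y+u;y)\ge0$ for all $u\in\mathscr W_0$.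
   Formalization: The point ξ₀=(0,√3/3) is not in Λ, so the normalisation v(ξ₀)=0 is imposed at the lattice point (0,−√3/3) instead; and each positively oriented triangle is counted once in B[y], not once for each of its three cyclic labellings as a triple. *)

theory Defs
  imports "HOL-Analysis.Analysis"
begin

text \<open>Lattice points are indexed by integer coordinates (m,n); the actual position
  in the plane is  (1/2, sqrt 3/6) + m a1 + n a2  with a1 = (1,0), a2 = (1/2, sqrt 3/2).\<close>

type_synonym lpt = "int \<times> int"

definition pos :: "lpt \<Rightarrow> real \<times> real" where
  "pos p = (1/2 + real_of_int (fst p) + real_of_int (snd p) / 2,
            sqrt 3 / 6 + real_of_int (snd p) * sqrt 3 / 2)"

definition is_bond :: "lpt \<Rightarrow> lpt \<Rightarrow> bool" where
  "is_bond \<xi> \<eta> \<longleftrightarrow> dist (pos \<xi>) (pos \<eta>) = 1"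

definition bond_dist :: "lpt \<Rightarrow> lpt \<Rightarrow> real" where
  "bond_dist \<xi> \<eta> = infdist (0 :: real \<times> real) (closed_segment (pos \<xi>) (pos \<eta>))"

definition D :: "(lpt \<Rightarrow> real) \<Rightarrow> lpt \<Rightarrow> lpt \<Rightarrow> real" where
  "D y \<xi> \<eta> = y \<eta> - y \<xi>"

definition is_cell :: "lpt \<Rightarrow> lpt \<Rightarrow> lpt \<Rightarrow> bool" where
  "is_cell \<xi> \<zeta> \<eta> \<longleftrightarrow> is_bond \<xi> \<zeta> \<and> is_bond \<zeta> \<eta> \<and> is_bond \<eta> \<xi>"

definition pos_oriented :: "lpt \<Rightarrow> lpt \<Rightarrow> lpt \<Rightarrow> bool" where
  "pos_oriented \<xi> \<zeta> \<eta> \<longleftrightarrow>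
     (fst (pos \<zeta>) - fst (pos \<xi>)) * (snd (pos \<eta>) - snd (pos \<xi>))
   - (snd (pos \<zeta>) - snd (pos \<xi>)) * (fst (pos \<eta>) - fst (pos \<xi>)) > 0"

definition circ :: "(lpt \<Rightarrow> lpt \<Rightarrow> real) \<Rightarrow> lpt \<Rightarrow> lpt \<Rightarrow> lpt \<Rightarrow> real" where
  "circ \<alpha> \<xi> \<zeta> \<eta> = \<alpha> \<xi> \<zeta> + \<alpha> \<zeta> \<eta> + \<alpha> \<eta> \<xi>"

definition Dclass :: "(lpt \<Rightarrow> real) \<Rightarrow> (lpt \<Rightarrow> lpt \<Rightarrow> real) set" where
  "Dclass y = {\<alpha>. \<forall>\<xi> \<eta>. is_bond \<xi> \<eta> \<longrightarrow>
      \<alpha> \<xi> \<eta> \<in> {-1/2..1/2} \<and> \<alpha> \<eta> \<xi> = - \<alpha> \<xi> \<eta> \<and> D y \<xi> \<eta> - \<alpha> \<xi> \<eta> \<in> \<int>}"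

definition decays :: "(lpt \<Rightarrow> lpt \<Rightarrow> real) \<Rightarrow> bool" where
  "decays \<alpha> \<longleftrightarrow> (\<forall>\<epsilon>>0. \<exists>R. \<forall>\<xi> \<eta>. is_bond \<xi> \<eta> \<and> bond_dist \<xi> \<eta> > R \<longrightarrow> \<bar>\<alpha> \<xi> \<eta>\<bar> < \<epsilon>)"

text \<open>Dislocation cores, identified as geometric triangles (vertex sets), so that the
  cyclic relabellings of one positively oriented cell are counted once.\<close>
definition cores :: "(lpt \<Rightarrow> lpt \<Rightarrow> real) \<Rightarrow> lpt set set" where
  "cores \<alpha> = {{\<xi>, \<zeta>, \<eta>} | \<xi> \<zeta> \<eta>.
      is_cell \<xi> \<zeta> \<eta> \<and> pos_oriented \<xi> \<zeta> \<eta> \<and> circ \<alpha> \<xi> \<zeta> \<eta> \<noteq> 0}"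

text \<open>Circulation around a triangle, computed from any positively oriented labelling
  (it is independent of the cyclic labelling chosen).\<close>
definition tri_circ :: "(lpt \<Rightarrow> lpt \<Rightarrow> real) \<Rightarrow> lpt set \<Rightarrow> real" where
  "tri_circ \<alpha> T = (case (SOME C. case C of (\<xi>, \<zeta>, \<eta>) \<Rightarrow>
        T = {\<xi>, \<zeta>, \<eta>} \<and> is_cell \<xi> \<zeta> \<eta> \<and> pos_oriented \<xi> \<zeta> \<eta>)
      of (\<xi>, \<zeta>, \<eta>) \<Rightarrow> circ \<alpha> \<xi> \<zeta> \<eta>)"

definition has_burgers :: "(lpt \<Rightarrow> real) \<Rightarrow> real \<Rightarrow> bool" where
  "has_burgers y B \<longleftrightarrow> (\<exists>\<alpha>. \<alpha> \<in> Dclass y \<and> decays \<alpha> \<and> finite (cores \<alpha>) \<and>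
      (\<Sum>T\<in>cores \<alpha>. tri_circ \<alpha> T) = B)"

text \<open>xi_0: the lattice point (0, -sqrt 3/3), i.e. index (0,-1).\<close>
definition xi0 :: lpt where "xi0 = (0, -1)"

definition W0 :: "(lpt \<Rightarrow> real) set" where
  "W0 = {v. v xi0 = 0 \<and>
      (\<exists>R. \<forall>\<xi> \<eta>. is_bond \<xi> \<eta> \<and> D v \<xi> \<eta> \<noteq> 0 \<longrightarrow> bond_dist \<xi> \<eta> \<le> R)}"

text \<open>E(y+u; y): finite sum over the (bounded, hence finite) set of bonds where Du \<noteq> 0;
  all other summands vanish.\<close>
definition energy_diff :: "(real \<Rightarrow> real) \<Rightarrow> (lpt \<Rightarrow> real) \<Rightarrow> (lpt \<Rightarrow> real) \<Rightarrow> real" where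
  "energy_diff \<psi> y u = (\<Sum>b\<in>{(\<xi>, \<eta>). is_bond \<xi> \<eta> \<and> D u \<xi> \<eta> \<noteq> 0}.
      \<psi> (D y (fst b) (snd b) + D u (fst b) (snd b)) - \<psi> (D y (fst b) (snd b)))"

definition globally_stable :: "(real \<Rightarrow> real) \<Rightarrow> (lpt \<Rightarrow> real) \<Rightarrow> bool" where
  "globally_stable \<psi> y \<longleftrightarrow> (\<forall>u\<in>W0. energy_diff \<psi> y u \<ge> 0)"

definition C4_on :: "real set \<Rightarrow> (real \<Rightarrow> real) \<Rightarrow> bool" where
  "C4_on S f \<longleftrightarrow> open S \<and>
     (\<forall>k<4. \<forall>x\<in>S. ((deriv ^^ k) f has_real_derivative (deriv ^^ Suc k) f x) (at x)) \<and>
     continuous_on S ((deriv ^^ 4) f)"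

end

theory Submission
  imports Defs "HOL-Complex_Analysis.Great_Picard"
begin

text \<open>
  Minimise the energy relative to the angle function of a single dislocation, with a penalty
  \<open>\<epsilon>\<close> for every bond that is changed. The penalised functional is trivially bounded below, and its
  near minimisers are stable up to an error of order \<open>\<epsilon>\<close>. The point is to show that, after a lattice
  translation, their bond strains differ from those of the single dislocation by a form that is
  bounded in the square-summable norm uniformly in \<open>\<epsilon>\<close>: a pointwise limit is then globally stable,
  and a square-summable perturbation changes neither the decay nor the net Burgers vector.

  For the uniform bound write the strain as the single dislocation at \<open>p\<close> plus a form \<open>\<gamma>\<close>.
  By (\<open>\<psi>\<close>5) and summation by parts the energy excess is at least half the squared norm of \<open>\<gamma>\<close> minus
  \<open>\<Sum> b\<^sub>T log |T - p|\<close>, where the charges \<open>b\<^sub>T\<close> of the cores are integers with sum 1. Single linkage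
  clusters of the cores at dyadic scales form a tree, and one can descend it through clusters of
  charge at least 1 to find \<open>p\<close>. A scale at which the clusters are small compared with their
  separation contributes with the good sign; the number of other scales is at most linear in the
  number of well separated cores, and their contribution is absorbed by Cauchy--Schwarz. Finally, a
  comparison argument shows that near a core of an almost minimiser the energy in a box of size \<open>r\<close>
  is at least of order \<open>log r\<close>, so that well separated cores cost more than they can gain.
\<close>

section \<open>Edges and triangles of the lattice\<close>

text \<open>The energy of a single dislocation diverges logarithmically, so only differences make
  sense, and it is not clear beforehand that these are bounded below: a competitor may move the core
  far away or create many pairs of opposite cores. (\<psi>5) is decisive because its constant is the
  one in the Taylor expansion at 0: the divergent quadratic parts cancel, and the cubic remainder is
  summable in two dimensions. The logarithm enters because the angle form agrees, up to a
  quadratically decaying error, with the rotated gradient of log on the dual lattice of triangle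
  centres. The estimate closes in a loop: the squared norm is at most linear in the number of well
  separated cores, with a slope that depends on the potential alone, while each such core costs as
  much as desired once the box size r is large. So r is fixed by that slope, and the coarsest scale
  to be ignored and the admissible \<epsilon> are fixed by r.\<close>

datatype dir = E0 | E1 | E2

lemma UNIV_dir: "(UNIV :: dir set) = {E0, E1, E2}"
  using dir.exhaust by auto

instance dir :: finite
  by standard (simp add: UNIV_dir)

text \<open>The triangle \<open>(x, True)\<close> has the vertices \<open>x\<close>, \<open>x + (1, 0)\<close>, \<open>x + (0, 1)\<close>, and \<open>(x, False)\<close> is
  its mirror image with the vertex \<open>x + (1, 1)\<close> instead of \<open>x\<close>. Every unoriented bond is represented by
  exactly one edge \<open>(x, d)\<close>; the edge \<open>(x, E2)\<close> is the side of \<open>(x, True)\<close> opposite to \<open>x\<close>.\<close>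

type_synonym edge = "lpt \<times> dir"
type_synonym tri = "lpt \<times> bool"

fun src :: "edge \<Rightarrow> lpt" where
  "src (x, E0) = x"
| "src (x, E1) = x"
| "src (x, E2) = x + (1, 0)"

fun tgt :: "edge \<Rightarrow> lpt" where
  "tgt (x, E0) = x + (1, 0)"
| "tgt (x, E1) = x + (0, 1)"
| "tgt (x, E2) = x + (0, 1)"

fun lft :: "edge \<Rightarrow> tri" where
  "lft (x, E0) = (x, True)"
| "lft (x, E1) = (x - (1, 0), False)"
| "lft (x, E2) = (x, True)"

fun rgt :: "edge \<Rightarrow> tri" where
  "rgt (x, E0) = (x - (0, 1), False)"
| "rgt (x, E1) = (x, True)"
| "rgt (x, E2) = (x, False)"

fun curl :: "(edge \<Rightarrow> real) \<Rightarrow> tri \<Rightarrow> real" where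
  "curl a (x, True) = a (x, E0) + a (x, E2) - a (x, E1)"
| "curl a (x, False) = a (x + (1, 0), E1) - a (x + (0, 1), E0) - a (x, E2)"

definition grad :: "(lpt \<Rightarrow> real) \<Rightarrow> edge \<Rightarrow> real" where
  "grad y e = y (tgt e) - y (src e)"

text \<open>The representative modulo 1 in [-1/2, 1/2). A tie goes to -1/2, so \<open>wrap\<close>
  is discontinuous at half integers, which matters when limits are taken.\<close>

definition wrap :: "real \<Rightarrow> real" where
  "wrap t = t - of_int (round t)"

definition supn :: "lpt \<Rightarrow> int" where
  "supn x = max \<bar>fst x\<bar> \<bar>snd x\<bar>"

definition Box :: "nat \<Rightarrow> lpt set" where
  "Box N = {- int N..int N} \<times> {- int N..int N}"

definition edges :: "nat \<Rightarrow> edge set" where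
  "edges N = Box N \<times> UNIV"

definition tris :: "nat \<Rightarrow> tri set" where
  "tris N = Box N \<times> UNIV"

lemma mem_Box: "x \<in> Box N \<longleftrightarrow> supn x \<le> int N"
  by (cases x) (auto simp: Box_def supn_def)

lemma finite_Box [simp]: "finite (Box N)"
  by (simp add: Box_def)

lemma card_Box: "card (Box N) = (2 * N + 1)\<^sup>2"
  by (simp add: Box_def power2_eq_square nat_add_distrib nat_mult_distrib)

lemma finite_edges [simp]: "finite (edges N)"
  by (simp add: edges_def)

lemma finite_tris [simp]: "finite (tris N)"
  by (simp add: tris_def)

lemma card_edges: "card (edges N) = 3 * (2 * N + 1)\<^sup>2"
  by (simp add: edges_def card_Box card_cartesian_product UNIV_dir)

lemma mem_edges: "e \<in> edges N \<longleftrightarrow> supn (fst e) \<le> int N"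
  by (cases e) (simp add: edges_def mem_Box)

lemma mem_tris: "T \<in> tris N \<longleftrightarrow> supn (fst T) \<le> int N"
  by (cases T) (simp add: tris_def mem_Box)

lemma supn_add: "supn (x + y) \<le> supn x + supn y"
  by (auto simp: supn_def)

lemma supn_minus [simp]: "supn (- x) = supn x"
  by (auto simp: supn_def)

lemma supn_diff: "supn (x - y) \<le> supn x + supn y"
  by (auto simp: supn_def)

lemma supn_ge0 [simp]: "0 \<le> supn x"
  by (auto simp: supn_def)

lemma supn_commute: "supn (x - y) = supn (y - x)"
  by (auto simp: supn_def abs_minus_commute)

lemma supn_simps [simp]: "supn (a, 0) = \<bar>a\<bar>" "supn (0, a) = \<bar>a\<bar>" "supn 0 = 0"
  by (auto simp: supn_def)

lemma sum_edges: "(\<Sum>e\<in>edges N. g e) = (\<Sum>x\<in>Box N. g (x, E0) + g (x, E1) + g (x, E2 :: dir))"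
  for g :: "edge \<Rightarrow> real"
  unfolding edges_def by (subst sum.cartesian_product [symmetric, where g="\<lambda>x d. g (x, d)", simplified])
    (simp add: UNIV_dir add.assoc)

lemma sum_tris: "(\<Sum>T\<in>tris N. g T) = (\<Sum>x\<in>Box N. g (x, True) + g (x, False))"
  for g :: "tri \<Rightarrow> real"
  unfolding tris_def by (subst sum.cartesian_product [symmetric, where g="\<lambda>x d. g (x, d)", simplified])
    (simp add: UNIV_bool add.commute)

lemma exists_edges_superset:
  assumes "finite S" shows "\<exists>N0. \<forall>N\<ge>N0. S \<subseteq> edges N"
proof -
  define N0 where "N0 = nat (Max (insert 0 ((\<lambda>e. supn (fst e)) ` S)))"
  have "supn (fst e) \<le> int N" if "e \<in> S" "N \<ge> N0" for e N
  proof -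
    have "supn (fst e) \<le> Max (insert 0 ((\<lambda>e. supn (fst e)) ` S))"
      using assms that by (intro Max_ge) auto
    then show ?thesis using that unfolding N0_def by linarith
  qed
  then show ?thesis unfolding subset_iff mem_edges by blast
qed

section \<open>Summation by parts on the triangular lattice\<close>

lemma sum_Box_shift:
  fixes g :: "lpt \<Rightarrow> real"
  assumes "\<And>x. x \<notin> Box N \<Longrightarrow> g x = 0" and "supn v \<le> 1"
  shows "(\<Sum>x\<in>Box (Suc N). g (x - v)) = (\<Sum>x\<in>Box (Suc N). g x)"
proof (rule sum.reindex_bij_witness_not_neutral
    [where i="\<lambda>x. x + v" and j="\<lambda>x. x - v"
      and S'="{x\<in>Box (Suc N). x - v \<notin> Box N}" and T'="Box (Suc N) - Box N"])
  show "finite {x\<in>Box (Suc N). x - v \<notin> Box N}" "finite (Box (Suc N) - Box N)"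
    by simp_all
  fix a assume "a \<in> Box (Suc N) - {x\<in>Box (Suc N). x - v \<notin> Box N}"
  then have *: "a \<in> Box (Suc N)" "a - v \<in> Box N" by auto
  then show "a - v \<in> Box (Suc N) - (Box (Suc N) - Box N)"
    by (auto simp: mem_Box)
  show "a - v + v = a" by simp
next
  fix b assume "b \<in> Box (Suc N) - (Box (Suc N) - Box N)"
  then have "b \<in> Box N" by auto
  moreover have "b + v \<in> Box (Suc N)"
    using calculation assms(2) supn_add[of b v] by (auto simp: mem_Box)
  ultimately show "b + v \<in> Box (Suc N) - {x\<in>Box (Suc N). x - v \<notin> Box N}"
    by auto
  show "b + v - v = b" by simp
qed (use assms in auto)

text \<open>\<open>curl\<close> runs counterclockwise around a triangle, so an edge enters with sign
  + in \<open>lft e\<close> and with sign - in \<open>rgt e\<close>; the two sides collect the same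
  terms by edges and by triangles. The layer added by \<open>Suc N\<close> contains every edge
  across which \<open>f\<close> can jump.\<close>

lemma summation_by_parts:
  fixes a :: "edge \<Rightarrow> real" and f :: "tri \<Rightarrow> real"
  assumes "\<And>T. T \<notin> tris N \<Longrightarrow> f T = 0"
  shows "(\<Sum>e\<in>edges (Suc N). a e * (f (lft e) - f (rgt e))) = (\<Sum>T\<in>tris (Suc N). f T * curl a T)"
proof -
  have f0: "x \<notin> Box N \<Longrightarrow> f (x, b) = 0" for x b
    using assms[of "(x, b)"] by (simp add: tris_def)
  have 1: "(\<Sum>x\<in>Box (Suc N). a (x, E0) * f (x - (0, 1), False))
         = (\<Sum>x\<in>Box (Suc N). a (x + (0, 1), E0) * f (x, False))"
    using sum_Box_shift[of N "\<lambda>x. a (x + (0, 1), E0) * f (x, False)" "(0, 1)"] f0 by simp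
  have 2: "(\<Sum>x\<in>Box (Suc N). a (x, E1) * f (x - (1, 0), False))
         = (\<Sum>x\<in>Box (Suc N). a (x + (1, 0), E1) * f (x, False))"
    using sum_Box_shift[of N "\<lambda>x. a (x + (1, 0), E1) * f (x, False)" "(1, 0)"] f0 by simp
  show ?thesis
    unfolding sum_edges sum_tris using 1 2
    by (simp add: algebra_simps sum.distrib sum_subtractf)
qed

text \<open>Truncated logarithms are constant, not zero, far out. As the total curl vanishes, the
  constant can be subtracted at no cost.\<close>

lemma summation_by_parts_const:
  fixes a :: "edge \<Rightarrow> real" and f :: "tri \<Rightarrow> real"
  assumes "\<And>T. T \<notin> tris N \<Longrightarrow> f T = c"
    and "(\<Sum>T\<in>tris (Suc N). curl a T) = 0"
  shows "(\<Sum>e\<in>edges (Suc N). a e * (f (lft e) - f (rgt e))) = (\<Sum>T\<in>tris (Suc N). f T * curl a T)"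
  using summation_by_parts[of N "\<lambda>T. f T - c" a] assms
  by (simp add: algebra_simps sum_subtractf flip: sum_distrib_left)

lemma lft_rgt_supn:
  "supn (fst (lft e)) \<ge> supn (fst e) - 1" "supn (fst (rgt e)) \<ge> supn (fst e) - 1"
  "supn (fst (lft e)) \<le> supn (fst e) + 1" "supn (fst (rgt e)) \<le> supn (fst e) + 1"
  by (cases e; cases "snd e"; auto simp: supn_def)+

text \<open>Stokes: the indicator of a large box does not jump across any edge on which
  \<open>a\<close> is nonzero.\<close>

lemma sum_curl_finite_support:
  assumes "\<And>e. e \<notin> edges N \<Longrightarrow> a e = 0" and "M \<ge> N + 2"
  shows "(\<Sum>T\<in>tris M. curl a T) = 0"
proof -
  define f where "f = (\<lambda>T. if T \<in> tris M then 1 else 0 :: real)"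
  have "a e * (f (lft e) - f (rgt e)) = 0" for e
  proof (cases "e \<in> edges N")
    case True
    then have "lft e \<in> tris M" "rgt e \<in> tris M"
      using lft_rgt_supn[of e] assms(2) by (auto simp: mem_edges mem_tris)
    then show ?thesis by (simp add: f_def)
  qed (use assms in auto)
  then have "(\<Sum>e\<in>edges (Suc M). a e * (f (lft e) - f (rgt e))) = 0"
    by (intro sum.neutral) blast
  moreover have "(\<Sum>e\<in>edges (Suc M). a e * (f (lft e) - f (rgt e)))
      = (\<Sum>T\<in>tris (Suc M). f T * curl a T)"
    by (rule summation_by_parts) (simp add: f_def)
  ultimately have "0 = (\<Sum>T\<in>tris (Suc M). f T * curl a T)" by simp
  also have "\<dots> = (\<Sum>T\<in>tris M. curl a T)"
    by (rule sum.mono_neutral_cong_right) (auto simp: f_def mem_tris)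
  finally show ?thesis by simp
qed

lemma wrap_bounds: "\<bar>wrap t\<bar> \<le> 1/2"
  unfolding wrap_def using of_int_round_abs_le[of t] by (simp add: abs_minus_commute)

lemma wrap_Ints: "t - wrap t \<in> \<int>"
  by (simp add: wrap_def)

lemma wrap_unique:
  assumes "t - a \<in> \<int>" "\<bar>a\<bar> < 1/2" shows "wrap t = a"
proof -
  from assms(1) obtain k where k: "t - a = of_int k" by (auto elim: Ints_cases)
  have "round t = k"
    by (rule round_unique') (use k assms(2) in \<open>auto simp: abs_if split: if_splits\<close>)
  then show ?thesis using k by (simp add: wrap_def)
qed

lemma curl_grad: "curl (grad y) T = 0"
  by (cases T; cases "snd T") (auto simp: grad_def add_ac)

lemma curl_diff: "curl (\<lambda>e. a e - b e) T = curl a T - curl b T"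
  by (cases T; cases "snd T") (auto simp: algebra_simps)

lemma curl_Ints:
  assumes "\<And>e. a e \<in> \<int>" shows "curl a T \<in> \<int>"
  by (cases T; cases "snd T") (use assms in auto)

lemma curl_Ints_congruent:
  assumes "\<And>e. grad y e - a e \<in> \<int>" shows "curl a T \<in> \<int>"
proof -
  have "curl (\<lambda>e. grad y e - a e) T \<in> \<int>" by (rule curl_Ints) (use assms in auto)
  then show ?thesis by (simp add: curl_diff curl_grad)
qed

section \<open>The angle function of a single dislocation\<close>

text \<open>Positions are shifted so that the origin is the centroid of the triangle \<open>(0, True)\<close>; by
  translation invariance this choice is immaterial.\<close>

definition omega :: complex where "omega = Complex (1/2) (sqrt 3 / 2)"
definition offs :: complex where "offs = (1 + omega) / 3"
definition lpos :: "lpt \<Rightarrow> complex" where "lpos x = of_int (fst x) + of_int (snd x) * omega"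
definition site :: "lpt \<Rightarrow> complex" where "site x = lpos x - offs"

text \<open>\<open>offs\<close> is the centroid of the triangle 0, 1, \<open>omega\<close>. With the
  vertices placed at \<open>site x\<close>, the centroid of \<open>(x, True)\<close> is therefore
  the lattice vector \<open>lpos x\<close> itself.\<close>

fun cen :: "tri \<Rightarrow> complex" where
  "cen (x, True) = lpos x"
| "cen (x, False) = lpos x + offs"

lemma Re_omega [simp]: "Re omega = 1/2" and Im_omega [simp]: "Im omega = sqrt 3 / 2"
  by (simp_all add: omega_def)

lemma lpos_add: "lpos (x + y) = lpos x + lpos y"
  by (simp add: lpos_def algebra_simps)

lemma lpos_diff: "lpos (x - y) = lpos x - lpos y"
  by (simp add: lpos_def algebra_simps)

lemma lpos_simps [simp]: "lpos 0 = 0" "lpos (a, 0) = of_int a" "lpos (0, a) = of_int a * omega"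
  by (simp_all add: lpos_def)

lemma site_add: "site (x + y) = site x + lpos y"
  by (simp add: site_def lpos_add)

lemma cmod_lpos: "(cmod (lpos x))\<^sup>2 = of_int ((fst x)\<^sup>2 + fst x * snd x + (snd x)\<^sup>2)"
proof -
  have "(cmod (lpos x))\<^sup>2 = (real_of_int (fst x) + real_of_int (snd x) / 2)\<^sup>2
      + (real_of_int (snd x))\<^sup>2 * (sqrt 3)\<^sup>2 / 4"
    by (simp add: cmod_power2 lpos_def power_mult_distrib power_divide)
  then show ?thesis by (simp add: power2_eq_square field_simps)
qed

text \<open>Completing the square in either variable bounds the form m^2 + m n + n^2 below by 3/4 of
  the larger square; 4/5 is a rational number below sqrt 3 / 2.\<close>

lemma cmod_lpos_ge: "cmod (lpos x) \<ge> 4/5 * of_int (supn x)"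
proof (rule power2_le_imp_le)
  obtain m n where x: "x = (m, n)" by fastforce
  have "3 * m\<^sup>2 \<le> 4 * (m\<^sup>2 + m * n + n\<^sup>2)"
    using zero_le_power2[of "m + 2 * n"] by (simp add: power2_eq_square algebra_simps)
  moreover have "3 * n\<^sup>2 \<le> 4 * (m\<^sup>2 + m * n + n\<^sup>2)"
    using zero_le_power2[of "2 * m + n"] by (simp add: power2_eq_square algebra_simps)
  ultimately have "3 * (supn x)\<^sup>2 \<le> 4 * (m\<^sup>2 + m * n + n\<^sup>2)"
    by (auto simp: supn_def x max_def)
  then have "real_of_int (3 * (supn x)\<^sup>2) \<le> real_of_int (4 * (m\<^sup>2 + m * n + n\<^sup>2))"
    by (simp only: of_int_le_iff)
  then have "(4/5)\<^sup>2 * (real_of_int (supn x))\<^sup>2 \<le> (cmod (lpos x))\<^sup>2"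
    unfolding cmod_lpos by (simp add: x power2_eq_square) 
      (smt (verit, best) zero_le_square)
  then show "(4/5 * real_of_int (supn x))\<^sup>2 \<le> (cmod (lpos x))\<^sup>2"
    by (simp only: power_mult_distrib)
qed simp

lemma cmod_lpos_le: "cmod (lpos x) \<le> 2 * of_int (supn x)"
proof -
  have om1: "cmod omega = 1"
    by (simp add: omega_def cmod_def power_divide)
  have "cmod (lpos x) \<le> \<bar>of_int (fst x)\<bar> + \<bar>of_int (snd x)\<bar>"
    unfolding lpos_def using norm_triangle_ineq[of "of_int (fst x)" "of_int (snd x) * omega"]
    by (simp add: norm_mult om1)
  also have "\<dots> \<le> 2 * of_int (supn x)"
    unfolding supn_def by (simp add: max_def flip: of_int_abs of_int_add of_int_mult)
  finally show ?thesis .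
qed

lemma offs_norm: "(cmod offs)\<^sup>2 = 1/3"
  by (simp add: cmod_power2 offs_def power_divide)

lemma offs_le: "cmod offs \<le> 3/5"
  by (rule power2_le_imp_le) (simp_all add: offs_norm power_divide)

lemma cmod_site: "(cmod (site x))\<^sup>2
   = of_int ((fst x)\<^sup>2 + fst x * snd x + (snd x)\<^sup>2 - fst x - snd x) + 1/3"
proof -
  define m n where "m = real_of_int (fst x)" and "n = real_of_int (snd x)"
  have s3: "sqrt 3 * sqrt 3 = (3::real)" "sqrt 3 * (sqrt 3 * r) = 3 * r" for r :: real by auto
  have "Re (site x) = m + n / 2 - 1/2" "Im (site x) = sqrt 3 * (n / 2 - 1 / 6)"
    by (simp_all add: site_def offs_def lpos_def m_def n_def field_simps)
  then have "(cmod (site x))\<^sup>2 = (m + n / 2 - 1/2)\<^sup>2 + 3 * (n / 2 - 1 / 6)\<^sup>2"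
    by (simp add: cmod_power2 power_mult_distrib)
  also have "\<dots> = m\<^sup>2 + m * n + n\<^sup>2 - m - n + 1/3"
    by (simp add: power2_eq_square field_simps)
  finally show ?thesis by (simp add: m_def n_def)
qed

abbreviation near :: "lpt set" where "near \<equiv> {(0, 0), (1, 0), (0, 1)}"

text \<open>Up to the summand 1/3 this form is the squared distance of a vertex from the core
  centre. The bound is the gap between the three vertices of the core triangle, at squared distance
  1/3, and all others, at squared distance at least 4/3.\<close>

lemma near_quadratic:
  fixes m n :: int
  shows "(m, n) \<notin> near \<Longrightarrow> m\<^sup>2 + m * n + n\<^sup>2 - m - n \<ge> 1"
proof (rule ccontr)
  assume nn: "(m, n) \<notin> near" and "\<not> m\<^sup>2 + m * n + n\<^sup>2 - m - n \<ge> 1"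
  then have le: "4 * (m\<^sup>2 + m * n + n\<^sup>2 - m - n) \<le> 0" by simp
  have id: "4 * (m\<^sup>2 + m * n + n\<^sup>2 - m - n) = (2 * m + n - 1)\<^sup>2 + (3 * n + 1) * (n - 1)"
    by (simp add: power2_eq_square algebra_simps)
  have "n \<ge> 2 \<or> n \<le> -1 \<or> n = 0 \<or> n = 1" by arith
  then show False
  proof (elim disjE)
    assume "n \<ge> 2"
    then have "(3 * n + 1) * (n - 1) > 0" by simp
    then show False using id le zero_le_power2[of "2 * m + n - 1"] by linarith
  next
    assume "n \<le> -1"
    then have "(3 * n + 1) * (n - 1) > 0" by (intro mult_neg_neg) auto
    then show False using id le zero_le_power2[of "2 * m + n - 1"] by linarith
  next
    assume n: "n = 0"
    then have "m * (m - 1) \<le> 0" using le by (simp add: power2_eq_square algebra_simps)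
    moreover have "m * (m - 1) > 0" using nn n
      by (cases "m \<ge> 2") (auto intro: mult_neg_neg)
    ultimately show False by simp
  next
    assume n: "n = 1"
    then have "m * m \<le> 0" using le by (simp add: power2_eq_square algebra_simps)
    then have "m = 0" by (auto simp: mult_le_0_iff)
    then show False using nn n by simp
  qed
qed

lemma cmod_site_not_near: "x \<notin> near \<Longrightarrow> (cmod (site x))\<^sup>2 \<ge> 4/3"
proof -
  assume "x \<notin> near"
  then have "(fst x)\<^sup>2 + fst x * snd x + (snd x)\<^sup>2 - fst x - snd x \<ge> 1"
    using near_quadratic[of "fst x" "snd x"] by simp
  then have "real_of_int ((fst x)\<^sup>2 + fst x * snd x + (snd x)\<^sup>2 - fst x - snd x) \<ge> 1"
    by (simp only: of_int_1_le_iff)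
  then show ?thesis by (simp only: cmod_site)
qed

lemma cmod_site_ge: "(cmod (site x))\<^sup>2 \<ge> 1/3"
  by (cases "x \<in> near") (use cmod_site_not_near[of x] in \<open>auto simp: cmod_site\<close>)

lemma site_nz [simp]: "site x \<noteq> 0"
  using cmod_site_ge[of x] by auto

definition evec :: "edge \<Rightarrow> complex" where "evec e = site (tgt e) - site (src e)"

lemma evec_simps [simp]: "evec (x, E0) = 1" "evec (x, E1) = omega" "evec (x, E2) = omega - 1"
  by (simp_all add: evec_def site_add)

lemma cmod_evec [simp]: "cmod (evec e) = 1"
  by (cases e; cases "snd e") (auto simp: cmod_def power_divide)

text \<open>The dual of an edge is the edge turned by 90 degrees and scaled by 1 / sqrt 3. This
  makes log increments across an edge conjugate to angle increments along it.\<close>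

lemma cen_lft: "cen (lft e) = cen (rgt e) + \<i> * evec e / sqrt 3"
proof -
  have s: "1 / sqrt 3 = sqrt 3 / 3" by (simp add: real_div_sqrt divide_eq_eq)
  show ?thesis
    by (cases e; cases "snd e")
      (auto simp: lpos_diff offs_def complex_eq_iff s field_simps)
qed

lemma src_cen: "cmod (site (src e) - cen (rgt e)) \<le> 3/5"
proof -
  have "site (src e) - cen (rgt e) \<in> {omega - 2 * offs, - offs, 1 - 2 * offs}"
    by (cases e; cases "snd e") (auto simp: site_def lpos_add lpos_diff)
  moreover have "cmod (omega - 2 * offs) \<le> 3/5" "cmod (1 - 2 * offs) \<le> 3/5"
    by (rule power2_le_imp_le; simp add: offs_def cmod_power2 power_divide power_mult_distrib)+
  ultimately show ?thesis using offs_le by auto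
qed

definition angle :: "lpt \<Rightarrow> real" where "angle x = Im (Ln (site x)) / (2 * pi)"
text \<open>The angle is taken from the quotient of the two end points, so that the branch cut of
  \<open>angle\<close> leaves no trace.\<close>

definition aform :: "edge \<Rightarrow> real" where
  "aform e = Im (Ln (site (tgt e) / site (src e))) / (2 * pi)"

lemma angle_aform_Ints: "grad angle e - aform e \<in> \<int>"
proof -
  define a b where "a = site (src e)" and "b = site (tgt e)"
  have nz: "a \<noteq> 0" "b \<noteq> 0" by (simp_all add: a_def b_def)
  have "exp (Ln b - Ln a) = exp (Ln (b / a))"
    using nz by (simp add: exp_diff)
  then obtain k :: int where "Ln b - Ln a = Ln (b / a) + of_int (2 * k) * pi * \<i>"
    by (auto simp: exp_eq)
  then have "Im (Ln b) - Im (Ln a) = Im (Ln (b / a)) + 2 * pi * of_int k"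
    by (simp add: complex_eq_iff)
  then have "grad angle e - aform e = of_int k"
    by (simp add: grad_def angle_def aform_def a_def b_def field_simps)
  then show ?thesis by simp
qed

lemma Im_Ln_bound:
  assumes "w \<noteq> 0" "Re w \<ge> - (1/2) * cmod w" shows "\<bar>Im (Ln w)\<bar> \<le> 2 * pi / 3"
proof (rule ccontr)
  assume "\<not> \<bar>Im (Ln w)\<bar> \<le> 2 * pi / 3"
  moreover have "\<bar>Im (Ln w)\<bar> \<le> pi" using mpi_less_Im_Ln[of w] Im_Ln_le_pi[of w] assms by auto
  ultimately have "cos \<bar>Im (Ln w)\<bar> < cos (2 * pi / 3)"
    by (intro cos_monotone_0_pi) auto
  then have "cos (Im (Ln w)) < - (1/2)" by (simp add: cos_120)
  moreover have "Re w = cmod w * cos (Im (Ln w))"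
    using assms(1) by (metis Re_exp Re_Ln exp_Ln exp_ln zero_less_norm_iff)
  ultimately have "Re w < - (1/2) * cmod w"
    using assms(1) mult_strict_left_mono[of "cos (Im (Ln w))" "- (1/2)" "cmod w"] by simp
  then show False using assms(2) by simp
qed

lemma Im_Ln_bound_strict:
  assumes "w \<noteq> 0" "Re w > - (1/2) * cmod w" shows "\<bar>Im (Ln w)\<bar> < 2 * pi / 3"
proof -
  have "\<bar>Im (Ln w)\<bar> \<noteq> 2 * pi / 3"
  proof
    assume "\<bar>Im (Ln w)\<bar> = 2 * pi / 3"
    then have "cos (Im (Ln w)) = - (1/2)" by (metis cos_120 cos_abs_real minus_divide_left)
    moreover have "Re w = cmod w * cos (Im (Ln w))"
      using assms(1) by (metis Re_exp Re_Ln exp_Ln exp_ln zero_less_norm_iff)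
    ultimately show False using assms(2) by simp
  qed
  then show ?thesis using Im_Ln_bound[of w] assms by auto
qed

text \<open>The law of cosines in the triangle 0, a, b, whose side opposite to 0 has length
  1.\<close>

lemma quotient_Re:
  assumes "cmod (b - a) = 1" "a \<noteq> 0" "b \<noteq> 0"
  shows "Re (b / a) = ((cmod a)\<^sup>2 + (cmod b)\<^sup>2 - 1) / (2 * (cmod a)\<^sup>2)"
proof -
  have "(cmod (b - a))\<^sup>2 = (cmod a)\<^sup>2 + (cmod b)\<^sup>2 - 2 * (Re b * Re a + Im b * Im a)"
    unfolding cmod_power2 by (simp add: power2_eq_square algebra_simps)
  then have "Re b * Re a + Im b * Im a = ((cmod a)\<^sup>2 + (cmod b)\<^sup>2 - 1) / 2"
    using assms by simp
  moreover have "Re (b / a) = (Re b * Re a + Im b * Im a) / (cmod a)\<^sup>2"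
    by (simp add: Re_divide cmod_power2)
  ultimately show ?thesis by (simp only: divide_divide_eq_left)
qed

text \<open>The criterion for the bond to be seen from 0 under an angle of at most, or less than,
  120 degrees. Equality holds for |a| = |b| = 1 / sqrt 3, that is, for the sides of the core
  triangle.\<close>

lemma quotient_ge:
  assumes "cmod (b - a) = 1" "a \<noteq> 0" "b \<noteq> 0"
  shows "(Re (b / a) \<ge> - (1/2) * cmod (b / a)) \<longleftrightarrow> (cmod a)\<^sup>2 + (cmod b)\<^sup>2 + cmod a * cmod b \<ge> 1"
    and "(Re (b / a) > - (1/2) * cmod (b / a)) \<longleftrightarrow> (cmod a)\<^sup>2 + (cmod b)\<^sup>2 + cmod a * cmod b > 1"
  using assms(2,3) unfolding quotient_Re[OF assms] norm_divide
  by (auto simp: field_simps power2_eq_square)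

lemma aform_le: "\<bar>aform e\<bar> \<le> 1/3"
proof -
  define a b where "a = site (src e)" and "b = site (tgt e)"
  have nz: "a \<noteq> 0" "b \<noteq> 0" "cmod (b - a) = 1"
    using cmod_evec[of e] by (simp_all add: a_def b_def evec_def)
  have ab: "(cmod a)\<^sup>2 \<ge> 1/3" "(cmod b)\<^sup>2 \<ge> 1/3"
    using cmod_site_ge by (auto simp: a_def b_def)
  have "(1/3)\<^sup>2 \<le> (cmod a)\<^sup>2 * (cmod b)\<^sup>2"
    using mult_mono[OF ab] by (simp add: power2_eq_square)
  then have "1/3 \<le> cmod a * cmod b"
    unfolding power_mult_distrib[symmetric] by (rule power2_le_imp_le) simp
  then have "\<bar>Im (Ln (b / a))\<bar> \<le> 2 * pi / 3"
    using nz ab by (intro Im_Ln_bound iffD2[OF quotient_ge(1)]) auto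
  then show ?thesis by (simp add: aform_def a_def b_def field_simps)
qed

lemma aform_less:
  assumes "src e \<notin> near \<or> tgt e \<notin> near" shows "\<bar>aform e\<bar> < 1/3"
proof -
  define a b where "a = site (src e)" and "b = site (tgt e)"
  have nz: "a \<noteq> 0" "b \<noteq> 0" "cmod (b - a) = 1"
    using cmod_evec[of e] by (simp_all add: a_def b_def evec_def)
  have "(cmod a)\<^sup>2 \<ge> 4/3 \<or> (cmod b)\<^sup>2 \<ge> 4/3"
    using cmod_site_not_near assms unfolding a_def b_def by blast
  moreover have "0 \<le> cmod a * cmod b" "0 \<le> (cmod a)\<^sup>2" "0 \<le> (cmod b)\<^sup>2" by simp_all
  ultimately have "(cmod a)\<^sup>2 + (cmod b)\<^sup>2 + cmod a * cmod b > 1"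
    by linarith
  then have "\<bar>Im (Ln (b / a))\<bar> < 2 * pi / 3"
    using nz by (intro Im_Ln_bound_strict iffD2[OF quotient_ge(2)]) auto
  then show ?thesis by (simp add: aform_def a_def b_def field_simps)
qed

lemma wrap_angle: "wrap (grad angle e) = aform e"
  by (rule wrap_unique) (use angle_aform_Ints[of e] aform_le[of e] in auto)

lemma Ints_abs_less_1: "(r::real) \<in> \<int> \<Longrightarrow> \<bar>r\<bar> < 1 \<Longrightarrow> r = 0"
  by (auto elim!: Ints_cases)

text \<open>The curl is an integer, and three terms of size at most 1/3 reach modulus 1 only if all
  of them are extremal; by \<open>aform_less\<close> all vertices then lie in \<open>near\<close>.
  On the core triangle the signs of the three sides make the curl positive.\<close>

lemma curl_aform: "curl aform T = (if T = (0, True) then 1 else 0)"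
proof -
  have int: "curl aform T \<in> \<int>" by (rule curl_Ints_congruent[of angle]) (rule angle_aform_Ints)
  show ?thesis
  proof (cases "T = (0, True)")
    case False
    have "\<bar>curl aform T\<bar> < 1"
    proof (cases T)
      case (Pair x b)
      show ?thesis
      proof (cases b)
        case True
        then have "x \<notin> near \<or> x + (1, 0) \<notin> near \<or> x + (0, 1) \<notin> near"
          using False Pair by (cases x) (auto simp: zero_prod_def)
        moreover have "curl aform T = aform (x, E0) + aform (x, E2) - aform (x, E1)"
          using Pair True by simp
        ultimately show ?thesis
          using aform_less[of "(x, E0)"] aform_less[of "(x, E1)"] aform_less[of "(x, E2)"]
            aform_le[of "(x, E0)"] aform_le[of "(x, E1)"] aform_le[of "(x, E2)"]
          unfolding src.simps tgt.simps by linarith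
      next
        case F: False
        have "x + (1, 0) \<notin> near \<or> x + (0, 1) \<notin> near \<or> x + (1, 1) \<notin> near"
          by (cases x) auto
        moreover have "x + (1, 0) + (0, 1) = x + (1, 1)" "x + (0, 1) + (1, 0) = x + (1, 1)"
          by (cases x; simp)+
        moreover have "curl aform T = aform (x + (1, 0), E1) - aform (x + (0, 1), E0) - aform (x, E2)"
          using Pair F by simp
        ultimately show ?thesis
          using aform_less[of "(x + (0, 1), E0)"] aform_less[of "(x + (1, 0), E1)"] aform_less[of "(x, E2)"]
            aform_le[of "(x + (0, 1), E0)"] aform_le[of "(x + (1, 0), E1)"] aform_le[of "(x, E2)"]
          unfolding src.simps tgt.simps by (elim disjE; simp; linarith)
      qed
    qed
    then show ?thesis using int Ints_abs_less_1 False by auto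
  next
    case True
    have pos: "Im (Ln w) > 0" if "Im w > 0" for w :: complex
      using that Im_Ln_pos_lt_imp[of w] by (metis Im_Ln_pos_lt less_irrefl zero_complex.simps(2))
    have "aform (0, E0) > 0" "aform (0, E2) > 0"
      unfolding aform_def
      by (auto intro!: pos divide_pos_pos simp: Im_divide site_def offs_def lpos_def field_simps
            power2_eq_square zero_prod_def)
    moreover have "aform (0, E1) \<le> 1/3" using aform_le[of "(0, E1)"] by linarith
    ultimately have "curl aform T > - 1/3" using True by simp
    moreover have "curl aform T \<le> 1"
      using aform_le[of "(0, E0)"] aform_le[of "(0, E1)"] aform_le[of "(0, E2)"] True by simp
    moreover have "aform (0, E1) < 0"
    proof -
      have "Im (site (tgt (0, E1)) / site (src (0, E1))) < 0"
        by (simp add: Im_divide site_def offs_def lpos_def field_simps power2_eq_square zero_prod_def)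
      then have "Im (Ln (site (tgt (0, E1)) / site (src (0, E1)))) < 0"
        using Im_Ln_pos_le[of "site (tgt (0, E1)) / site (src (0, E1))"]
          Im_Ln_le_pi[of "site (tgt (0, E1)) / site (src (0, E1))"] by force
      then show ?thesis by (simp add: aform_def divide_neg_pos)
    qed
    ultimately have "0 < curl aform T" "curl aform T \<le> 1"
      using True \<open>aform (0, E0) > 0\<close> \<open>aform (0, E2) > 0\<close> by auto
    then show ?thesis using int True by (auto elim!: Ints_cases)
  qed
qed

section \<open>Decay of the angle form and its conjugate logarithm\<close>

definition rad :: "edge \<Rightarrow> real" where "rad e = 1 + of_int (supn (fst e))"

lemma rad_ge1: "rad e \<ge> 1" and rad_pos [simp]: "rad e > 0"
  unfolding rad_def using supn_ge0[of "fst e"] by linarith+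

lemma rad_ge0 [simp]: "rad e \<ge> 0" and rad_nz [simp]: "rad e \<noteq> 0"
  using rad_ge1[of e] by linarith+

definition eshift :: "lpt \<Rightarrow> edge \<Rightarrow> edge" where "eshift q e = (fst e + q, snd e)"

lemma cmod_site_supn: "cmod (site x) \<ge> 4/5 * of_int (supn x) - 3/5"
  using cmod_lpos_ge[of x] offs_le norm_triangle_ineq2[of "lpos x" offs] by (simp add: site_def)

lemma cmod_cen_supn: "cmod (cen T) \<ge> 4/5 * of_int (supn (fst T)) - 3/5"
proof (cases T)
  case (Pair x b)
  have "cmod (lpos x + offs) \<ge> cmod (lpos x) - cmod offs"
    using norm_triangle_ineq2[of "lpos x" "- offs"] by simp
  then show ?thesis
    using cmod_lpos_ge[of x] offs_le Pair by (cases b) auto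
qed

lemma cmod_cen_le: "cmod (cen T) \<le> 2 * of_int (supn (fst T)) + 3/5"
proof (cases T)
  case (Pair x b)
  show ?thesis
    using cmod_lpos_le[of x] offs_le norm_triangle_ineq[of "lpos x" offs] Pair by (cases b) auto
qed

lemma src_supn: "supn (src e) \<ge> supn (fst e) - 1"
  by (cases e; cases "snd e"; auto simp: supn_def)

text \<open>The threshold 5 gives \<open>rad e\<close> at least 6, hence relative displacements of
  at most 3 / rad e, which is at most 1/2: the range in which \<open>Ln_1_plus_approx\<close>
  applies.\<close>

lemma far_norm:
  assumes "supn (fst e) \<ge> 5"
  shows "cmod (site (src e)) \<ge> rad e / 3" "cmod (cen (lft e)) \<ge> rad e / 3"
    "cmod (cen (rgt e)) \<ge> rad e / 3" "rad e \<ge> 6"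
proof -
  have r: "real_of_int (supn (fst e)) \<ge> 5" using assms by linarith
  have "real_of_int (supn (src e)) \<ge> real_of_int (supn (fst e)) - 1"
    "real_of_int (supn (fst (lft e))) \<ge> real_of_int (supn (fst e)) - 1"
    "real_of_int (supn (fst (rgt e))) \<ge> real_of_int (supn (fst e)) - 1"
    using src_supn[of e] lft_rgt_supn[of e] by linarith+
  then show "cmod (site (src e)) \<ge> rad e / 3" "cmod (cen (lft e)) \<ge> rad e / 3"
    "cmod (cen (rgt e)) \<ge> rad e / 3" "rad e \<ge> 6"
    using r cmod_site_supn[of "src e"] cmod_cen_supn[of "lft e"] cmod_cen_supn[of "rgt e"]
    unfolding rad_def by (simp_all add: field_simps)
qed

lemma Ln_1_plus_approx:
  assumes "cmod t \<le> 1/2" shows "cmod (Ln (1 + t) - t) \<le> 2 * (cmod t)\<^sup>2"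
proof -
  have "cmod (Ln (1 + t) - t) \<le> (cmod t)\<^sup>2 / (1 - cmod t)"
    using assms by (intro Ln_approx_linear) auto
  also have "\<dots> \<le> (cmod t)\<^sup>2 / (1/2)"
    using assms by (intro divide_left_mono) auto
  finally show ?thesis by simp
qed

lemma inverse_far:
  assumes "a \<ge> rad e / 3" shows "1 / a \<le> 3 / rad e" "(1 / a)\<^sup>2 \<le> 9 / (rad e)\<^sup>2" "a > 0"
proof -
  show a: "a > 0" using assms rad_pos[of e] by linarith
  show 1: "1 / a \<le> 3 / rad e" using assms a rad_pos[of e]
    using divide_left_mono[of "rad e / 3" a 1] mult_pos_pos[OF a rad_pos[of e]] by simp
  have "(1 / a)\<^sup>2 \<le> (3 / rad e)\<^sup>2" using 1 a by (intro power_mono) auto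
  then show "(1 / a)\<^sup>2 \<le> 9 / (rad e)\<^sup>2" by (simp add: power_divide)
qed

lemma aform_approx:
  assumes "supn (fst e) \<ge> 5"
  shows "\<bar>2 * pi * aform e - Im (evec e / site (src e))\<bar> \<le> 18 / (rad e)\<^sup>2"
proof -
  define s where "s = site (src e)"
  define t where "t = evec e / s"
  note f = far_norm[OF assms, folded s_def]
  have ct: "cmod t = 1 / cmod s" by (simp add: t_def norm_divide)
  have "cmod t \<le> 3 / rad e" using ct inverse_far(1)[OF f(1)] by simp
  also have "\<dots> \<le> 1/2" using f(4) by (simp add: field_simps)
  finally have t2: "cmod t \<le> 1/2" .
  have "site (tgt e) / s = 1 + t"
    by (simp add: t_def evec_def s_def field_simps)
  then have "2 * pi * aform e = Im (Ln (1 + t))" by (simp add: aform_def s_def)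
  then have "\<bar>2 * pi * aform e - Im t\<bar> \<le> cmod (Ln (1 + t) - t)"
    using abs_Im_le_cmod[of "Ln (1 + t) - t"] by simp
  also have "\<dots> \<le> 2 * (cmod t)\<^sup>2" using t2 by (rule Ln_1_plus_approx)
  also have "\<dots> \<le> 18 / (rad e)\<^sup>2" using inverse_far(2)[OF f(1)] ct by simp
  finally show ?thesis by (simp add: t_def s_def)
qed

text \<open>The maximum with 1 removes the singularity at the core triangle, whose centre is
  0.\<close>

definition logd :: "tri \<Rightarrow> real" where "logd T = ln (max 1 (cmod (cen T)))"

text \<open>The harmonic conjugate of the angle. By \<open>cen_lft\<close> the logarithm changes
  from \<open>lft e\<close> to \<open>rgt e\<close> by about Im (evec e / z) / sqrt 3, and the
  factor sqrt 3 / (2 pi) turns this into the angle increment divided by 2 pi.\<close>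

definition lform :: "edge \<Rightarrow> real" where
  "lform e = sqrt 3 / (2 * pi) * (logd (rgt e) - logd (lft e))"

lemma logd_far: "cmod (cen T) \<ge> 1 \<Longrightarrow> logd T = ln (cmod (cen T))"
  by (simp add: logd_def max_def)

lemma cen_dist: "cmod (cen (lft e) - cen (rgt e)) = 1 / sqrt 3"
  by (simp add: cen_lft norm_mult norm_divide)

lemma inv_sqrt3_le: "1 / sqrt 3 \<le> (1::real)"
  by simp

lemma lform_approx:
  assumes "supn (fst e) \<ge> 5"
  shows "\<bar>2 * pi * lform e - Im (evec e / cen (rgt e))\<bar> \<le> 12 / (rad e)\<^sup>2"
proof -
  define s where "s = cen (rgt e)"
  define t where "t = \<i> * evec e / (sqrt 3 * s)"
  note f = far_norm[OF assms, folded s_def]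
  have s0: "s \<noteq> 0" "cmod s \<ge> 1" "cmod (cen (lft e)) \<ge> 1" using f by auto
  have ct: "cmod t = 1 / sqrt 3 * (1 / cmod s)" by (simp add: t_def norm_divide norm_mult)
  have ct2: "(cmod t)\<^sup>2 = 1 / 3 * (1 / cmod s)\<^sup>2" unfolding ct by (simp add: power_mult_distrib power_divide)
  have "cmod t \<le> 1 * (1 / cmod s)" unfolding ct by (intro mult_right_mono inv_sqrt3_le) simp
  also have "\<dots> \<le> 3 / rad e" using inverse_far(1)[OF f(3)] by simp
  also have "\<dots> \<le> 1/2" using f(4) by (simp add: field_simps)
  finally have t2: "cmod t \<le> 1/2" .
  have L: "cen (lft e) = s * (1 + t)"
    using s0 by (simp add: cen_lft t_def s_def field_simps)
  have nz: "1 + t \<noteq> 0" using L s0 by auto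
  have "logd (lft e) - logd (rgt e) = ln (cmod (1 + t))"
    using s0 nz by (simp add: logd_far s_def[symmetric]) (simp add: L norm_mult ln_mult)
  also have "\<dots> = Re (Ln (1 + t))" using nz by simp
  finally have 1: "2 * pi * lform e = - sqrt 3 * Re (Ln (1 + t))"
    by (simp add: lform_def field_simps)
  have it: "sqrt 3 * Re t = - Im (evec e / s)"
  proof -
    have "t = \<i> * (evec e / s) / of_real (sqrt 3)" by (simp add: t_def)
    then have "Re t = - Im (evec e / s) / sqrt 3" by (simp only: Re_divide_of_real Re_i_times)
    then show ?thesis by simp
  qed
  have "\<bar>2 * pi * lform e - Im (evec e / s)\<bar> = sqrt 3 * \<bar>Re (Ln (1 + t) - t)\<bar>"
  proof -
    have "2 * pi * lform e - Im (evec e / s) = - (sqrt 3 * Re (Ln (1 + t) - t))"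
      unfolding 1 using it by (simp add: algebra_simps)
    then show ?thesis by (simp add: abs_mult)
  qed
  also have "\<dots> \<le> 2 * cmod (Ln (1 + t) - t)"
    by (intro mult_mono abs_Re_le_cmod) (auto simp: real_le_lsqrt)
  also have "\<dots> \<le> 2 * (2 * (cmod t)\<^sup>2)" using Ln_1_plus_approx[OF t2] by simp
  also have "\<dots> \<le> 12 / (rad e)\<^sup>2" using inverse_far(2)[OF f(3)] ct2 by simp
  finally show ?thesis by (simp add: s_def)
qed

lemma inverse_diff_bound:
  fixes a b h :: complex
  assumes "a \<noteq> 0" "b \<noteq> 0" "cmod h = 1" "1 / cmod a \<le> A" "1 / cmod b \<le> B"
  shows "\<bar>Im (h / a) - Im (h / b)\<bar> \<le> cmod (a - b) * (A * B)"
proof -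
  have "h / a - h / b = h * (b - a) / (a * b)" using assms by (simp add: field_simps)
  then have "cmod (h / a - h / b) = cmod (a - b) * ((1 / cmod a) * (1 / cmod b))"
    using assms by (simp add: norm_mult norm_divide norm_minus_commute)
  also have "\<dots> \<le> cmod (a - b) * (A * B)"
    using assms by (intro mult_left_mono mult_mono) (auto intro: order_trans[rotated])
  finally show ?thesis using abs_Im_le_cmod[of "h / a - h / b"] by simp
qed

lemma logd_diff:
  "\<bar>logd (lft e) - logd (rgt e)\<bar> \<le> 1 / max 1 (min (cmod (cen (lft e))) (cmod (cen (rgt e))))"
proof -
  have key: "\<bar>ln (max 1 a) - ln (max 1 b)\<bar> \<le> 1 / max 1 (min a b)" if "\<bar>a - b\<bar> \<le> 1" "b \<le> a"
    for a b :: real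
  proof -
    define A B where "A = max 1 a" and "B = max 1 b"
    have AB: "B \<le> A" "1 \<le> B" "A - B \<le> 1" using that by (auto simp: A_def B_def)
    have "ln A - ln B = ln (A / B)" using AB by (simp add: ln_div)
    also have "\<dots> \<le> A / B - 1" using AB by (intro ln_le_minus_one) auto
    also have "\<dots> = (A - B) / B" using AB by (simp add: field_simps)
    also have "\<dots> \<le> 1 / B" using AB by (intro divide_right_mono) auto
    finally have "ln A - ln B \<le> 1 / B" .
    moreover have "ln B \<le> ln A" using AB by simp
    ultimately have "\<bar>ln A - ln B\<bar> \<le> 1 / B" by linarith
    then show ?thesis using that by (simp add: A_def B_def min_absorb2)
  qed
  have d: "\<bar>cmod (cen (lft e)) - cmod (cen (rgt e))\<bar> \<le> 1"
    using norm_triangle_ineq3[of "cen (lft e)" "cen (rgt e)"] cen_dist[of e] inv_sqrt3_le by linarith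
  show ?thesis
    using key[of "cmod (cen (lft e))" "cmod (cen (rgt e))"] key[of "cmod (cen (rgt e))" "cmod (cen (lft e))"] d
    unfolding logd_def
    by (cases "cmod (cen (rgt e)) \<le> cmod (cen (lft e))") (auto simp: abs_minus_commute min.commute)
qed

lemma logd_diff_1: "\<bar>logd (lft e) - logd (rgt e)\<bar> \<le> 1"
  by (rule order_trans[OF logd_diff]) simp

lemma logd_diff_rad: "\<bar>logd (lft e) - logd (rgt e)\<bar> \<le> 6 / rad e"
proof (cases "supn (fst e) \<ge> 5")
  case True
  note f = far_norm[OF True]
  have "1 / max 1 (min (cmod (cen (lft e))) (cmod (cen (rgt e)))) \<le> 3 / rad e"
    using f rad_pos[of e] by (intro inverse_far) auto
  also have "\<dots> \<le> 6 / rad e" using rad_pos[of e] by (intro divide_right_mono) auto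
  finally show ?thesis using logd_diff[of e] by linarith
next
  case False
  then have "rad e \<le> 6" unfolding rad_def by linarith
  then have "1 \<le> 6 / rad e" using rad_pos[of e] by (simp add: field_simps)
  then show ?thesis using logd_diff_1[of e] by linarith
qed

lemma sqrt3_2pi: "0 \<le> sqrt 3 / (2 * pi)" "sqrt 3 / (2 * pi) \<le> 1/3"
proof -
  have "sqrt 3 \<le> (2::real)" by (simp add: real_le_lsqrt)
  then show "0 \<le> sqrt 3 / (2 * pi)" "sqrt 3 / (2 * pi) \<le> 1/3"
    using pi_gt3 by (simp_all add: field_simps)
qed

lemma aform_decay: "\<bar>aform e\<bar> \<le> 2 / rad e"
proof (cases "supn (fst e) \<ge> 5")
  case True
  define s where "s = site (src e)"
  note f = far_norm[OF True, folded s_def]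
  have "\<bar>Im (evec e / s)\<bar> \<le> 1 / cmod s"
    using abs_Im_le_cmod[of "evec e / s"] by (simp add: norm_divide)
  also have "\<dots> \<le> 3 / rad e" using inverse_far(1)[OF f(1)] .
  finally have "\<bar>2 * pi * aform e\<bar> \<le> 3 / rad e + 18 / (rad e)\<^sup>2"
    using aform_approx[OF True] unfolding s_def by linarith
  also have "18 / (rad e)\<^sup>2 \<le> 3 / rad e"
    using f(4) by (simp add: field_simps power2_eq_square)
  finally have "2 * pi * \<bar>aform e\<bar> \<le> 6 / rad e" by (simp add: abs_mult)
  moreover have "2 * 3 * \<bar>aform e\<bar> \<le> 2 * pi * \<bar>aform e\<bar>"
    using pi_gt3 by (intro mult_right_mono) auto
  ultimately have "6 * \<bar>aform e\<bar> \<le> 6 / rad e" by linarith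
  then show ?thesis using rad_pos[of e] by (simp add: field_simps)
next
  case False
  then have "rad e \<le> 6" unfolding rad_def by linarith
  then have "1/3 \<le> 2 / rad e" using rad_pos[of e] by (simp add: field_simps)
  then show ?thesis using aform_le[of e] by linarith
qed

text \<open>Both forms are Im (evec e / z) / (2 pi) up to a quadratic error, with z the source
  vertex for one and the right centre for the other, at distance at most 3/5. The square of the
  error decays like \<open>rad\<close> to the power -4 and is summable.\<close>

lemma aform_lform: "\<bar>aform e - lform e\<bar> \<le> 36 / (rad e)\<^sup>2"
proof (cases "supn (fst e) \<ge> 5")
  case True
  note f = far_norm[OF True]
  have "\<bar>Im (evec e / site (src e)) - Im (evec e / cen (rgt e))\<bar>
      \<le> cmod (site (src e) - cen (rgt e)) * ((3 / rad e) * (3 / rad e))"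
    using inverse_far[OF f(1)] inverse_far[OF f(3)]
    by (intro inverse_diff_bound) auto
  also have "\<dots> \<le> 1 * ((3 / rad e) * (3 / rad e))"
    using src_cen[of e] by (intro mult_right_mono) auto
  also have "\<dots> = 9 / (rad e)\<^sup>2" by (simp add: power2_eq_square)
  finally have "\<bar>2 * pi * aform e - 2 * pi * lform e\<bar> \<le> 18 / (rad e)\<^sup>2 + 12 / (rad e)\<^sup>2 + 9 / (rad e)\<^sup>2"
    using aform_approx[OF True] lform_approx[OF True] by linarith
  also have "\<dots> = 39 / (rad e)\<^sup>2" by (simp add: field_simps)
  finally have "2 * pi * \<bar>aform e - lform e\<bar> \<le> 39 / (rad e)\<^sup>2"
    by (simp add: abs_mult flip: right_diff_distrib)
  moreover have "2 * 3 * \<bar>aform e - lform e\<bar> \<le> 2 * pi * \<bar>aform e - lform e\<bar>"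
    using pi_gt3 by (intro mult_right_mono) auto
  ultimately have "6 * \<bar>aform e - lform e\<bar> \<le> 39 / (rad e)\<^sup>2" by linarith
  also have "\<dots> \<le> 6 * (36 / (rad e)\<^sup>2)"
    unfolding times_divide_eq_right by (intro divide_right_mono) auto
  finally show ?thesis by simp
next
  case False
  then have "rad e \<le> 6" unfolding rad_def by linarith
  then have "(rad e)\<^sup>2 \<le> 6\<^sup>2" using rad_pos[of e] by (intro power_mono) auto
  then have "1 \<le> 36 / (rad e)\<^sup>2" using rad_pos[of e] by (simp add: field_simps)
  moreover have "\<bar>lform e\<bar> \<le> 1/3 * 1"
    unfolding lform_def abs_mult using sqrt3_2pi logd_diff_1[of e]
    by (intro mult_mono) (auto simp: abs_minus_commute)
  ultimately show ?thesis using aform_le[of e] by linarith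
qed

text \<open>A translation by q changes 1/z by O(|q| / |z|^2). Hence moving the core costs a
  difference that is small at infinity, which controls the far field in
  \<open>gamma_bound\<close>.\<close>

lemma aform_shift_diff: "\<exists>C>0. \<forall>e. \<bar>aform (eshift q e) - aform e\<bar> \<le> C / (rad e)\<^sup>2"
proof -
  define Q where "Q = 2 * real_of_int (supn q)"
  have Q0: "Q \<ge> 0" by (simp add: Q_def)
  define C where "C = 90 + 18 * Q + (6 + Q)\<^sup>2"
  have "\<bar>aform (eshift q e) - aform e\<bar> \<le> C / (rad e)\<^sup>2" for e
  proof (cases "supn (fst e) \<ge> 5 + 2 * supn q")
    case True
    let ?e = "eshift q e"
    have e5: "supn (fst e) \<ge> 5" using True supn_ge0[of q] by linarith
    have sne: "supn (fst ?e) \<ge> supn (fst e) - supn q"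
      using supn_diff[of "fst e + q" q] by (simp add: eshift_def)
    then have e5': "supn (fst ?e) \<ge> 5" using True supn_ge0[of q] by linarith
    have "2 * supn (fst ?e) \<ge> supn (fst e)" using sne True by linarith
    then have nr2: "rad ?e \<ge> rad e / 2" unfolding rad_def
      using of_int_le_iff[of "supn (fst e)" "2 * supn (fst ?e)", where ?'a=real] by simp
    then have inv2: "3 / rad ?e \<le> 6 / rad e" 
      using rad_pos[of e] rad_pos[of ?e] by (simp add: field_simps)
    have "(rad e / 2)\<^sup>2 \<le> (rad ?e)\<^sup>2" using nr2 rad_pos[of e] by (intro power_mono) auto
    then have inv2': "18 / (rad ?e)\<^sup>2 \<le> 72 / (rad e)\<^sup>2"
      using rad_pos[of e] rad_pos[of ?e] by (simp add: field_simps)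
    have evec: "evec ?e = evec e" by (cases e; cases "snd e") (auto simp: eshift_def)
    have st: "site (src ?e) = site (src e) + lpos q"
      by (cases e; cases "snd e") (auto simp: eshift_def site_add)
    note f = far_norm[OF e5] and g = far_norm[OF e5']
    have "1 / cmod (site (src ?e)) \<le> 6 / rad e"
      using inverse_far(1)[OF g(1)] inv2 by linarith
    then have "\<bar>Im (evec e / site (src e)) - Im (evec e / site (src ?e))\<bar>
      \<le> cmod (site (src e) - site (src ?e)) * ((3 / rad e) * (6 / rad e))"
      using inverse_far[OF f(1)] by (intro inverse_diff_bound) auto
    also have "\<dots> \<le> Q * ((3 / rad e) * (6 / rad e))"
      using cmod_lpos_le[of q] rad_pos[of e] unfolding st Q_def by (intro mult_right_mono) auto
    also have "\<dots> = 18 * Q / (rad e)\<^sup>2" by (simp add: power2_eq_square)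
    finally have "\<bar>2 * pi * aform ?e - 2 * pi * aform e\<bar> \<le> 18 / (rad e)\<^sup>2 + 72 / (rad e)\<^sup>2 + 18 * Q / (rad e)\<^sup>2"
      using aform_approx[OF e5] aform_approx[OF e5'] inv2' unfolding evec by linarith
    also have "\<dots> = (90 + 18 * Q) / (rad e)\<^sup>2" by (simp add: field_simps)
    also have "\<dots> \<le> C / (rad e)\<^sup>2" unfolding C_def by (intro divide_right_mono) auto
    finally have "2 * pi * \<bar>aform ?e - aform e\<bar> \<le> C / (rad e)\<^sup>2"
      by (simp add: abs_mult flip: right_diff_distrib)
    moreover have "\<bar>aform ?e - aform e\<bar> \<le> 2 * pi * \<bar>aform ?e - aform e\<bar>"
      using mult_right_mono[of 1 "2 * pi" "\<bar>aform ?e - aform e\<bar>"] pi_gt3 by simp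
    ultimately show ?thesis by (rule order_trans[rotated])
  next
    case False
    then have "rad e \<le> 6 + Q" unfolding rad_def Q_def by linarith
    then have "(rad e)\<^sup>2 \<le> (6 + Q)\<^sup>2" using rad_pos[of e] by (intro power_mono) auto
    also have "\<dots> \<le> C" using Q0 by (simp add: C_def)
    finally have "1 \<le> C / (rad e)\<^sup>2" using rad_pos[of e] by (simp add: field_simps)
    then show ?thesis using aform_le[of e] aform_le[of "eshift q e"] by linarith
  qed
  moreover have "C > 0" using Q0 by (simp add: C_def add_pos_nonneg)
  ultimately show ?thesis by blast
qed

lemma sum_edges_cube: "(\<Sum>e\<in>edges N. 1 / (rad e)^3) \<le> 27"
proof -
  \<comment> \<open>At N = 0 the bound is 3, for three edges with \<open>rad\<close> 1. The next
    shell has 24 (N + 1) edges with \<open>rad\<close> N + 2, and its contribution is at most the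
    telescoping difference 24 / ((N + 1) (N + 2)).\<close>
  have "(\<Sum>e\<in>edges N. 1 / (rad e)^3) \<le> 27 - 24 / (real N + 1)"
  proof (induction N)
    case 0
    have "edges 0 = {((0,0), E0), ((0,0), E1), ((0,0), E2)}"
      by (auto simp: edges_def Box_def UNIV_dir)
    then show ?case by (simp add: rad_def supn_def)
  next
    case (Suc N)
    have sub: "edges N \<subseteq> edges (Suc N)" by (auto simp: mem_edges)
    have "(\<Sum>e\<in>edges (Suc N). 1 / (rad e)^3)
        = (\<Sum>e\<in>edges N. 1 / (rad e)^3) + (\<Sum>e\<in>edges (Suc N) - edges N. 1 / (rad e)^3)"
      using sub by (simp add: sum.subset_diff)
    also have "(\<Sum>e\<in>edges (Suc N) - edges N. 1 / (rad e)^3)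
        = (\<Sum>e\<in>edges (Suc N) - edges N. 1 / (real N + 2)^3)"
    proof (rule sum.cong)
      fix e assume "e \<in> edges (Suc N) - edges N"
      then have "supn (fst e) = int N + 1" by (auto simp: mem_edges)
      then have "rad e = real N + 2" by (simp add: rad_def)
      then show "1 / (rad e)^3 = 1 / (real N + 2)^3" by simp
    qed simp
    also have "\<dots> = real (card (edges (Suc N) - edges N)) * (1 / (real N + 2)^3)" by simp
    also have "card (edges (Suc N) - edges N) = 24 * (N + 1)"
      using sub by (simp add: card_Diff_subset card_edges power2_eq_square algebra_simps)
    also have "real (24 * (N + 1)) * (1 / (real N + 2)^3) \<le> 24 / ((real N + 1) * (real N + 2))"
    proof -
      define a where "a = real N + 1"
      have a: "a > 0" by (simp add: a_def)
      have "24 * a * (a * (a + 1)) \<le> 24 * (a + 1)^3"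
        using a by (simp add: power3_eq_cube algebra_simps)
      then have "24 * a / (a + 1)^3 \<le> 24 / (a * (a + 1))"
        using a by (simp add: pos_divide_le_eq pos_le_divide_eq mult.commute)
      moreover have "real (24 * (N + 1)) * (1 / (real N + 2)^3) = 24 * a / (a + 1)^3"
        by (simp add: a_def add.commute)
      moreover have "(real N + 1) * (real N + 2) = a * (a + 1)" by (simp add: a_def)
      ultimately show ?thesis by (simp only:)
    qed
    finally have "(\<Sum>e\<in>edges (Suc N). 1 / (rad e)^3)
        \<le> 27 - 24 / (real N + 1) + 24 / ((real N + 1) * (real N + 2))" using Suc by linarith
    also have "\<dots> = 27 - 24 / (real (Suc N) + 1)"
    proof -
      have "24 / (a * (a + 1)) = 24 / a - 24 / (a + 1)" if "a > 0" for a :: real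
        using that by (simp add: field_simps)
      from this[of "real N + 1"] show ?thesis by (simp add: add.commute)
    qed
    finally show ?case .
  qed
  also have "\<dots> \<le> 27" by simp
  finally show ?thesis .
qed

section \<open>Hierarchical clustering of charges\<close>

definition separated :: "('a \<Rightarrow> 'b::metric_space) \<Rightarrow> real \<Rightarrow> 'a set set \<Rightarrow> bool" where
  "separated c l P \<longleftrightarrow> (\<forall>C\<in>P. \<forall>D\<in>P. C \<noteq> D \<longrightarrow> (\<forall>x\<in>C. \<forall>y\<in>D. dist (c x) (c y) > l))"

definition spread :: "('a \<Rightarrow> 'b::metric_space) \<Rightarrow> 'a set set \<Rightarrow> real" where
  "spread c P = (\<Sum>C\<in>P. diameter (c ` C))"

lemma dist_le_diameter:
  "finite C \<Longrightarrow> x \<in> C \<Longrightarrow> y \<in> C \<Longrightarrow> dist (c x) (c y) \<le> diameter (c ` C)"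
  by (intro diameter_bounded_bound finite_imp_bounded) auto

lemma diameter_union_le:
  assumes "finite C" "finite S" "x \<in> C" "y \<in> S" "dist (c x) (c y) \<le> l"
  shows "diameter (c ` (C \<union> S)) \<le> diameter (c ` C) + diameter (c ` S) + l"
proof -
  have nn: "0 \<le> diameter (c ` C)" "0 \<le> diameter (c ` S)"
    using assms by (auto intro!: diameter_ge_0 finite_imp_bounded)
  have l0: "0 \<le> l" using assms(5) zero_le_dist order_trans by blast
  have "dist (c u) (c v) \<le> diameter (c ` C) + diameter (c ` S) + l"
    if uv: "u \<in> C \<union> S" "v \<in> C \<union> S" for u v
  proof -
    have mixed: "dist (c u) (c v) \<le> diameter (c ` C) + diameter (c ` S) + l"
      if "u \<in> C" "v \<in> S" for u v
    proof -
      have "dist (c u) (c v) \<le> dist (c u) (c x) + dist (c x) (c y) + dist (c y) (c v)"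
        using dist_triangle[of "c u" "c v" "c x"] dist_triangle[of "c x" "c v" "c y"] by linarith
      then show ?thesis
        using dist_le_diameter[of C u x c] dist_le_diameter[of S y v c] that assms by linarith
    qed
    show ?thesis
      using uv mixed[of u v] mixed[of v u] dist_le_diameter[of C u v c] dist_le_diameter[of S u v c]
        nn l0 assms by (auto simp: dist_commute)
  qed
  then show ?thesis
    unfolding diameter_def[of "c ` (C \<union> S)"] using assms(3) by (auto intro!: cSUP_least)
qed

text \<open>Merging two clusters at distance at most l raises the sum of the diameters by at most l
  and lowers the number of clusters by one. So spread plus l times cardinality never increases, and
  merging stops when the clusters are separated.\<close>

lemma merge_close_clusters:
  fixes c :: "'a \<Rightarrow> 'b::metric_space"
  assumes "finite X" "partition_on X P" "l > 0"
  shows "\<exists>P'. partition_on X P' \<and> (\<forall>C\<in>P. \<exists>C'\<in>P'. C \<subseteq> C') \<and> separated c l P' \<and>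
      spread c P' \<le> spread c P + l * (real (card P) - real (card P'))"
  using assms(2)
proof (induction "card P" arbitrary: P rule: less_induct)
  case less
  have finP: "finite P" using finite_elements[OF assms(1) less.prems] .
  have finC: "finite C" if "C \<in> P" for C
    using that less.prems assms(1) finite_subset[of C X] by (auto simp: partition_on_def)
  show ?case
  proof (cases "separated c l P")
    case True
    then show ?thesis using less.prems by (intro exI[of _ P]) auto
  next
    case False
    then obtain C S x y where CS: "C \<in> P" "S \<in> P" "C \<noteq> S" "x \<in> C" "y \<in> S" "dist (c x) (c y) \<le> l"
      unfolding separated_def by (auto simp: not_less)
    define R where "R = P - {C, S}"
    define Q where "Q = insert (C \<union> S) R"
    have dj: "A \<inter> B = {}" if "A \<in> P" "B \<in> P" "A \<noteq> B" for A B
      using that less.prems by (auto simp: partition_on_def disjoint_def)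
    have nC: "C \<noteq> {}" "S \<noteq> {}" using CS by auto
    have notin: "C \<union> S \<notin> R"
    proof
      assume "C \<union> S \<in> R"
      then have "(C \<union> S) \<inter> C = {}" using dj[of "C \<union> S" C] CS by (auto simp: R_def)
      then show False using nC by auto
    qed
    have PR: "P = insert C (insert S R)" "C \<notin> insert S R" "S \<notin> R" "finite R"
      using CS finP by (auto simp: R_def)
    have partQ: "partition_on X Q"
    proof (rule partition_onI)
      show "\<Union> Q = X" using less.prems PR unfolding Q_def partition_on_def by auto
      show "{} \<notin> Q"
        using nC less.prems by (auto simp: Q_def R_def partition_on_def)
      fix p p' assume p: "p \<in> Q" "p' \<in> Q" "p \<noteq> p'"
      have R: "disjnt (C \<union> S) A" if "A \<in> R" for A
        using dj[of C A] dj[of S A] that CS(1,2) by (auto simp: R_def disjnt_def)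
      have R': "disjnt A A'" if "A \<in> R" "A' \<in> R" "A \<noteq> A'" for A A'
        using dj[of A A'] that by (simp add: R_def disjnt_def)
      show "disjnt p p'"
        using p R[of p] R[of p'] R'[of p p'] unfolding Q_def by (metis disjnt_sym insertE)
    qed
    have cards: "card P = card R + 2" "card Q = card R + 1"
      using PR notin by (auto simp: Q_def)
    obtain P' where P': "partition_on X P'" "\<forall>C\<in>Q. \<exists>C'\<in>P'. C \<subseteq> C'" "separated c l P'"
      "spread c P' \<le> spread c Q + l * (real (card Q) - real (card P'))"
      using less.hyps[of Q] partQ cards by auto
    have "spread c Q = diameter (c ` (C \<union> S)) + spread c R"
      using notin PR by (simp add: spread_def Q_def)
    also have "\<dots> \<le> diameter (c ` C) + diameter (c ` S) + l + spread c R"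
      using diameter_union_le[OF finC finC CS(4,5,6)] CS by simp
    also have "\<dots> = spread c P + l" using PR by (simp add: spread_def)
    finally have "spread c P' \<le> spread c P + l * (real (card P) - real (card P'))"
      using P'(4) cards by (simp add: algebra_simps)
    moreover have "\<forall>C\<in>P. \<exists>C'\<in>P'. C \<subseteq> C'"
    proof
      fix A assume "A \<in> P"
      then have "\<exists>B\<in>Q. A \<subseteq> B" using PR by (auto simp: Q_def)
      then show "\<exists>C'\<in>P'. A \<subseteq> C'" using P'(2) by (meson subset_trans)
    qed
    ultimately show ?thesis using P' by blast
  qed
qed

lemma sum_partition_ge1:
  fixes b :: "'a \<Rightarrow> int"
  assumes "finite X" "partition_on X P" "sum b X \<ge> 1"
  shows "\<exists>C\<in>P. sum b C \<ge> 1"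
proof (rule ccontr)
  assume "\<not> (\<exists>C\<in>P. sum b C \<ge> 1)"
  then have "(\<Sum>C\<in>P. sum b C) \<le> 0" 
    by (intro sum_nonpos[where f="sum b"]) force
  moreover have "sum b X = (\<Sum>C\<in>P. sum b C)"
    using sum.Union_disjoint_sets[of P b] sum.partition[OF assms(1,2), of b] by simp
  ultimately show False using assms(3) by simp
qed

text \<open>Doubling the scale halves the spread relative to the scale, and every merger adds at
  most 1 to it. There are at most \<open>card P0\<close> mergers, so the relative spreads sum to at
  most four times that number, and at most 16 times it many of them exceed 1/4. At the other scales
  each cluster is four times smaller than its distance to the rest. Integrality of the charges lets
  charge at least 1 be inherited by a child.\<close>

lemma cluster_descent:
  fixes c :: "'a \<Rightarrow> 'b::metric_space" and b :: "'a \<Rightarrow> int"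
  assumes X: "finite X" "sum b X \<ge> 1" and P0: "partition_on X P0"
    and l: "l > 0" and sp: "spread c P0 \<le> l * real (card P0)"
  shows "\<exists>x\<in>X. \<forall>K. real (card {k. k \<le> K \<and> \<not> (\<exists>S\<subseteq>X. sum b S \<ge> 1 \<and>
        (\<forall>q\<in>S. dist (c q) (c x) \<le> l * 2^k / 4) \<and> (\<forall>q\<in>X - S. dist (c q) (c x) > l * 2^k))})
      \<le> 16 * real (card P0)"
proof -
  define n where "n = real (card P0)"
  \<comment> \<open>The clause for k = 0 starts the recursion: the spread of \<open>P0\<close> is at
    most l n, and merging down to \<open>card P\<close> clusters adds at most l (n - card
    P).\<close>
  define A where "A = (\<lambda>k P. partition_on X P \<and> separated c (l * 2^k) P \<and>
     (k = 0 \<longrightarrow> spread c P \<le> l * (2 * n - real (card P))))"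
  define B where "B = (\<lambda>k P P'. (\<forall>C\<in>P. \<exists>C'\<in>P'. C \<subseteq> C') \<and>
     spread c P' \<le> spread c P + l * 2^Suc k * (real (card P) - real (card P')))"
  have "\<exists>P. \<forall>k. A k (P k) \<and> B k (P k) (P (Suc k))"
  proof (rule dependent_nat_choice)
    obtain P where "partition_on X P" "separated c l P"
       "spread c P \<le> spread c P0 + l * (real (card P0) - real (card P))"
      using merge_close_clusters[OF X(1) P0 l, of c] by blast
    then have "A 0 P" using sp by (auto simp: A_def n_def algebra_simps)
    then show "\<exists>P. A 0 P" ..
  next
    fix P k assume "A k P"
    then have "partition_on X P" by (simp add: A_def)
    moreover have "l * 2 ^ Suc k > 0" using l by simp
    ultimately obtain P' where "partition_on X P'" "\<forall>C\<in>P. \<exists>C'\<in>P'. C \<subseteq> C'"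
      "separated c (l * 2^Suc k) P'"
      "spread c P' \<le> spread c P + l * 2^Suc k * (real (card P) - real (card P'))"
      using merge_close_clusters[OF X(1), of P "l * 2^Suc k" c] by blast
    then show "\<exists>P'. A (Suc k) P' \<and> B k P P'" unfolding A_def B_def by auto
  qed
  then obtain P where A: "\<And>k. A k (P k)" and B: "\<And>k. B k (P k) (P (Suc k))" by blast
  have part: "partition_on X (P k)" and sepa: "separated c (l * 2^k) (P k)" for k
    using A[of k] by (auto simp: A_def)
  have finP: "finite (P k)" for k using finite_elements[OF X(1) part] .
  have subX: "C \<subseteq> X" if "C \<in> P k" for C k
    using that part[of k] by (auto simp: partition_on_def)
  have finC: "finite C" if "C \<in> P k" for C k
    using subX[OF that] X(1) finite_subset by blast
  have diam0: "0 \<le> diameter (c ` C)" if "C \<in> P k" for C k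
    using finC[OF that] by (auto intro!: diameter_ge_0 finite_imp_bounded)
  define a where "a k = spread c (P k) / (l * 2^k)" for k
  have a0: "0 \<le> a k" for k
    unfolding a_def spread_def using l diam0 by (intro divide_nonneg_nonneg sum_nonneg) auto
  have a_Suc: "a (Suc k) \<le> a k / 2 + (real (card (P k)) - real (card (P (Suc k))))" for k
  proof -
    have "spread c (P (Suc k)) \<le> spread c (P k) + l * 2^Suc k * (real (card (P k)) - real (card (P (Suc k))))"
      using B[of k] by (simp add: B_def)
    then have "a (Suc k) \<le> (spread c (P k) + l * 2^Suc k * (real (card (P k)) - real (card (P (Suc k))))) / (l * 2^Suc k)"
      unfolding a_def using l by (intro divide_right_mono) auto
    also have "\<dots> = a k / 2 + (real (card (P k)) - real (card (P (Suc k))))"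
      unfolding a_def using l by (simp add: field_simps)
    finally show ?thesis .
  qed
  \<comment> \<open>The terms beside the sum form a potential: doubling \<open>a_Suc\<close> shows
    that the left side does not increase with K.\<close>
  have a_sum: "(\<Sum>k\<le>K. a k) + a K + 2 * real (card (P K)) \<le> 4 * n" for K
  proof (induction K)
    case 0
    have "spread c (P 0) \<le> l * (2 * n - real (card (P 0)))" using A[of 0] by (simp add: A_def)
    then have "a 0 \<le> 2 * n - real (card (P 0))"
      using l by (simp add: a_def field_simps)
    then show ?case by simp
  next
    case (Suc K)
    then show ?case using a_Suc[of K] by simp
  qed
  have bad: "real (card {k. k \<le> K \<and> a k > 1/4}) \<le> 16 * n" for K
  proof -
    have "real (card {k. k \<le> K \<and> a k > 1/4}) * (1/4) = (\<Sum>k\<in>{k. k \<le> K \<and> a k > 1/4}. 1/4)"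
      by simp
    also have "\<dots> \<le> (\<Sum>k\<in>{k. k \<le> K \<and> a k > 1/4}. a k)" by (intro sum_mono) auto
    also have "\<dots> \<le> (\<Sum>k\<le>K. a k)" using a0 by (intro sum_mono2) auto
    also have "\<dots> \<le> 4 * n" using a_sum[of K] a0[of K] of_nat_0_le_iff[of "card (P K)", where ?'a=real] by linarith
    finally show ?thesis by simp
  qed
  \<comment> \<open>The clusters at scale K inside a cluster C at scale K + 1 partition C, so one of
    them has charge at least 1 and the descent continues in it.\<close>
  have desc: "\<forall>C\<in>P K. sum b C \<ge> 1 \<longrightarrow> (\<exists>x\<in>C. \<forall>k\<le>K. \<exists>S\<in>P k. x \<in> S \<and> sum b S \<ge> 1)" for K
  proof (induction K)
    case 0
    have "C \<noteq> {}" if "sum b C \<ge> 1" for C using that by auto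
    then show ?case by fastforce
  next
    case (Suc K)
    show ?case
    proof (intro ballI impI)
      fix C assume C: "C \<in> P (Suc K)" "sum b C \<ge> 1"
      have "partition_on C {S \<in> P K. S \<subseteq> C}"
      proof (rule partition_onI)
        show "\<Union> {S \<in> P K. S \<subseteq> C} = C"
        proof (intro equalityI subsetI)
          fix x assume x: "x \<in> C"
          then have "x \<in> X" using subX C by blast
          then obtain S where S: "S \<in> P K" "x \<in> S" using part[of K] by (auto simp: partition_on_def)
          then obtain C' where "C' \<in> P (Suc K)" "S \<subseteq> C'" using B[of K] by (auto simp: B_def)
          then have "C' = C" using x S C part[of "Suc K"] by (auto simp: partition_on_def disjoint_def)
          then show "x \<in> \<Union> {S \<in> P K. S \<subseteq> C}" using S \<open>S \<subseteq> C'\<close> by auto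
        qed auto
        show "{} \<notin> {S \<in> P K. S \<subseteq> C}"
          using part[of K] by (auto simp: partition_on_def)
        show "disjnt p p'" if "p \<in> {S \<in> P K. S \<subseteq> C}" "p' \<in> {S \<in> P K. S \<subseteq> C}" "p \<noteq> p'" for p p'
          using that part[of K] by (auto simp: partition_on_def disjoint_def disjnt_def)
      qed
      from sum_partition_ge1[OF finC[OF C(1)] this C(2)]
      obtain S where S: "S \<in> P K" "S \<subseteq> C" "sum b S \<ge> 1" by auto
      have "\<exists>x\<in>S. \<forall>k\<le>K. \<exists>S\<in>P k. x \<in> S \<and> sum b S \<ge> 1"
        using bspec[OF Suc.IH S(1)] S(3) by (rule mp)
      then obtain x where "x \<in> S" "\<forall>k\<le>K. \<exists>S\<in>P k. x \<in> S \<and> sum b S \<ge> 1" ..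
      then show "\<exists>x\<in>C. \<forall>k\<le>Suc K. \<exists>S\<in>P k. x \<in> S \<and> sum b S \<ge> 1"
        using S C by (intro bexI[of _ x]) (auto simp: le_Suc_eq)
    qed
  qed
  \<comment> \<open>Compactness over the finite set \<open>X\<close>: were every point to fail at
    some scale, the largest of these scales would contradict \<open>desc\<close>.\<close>
  have "\<exists>x\<in>X. \<forall>k. \<exists>S\<in>P k. x \<in> S \<and> sum b S \<ge> 1"
  proof (rule ccontr)
    assume "\<not> ?thesis"
    then have "\<forall>x\<in>X. \<exists>k. \<not> (\<exists>S\<in>P k. x \<in> S \<and> sum b S \<ge> 1)" by simp
    then obtain f where "\<forall>x\<in>X. \<not> (\<exists>S\<in>P (f x). x \<in> S \<and> sum b S \<ge> 1)"
      by (rule bchoice[THEN exE])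
    then have f: "\<not> (\<exists>S\<in>P (f x). x \<in> S \<and> sum b S \<ge> 1)" if "x \<in> X" for x
      using that by (rule bspec)
    define K where "K = Max (insert 0 (f ` X))"
    have fK: "f x \<le> K" if "x \<in> X" for x using that X(1) by (auto simp: K_def)
    obtain C where C: "C \<in> P K" "sum b C \<ge> 1"
      using sum_partition_ge1[OF X(1) part X(2)] by blast
    have "\<exists>x\<in>C. \<forall>k\<le>K. \<exists>S\<in>P k. x \<in> S \<and> sum b S \<ge> 1"
      using bspec[OF desc C(1)] C(2) by (rule mp)
    then obtain x where x: "x \<in> C" "\<forall>k\<le>K. \<exists>S\<in>P k. x \<in> S \<and> sum b S \<ge> 1" ..
    then have xX: "x \<in> X" using subX[OF C(1)] by (auto dest: subsetD)
    show False using f[OF xX] x(2)[rule_format, OF fK[OF xX]] by contradiction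
  qed
  then obtain x where x: "x \<in> X" "\<And>k. \<exists>S\<in>P k. x \<in> S \<and> sum b S \<ge> 1" by blast
  have good: "\<exists>S\<subseteq>X. sum b S \<ge> 1 \<and> (\<forall>q\<in>S. dist (c q) (c x) \<le> l * 2^k / 4) \<and>
      (\<forall>q\<in>X - S. dist (c q) (c x) > l * 2^k)" if "a k \<le> 1/4" for k
  proof -
    obtain S where S: "S \<in> P k" "x \<in> S" "sum b S \<ge> 1" using x(2) by blast
    have "diameter (c ` S) \<le> spread c (P k)"
      unfolding spread_def using S finP diam0 by (intro member_le_sum) auto
    also have "\<dots> \<le> l * 2^k / 4" using that l by (simp add: a_def field_simps)
    finally have "dist (c q) (c x) \<le> l * 2^k / 4" if "q \<in> S" for q
      using dist_le_diameter[of S q x c] S that finC by force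
    moreover have "dist (c q) (c x) > l * 2^k" if q: "q \<in> X - S" for q
    proof -
      obtain S' where "S' \<in> P k" "q \<in> S'" using part[of k] q by (auto simp: partition_on_def)
      then show ?thesis using sepa[of k] S q unfolding separated_def by auto
    qed
    ultimately show ?thesis using S subX by (intro exI[of _ S]) auto
  qed
  show ?thesis
  proof (intro bexI[of _ x] allI)
    fix K
    have "card {k. k \<le> K \<and> \<not> (\<exists>S\<subseteq>X. sum b S \<ge> 1 \<and>
        (\<forall>q\<in>S. dist (c q) (c x) \<le> l * 2^k / 4) \<and> (\<forall>q\<in>X - S. dist (c q) (c x) > l * 2^k))}
        \<le> card {k. k \<le> K \<and> a k > 1/4}"
    proof (rule card_mono)
      show "{k. k \<le> K \<and> \<not> (\<exists>S\<subseteq>X. sum b S \<ge> 1 \<and>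
        (\<forall>q\<in>S. dist (c q) (c x) \<le> l * 2^k / 4) \<and> (\<forall>q\<in>X - S. dist (c q) (c x) > l * 2^k))}
        \<subseteq> {k. k \<le> K \<and> a k > 1/4}"
        using good by (intro Collect_mono) (metis not_le)
    qed simp
    then show "real (card {k. k \<le> K \<and> \<not> (\<exists>S\<subseteq>X. sum b S \<ge> 1 \<and>
        (\<forall>q\<in>S. dist (c q) (c x) \<le> l * 2^k / 4) \<and> (\<forall>q\<in>X - S. dist (c q) (c x) > l * 2^k))})
        \<le> 16 * real (card P0)"
      using bad[of K] unfolding n_def by linarith
  qed (rule x(1))
qed

section \<open>Energies and almost minimisers\<close>

lemma sum_abs_squared_le:
  fixes a :: "nat \<Rightarrow> real"
  shows "(\<Sum>i<n. \<bar>a i\<bar>)\<^sup>2 \<le> real n * (\<Sum>i<n. (a i)\<^sup>2)"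
  using Cauchy_Schwarz_ineq_sum[of "\<lambda>_. 1" "\<lambda>i. \<bar>a i\<bar>" "{..<n}"] by simp

lemma abs_diff_le_variation:
  fixes f :: "nat \<Rightarrow> real"
  assumes "j \<le> n" shows "\<bar>f j - f 0\<bar> \<le> (\<Sum>i<n. \<bar>f (Suc i) - f i\<bar>)"
proof -
  have "\<bar>f j - f 0\<bar> = \<bar>\<Sum>i<j. f (Suc i) - f i\<bar>" by (simp add: sum_lessThan_telescope)
  also have "\<dots> \<le> (\<Sum>i<j. \<bar>f (Suc i) - f i\<bar>)" by (rule sum_abs)
  also have "\<dots> \<le> (\<Sum>i<n. \<bar>f (Suc i) - f i\<bar>)" using assms by (intro sum_mono2) auto
  finally show ?thesis .
qed

text \<open>The bilinearly blended Coons patch with bottom, top, left and right data: the sum of the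
  two linear interpolations between opposite sides minus the bilinear interpolant of the
  corners.\<close>

definition coons :: "nat \<Rightarrow> (nat \<Rightarrow> real) \<Rightarrow> (nat \<Rightarrow> real) \<Rightarrow> (nat \<Rightarrow> real) \<Rightarrow> (nat \<Rightarrow> real) \<Rightarrow> nat \<Rightarrow> nat \<Rightarrow> real" where
  "coons n B T L R i j = (let t = real i / real n; u = real j / real n in
     (1 - u) * B i + u * T i + (1 - t) * L j + t * R j
     - ((1 - t) * (1 - u) * B 0 + t * (1 - u) * B n + (1 - t) * u * T 0 + t * u * T n))"

lemma coons_swap:
  assumes "B 0 = L 0" "B n = R 0" "T 0 = L n" "T n = R n"
  shows "coons n B T L R i j = coons n L R B T j i"
  using assms by (simp add: coons_def Let_def algebra_simps)

lemma coons_boundary: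
  assumes "B 0 = L 0" "B n = R 0" "T 0 = L n" "T n = R n" "n > 0"
  shows "coons n B T L R i 0 = B i" "coons n B T L R i n = T i"
    "coons n B T L R 0 j = L j" "coons n B T L R n j = R j"
  using assms by (simp_all add: coons_def Let_def algebra_simps)

definition variation :: "nat \<Rightarrow> (nat \<Rightarrow> real) \<Rightarrow> real" where
  "variation n f = (\<Sum>i<n. \<bar>f (Suc i) - f i\<bar>)"

definition variation2 :: "nat \<Rightarrow> (nat \<Rightarrow> real) \<Rightarrow> real" where
  "variation2 n f = (\<Sum>i<n. (f (Suc i) - f i)\<^sup>2)"

lemma variation_bounds: "0 \<le> variation n f" "0 \<le> variation2 n f"
  "(variation n f)\<^sup>2 \<le> real n * variation2 n f"
  unfolding variation_def variation2_def
  by (simp_all add: sum_nonneg sum_abs_squared_le)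

text \<open>In the first direction the patch moves by a convex combination of the bottom and top
  increments plus 1/n times a difference of boundary values. The latter is at most 2 V in modulus,
  with V the total variation of the boundary data.\<close>

lemma coons_diff:
  assumes c: "B 0 = L 0" "B n = R 0" "T 0 = L n" "T n = R n" and n: "n > 0" and j: "j \<le> n"
    and V: "V = variation n B + variation n T + variation n L + variation n R"
  shows "(coons n B T L R (Suc i) j - coons n B T L R i j)\<^sup>2
    \<le> 3 * (B (Suc i) - B i)\<^sup>2 + 3 * (T (Suc i) - T i)\<^sup>2 + 12 * (V / real n)\<^sup>2"
proof -
  define u where "u = real j / real n"
  have u: "0 \<le> u" "u \<le> 1" using j n by (auto simp: u_def)
  have v0: "0 \<le> variation n B" "0 \<le> variation n T" "0 \<le> variation n L" "0 \<le> variation n R"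
    by (simp_all add: variation_bounds)
  define dB dT where "dB = B (Suc i) - B i" and "dT = T (Suc i) - T i"
  define X where "X = (R j - L j) - ((1 - u) * (B n - B 0) + u * (T n - T 0))"
  have eq: "coons n B T L R (Suc i) j - coons n B T L R i j = (1 - u) * dB + u * dT + X / real n"
    using n unfolding coons_def Let_def u_def[symmetric] X_def dB_def dT_def
    by (simp add: field_simps)
  have BT: "\<bar>B n - B 0\<bar> \<le> V" "\<bar>T n - T 0\<bar> \<le> V"
    using abs_diff_le_variation[of n n B] abs_diff_le_variation[of n n T] v0
    unfolding V variation_def by linarith+
  have RL: "\<bar>R j - L j\<bar> \<le> V"
    using abs_diff_le_variation[of n n B] abs_diff_le_variation[OF j, of R]
      abs_diff_le_variation[OF j, of L] v0 c unfolding V variation_def by linarith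
  have "\<bar>(1 - u) * (B n - B 0) + u * (T n - T 0)\<bar> \<le> (1 - u) * V + u * V"
    using u BT by (intro order_trans[OF abs_triangle_ineq] add_mono) (auto simp: abs_mult intro: mult_left_mono)
  then have "\<bar>X\<bar> \<le> 2 * V" using RL unfolding X_def by (simp add: algebra_simps)
  then have X: "\<bar>X / real n\<bar> \<le> 2 * (V / real n)" using n by (simp add: field_simps)
  have cvx: "\<bar>(1 - u) * dB + u * dT\<bar> \<le> \<bar>dB\<bar> + \<bar>dT\<bar>"
  proof -
    have "\<bar>(1 - u) * dB\<bar> \<le> 1 * \<bar>dB\<bar>" "\<bar>u * dT\<bar> \<le> 1 * \<bar>dT\<bar>"
      using u unfolding abs_mult by (intro mult_right_mono; simp)+
    then show ?thesis by linarith
  qed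
  define w where "w = 2 * (V / real n)"
  have "\<bar>(1 - u) * dB + u * dT + X / real n\<bar> \<le> \<bar>dB\<bar> + \<bar>dT\<bar> + w"
    using X cvx unfolding w_def by linarith
  then have "((1 - u) * dB + u * dT + X / real n)\<^sup>2 \<le> (\<bar>dB\<bar> + \<bar>dT\<bar> + w)\<^sup>2"
    by (rule abs_le_square_iff[THEN iffD1, OF order_trans]) simp
  also have "\<dots> \<le> 3 * \<bar>dB\<bar>\<^sup>2 + 3 * \<bar>dT\<bar>\<^sup>2 + 3 * w\<^sup>2"
    using zero_le_power2[of "\<bar>dB\<bar> - \<bar>dT\<bar>"] zero_le_power2[of "\<bar>dB\<bar> - w"] zero_le_power2[of "\<bar>dT\<bar> - w"]
    by (simp add: power2_eq_square algebra_simps)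
  also have "\<dots> = 3 * dB\<^sup>2 + 3 * dT\<^sup>2 + 12 * (V / real n)\<^sup>2" by (simp add: w_def power_divide power_mult_distrib)
  finally show ?thesis unfolding eq dB_def dT_def .
qed

lemma four_squares: "(a + b + c + d)\<^sup>2 \<le> 4 * (a\<^sup>2 + b\<^sup>2 + c\<^sup>2 + d\<^sup>2)" for a b c d :: real
  using zero_le_power2[of "a - b"] zero_le_power2[of "a - c"] zero_le_power2[of "a - d"]
    zero_le_power2[of "b - c"] zero_le_power2[of "b - d"] zero_le_power2[of "c - d"]
  by (simp add: power2_eq_square algebra_simps)

text \<open>Cauchy-Schwarz gives V^2 at most 4 n rho, so the n (n + 1) remainders of order (V / n)^2
  sum to O(n rho), as do the boundary increments repeated over n + 1 rows. The constant is 2 (3 +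
  48), with the 2 from n + 1 \<le> 2 n.\<close>

lemma coons_energy_half:
  assumes c: "B 0 = L 0" "B n = R 0" "T 0 = L n" "T n = R n" and n: "n > 0"
    and rho: "rho = variation2 n B + variation2 n T + variation2 n L + variation2 n R"
  shows "(\<Sum>i<n. \<Sum>j\<le>n. (coons n B T L R (Suc i) j - coons n B T L R i j)\<^sup>2) \<le> 102 * real n * rho"
proof -
  define V where "V = variation n B + variation n T + variation n L + variation n R"
  have v: "0 \<le> variation2 n B" "0 \<le> variation2 n T" "0 \<le> variation2 n L" "0 \<le> variation2 n R"
    by (simp_all add: variation_bounds)
  have "V\<^sup>2 \<le> 4 * ((variation n B)\<^sup>2 + (variation n T)\<^sup>2 + (variation n L)\<^sup>2 + (variation n R)\<^sup>2)"
    unfolding V_def by (rule four_squares)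
  also have "\<dots> \<le> 4 * (real n * rho)"
    using variation_bounds(3)[of n B] variation_bounds(3)[of n T]
      variation_bounds(3)[of n L] variation_bounds(3)[of n R] unfolding rho by (simp add: algebra_simps)
  finally have V2: "V\<^sup>2 \<le> 4 * (real n * rho)" .
  have "(V / real n)\<^sup>2 \<le> 4 * (real n * rho) / (real n)\<^sup>2"
    unfolding power_divide using V2 by (intro divide_right_mono) auto
  also have "\<dots> = 4 * rho / real n" using n by (simp add: power2_eq_square)
  finally have Vn: "(V / real n)\<^sup>2 \<le> 4 * rho / real n" .
  have rho0: "0 \<le> rho" "variation2 n B + variation2 n T \<le> rho" using v by (auto simp: rho)
  have "(\<Sum>i<n. \<Sum>j\<le>n. (coons n B T L R (Suc i) j - coons n B T L R i j)\<^sup>2)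
    \<le> (\<Sum>i<n. \<Sum>j\<le>n. 3 * (B (Suc i) - B i)\<^sup>2 + 3 * (T (Suc i) - T i)\<^sup>2 + 12 * (4 * rho / real n))"
    using coons_diff[OF c n _ V_def] Vn
    by (intro sum_mono) (smt (verit, ccfv_threshold) atMost_iff)
  also have "\<dots> = (real n + 1) * (3 * (variation2 n B + variation2 n T) + 48 * rho)"
  proof -
    have "real n * (12 * (4 * rho / real n)) = 48 * rho" using n by simp
    moreover have "(\<Sum>i<n. \<Sum>j\<le>n. 3 * (B (Suc i) - B i)\<^sup>2 + 3 * (T (Suc i) - T i)\<^sup>2 + q)
      = (real n + 1) * (3 * (variation2 n B + variation2 n T) + real n * q)" for q
      by (simp add: variation2_def sum.distrib sum_distrib_left algebra_simps)
    ultimately show ?thesis by (simp only:)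
  qed
  also have "\<dots> \<le> (2 * real n) * (3 * rho + 48 * rho)"
    using n rho0 v by (intro mult_mono) auto
  finally show ?thesis by simp
qed

lemma coons_energy:
  assumes c: "B 0 = L 0" "B n = R 0" "T 0 = L n" "T n = R n" and n: "n > 0"
    and rho: "rho = variation2 n B + variation2 n T + variation2 n L + variation2 n R"
  shows "(\<Sum>i<n. \<Sum>j\<le>n. (coons n B T L R (Suc i) j - coons n B T L R i j)\<^sup>2)
      + (\<Sum>i\<le>n. \<Sum>j<n. (coons n B T L R i (Suc j) - coons n B T L R i j)\<^sup>2) \<le> 204 * real n * rho"
proof -
  have "(\<Sum>i\<le>n. \<Sum>j<n. (coons n B T L R i (Suc j) - coons n B T L R i j)\<^sup>2)
    = (\<Sum>j<n. \<Sum>i\<le>n. (coons n L R B T (Suc j) i - coons n L R B T j i)\<^sup>2)"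
    by (subst sum.swap) (simp only: coons_swap[OF c])
  also have "\<dots> \<le> 102 * real n * rho"
    by (rule coons_energy_half) (use c n rho in auto)
  finally show ?thesis using coons_energy_half[OF c n rho] by simp
qed

section \<open>Periodic potentials and penalised minimisation\<close>

lemma periodic_int:
  fixes \<psi> :: "real \<Rightarrow> real"
  assumes per: "\<And>x. \<psi> (x + 1) = \<psi> x" shows "\<psi> (x + of_int k) = \<psi> x"
proof -
  have pern: "\<psi> (x + real n) = \<psi> x" for x n
    using per[of "x + real k" for k] by (induction n) (auto simp: algebra_simps)
  show ?thesis
    by (cases k rule: int_cases2) (use pern[of x] pern[of "x - real n" n for n] in auto)
qed

text \<open>That \<open>lower\<close> and \<open>cubic\<close> share the coefficient \<mu> / 2 is
  what cancels the divergent sums in \<open>energy_compare\<close>. \<open>upper\<close> is stated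
  for all x because it is applied to increments that have not been reduced modulo 1.\<close>

locale potential =
  fixes \<psi> :: "real \<Rightarrow> real" and \<mu> Cp Ct :: real
  assumes per: "\<And>x. \<psi> (x + 1) = \<psi> x"
    and psi_cont: "continuous_on UNIV \<psi>"
    and mu: "\<mu> > 0" and Cp: "Cp > 0" and Ct: "Ct > 0"
    and lower: "\<And>x. \<bar>x\<bar> \<le> 1/2 \<Longrightarrow> \<psi> x \<ge> \<mu> / 2 * x\<^sup>2"
    and upper: "\<And>x. \<psi> x \<le> Cp * x\<^sup>2"
    and cubic: "\<And>x. \<bar>x\<bar> \<le> 1/2 \<Longrightarrow> \<psi> x \<le> \<mu> / 2 * x\<^sup>2 + Ct * \<bar>x\<bar>^3"
begin

lemma per_Ints: "a - b \<in> \<int> \<Longrightarrow> \<psi> a = \<psi> b"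
  using periodic_int[of \<psi> b, OF per] by (auto elim!: Ints_cases simp: algebra_simps)

lemma psi_wrap: "\<psi> (wrap x) = \<psi> x"
  using wrap_Ints[of x] per_Ints by metis

lemma psi_ge: "\<psi> x \<ge> \<mu> / 2 * (wrap x)\<^sup>2"
  using lower[OF wrap_bounds[of x]] psi_wrap by simp

lemma psi_nonneg: "\<psi> x \<ge> 0"
  using psi_ge[of x] mu by (smt (verit) zero_le_power2 mult_nonneg_nonneg divide_nonneg_pos)

definition supp :: "(lpt \<Rightarrow> real) \<Rightarrow> edge set" where
  "supp v = {e. grad v e \<noteq> 0}"

definition energy :: "(lpt \<Rightarrow> real) \<Rightarrow> (lpt \<Rightarrow> real) \<Rightarrow> real" where
  "energy y v = (\<Sum>e\<in>supp v. \<psi> (grad y e + grad v e) - \<psi> (grad y e))"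

text \<open>The tolerance grows with the number of changed edges because the penalty does; for fixed
  \<open>v\<close> it vanishes with \<epsilon>.\<close>

definition almost_min :: "real \<Rightarrow> (lpt \<Rightarrow> real) \<Rightarrow> bool" where
  "almost_min \<epsilon> y \<longleftrightarrow> (\<forall>v. finite (supp v) \<longrightarrow> energy y v \<ge> - \<epsilon> * (1 + real (card (supp v))))"

lemma grad_add: "grad (\<lambda>x. y x + v x) e = grad y e + grad v e"
  by (simp add: grad_def)

lemma energy_superset:
  assumes "finite S" "supp v \<subseteq> S"
  shows "energy y v = (\<Sum>e\<in>S. \<psi> (grad (\<lambda>x. y x + v x) e) - \<psi> (grad y e))"
  unfolding energy_def grad_add by (rule sum.mono_neutral_left) (use assms in \<open>auto simp: supp_def\<close>)

lemma supp_add: "supp (\<lambda>x. u x + v x) \<subseteq> supp u \<union> supp v"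
  by (auto simp: supp_def grad_add)

text \<open>Changing a bond gains at most its present energy, which is at most \<epsilon> outside a
  box by the decay of the angle form. The penalty thus pays for all but finitely many bonds, and
  \<open>F\<close> is bounded below without any knowledge of how cores interact.\<close>

lemma exists_almost_min:
  assumes eps: "\<epsilon> > 0"
  shows "\<exists>u. finite (supp u) \<and> energy angle u \<le> 0 \<and> almost_min \<epsilon> (\<lambda>x. angle x + u x)"
proof -
  define F where "F u = energy angle u + \<epsilon> * real (card (supp u))" for u
  obtain N :: nat where N: "real N > 4 * Cp / \<epsilon> + 1" using reals_Archimedean2 by blast
  have small: "\<psi> (grad angle e) \<le> \<epsilon>" if "e \<notin> edges N" for e
  proof -
    have "rad e \<ge> real N" using that unfolding mem_edges rad_def by linarith
    then have rad: "rad e \<ge> 4 * Cp / \<epsilon>" using N by linarith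
    have "\<psi> (grad angle e) = \<psi> (aform e)" using psi_wrap[of "grad angle e"] wrap_angle by simp
    also have "\<dots> \<le> Cp * (aform e)\<^sup>2" by (rule upper)
    also have "(aform e)\<^sup>2 \<le> (2 / rad e)\<^sup>2"
      using aform_decay[of e] by (intro abs_le_square_iff[THEN iffD1]) simp
    also have "Cp * (2 / rad e)\<^sup>2 = 4 * Cp / rad e / rad e" by (simp add: power2_eq_square)
    also have "\<dots> \<le> 4 * Cp / rad e / 1"
      using rad_ge1[of e] Cp by (intro divide_left_mono) auto
    also have "\<dots> \<le> \<epsilon>" using rad eps by (simp add: field_simps)
    finally show ?thesis using Cp by simp
  qed
  define M where "M = (\<Sum>e\<in>edges N. \<psi> (grad angle e))"
  have lowF: "F u \<ge> - M" if "finite (supp u)" for u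
  proof -
    have "energy angle u \<ge> (\<Sum>e\<in>supp u. - \<psi> (grad angle e))"
      unfolding energy_def by (intro sum_mono) (use psi_nonneg in auto)
    moreover have "(\<Sum>e\<in>supp u. \<psi> (grad angle e)) \<le> (\<Sum>e\<in>supp u. \<epsilon> + (if e \<in> edges N then \<psi> (grad angle e) else 0))"
      using small eps psi_nonneg by (intro sum_mono) auto
    moreover have "(\<Sum>e\<in>supp u. if e \<in> edges N then \<psi> (grad angle e) else 0) \<le> M"
      unfolding M_def using that psi_nonneg
      by (subst sum.inter_restrict[symmetric]) (auto intro!: sum_mono2)
    ultimately show ?thesis unfolding F_def by (simp add: sum.distrib sum_negf algebra_simps)
  qed
  define I where "I = Inf (F ` {u. finite (supp u)})"
  have bdd: "bdd_below (F ` {u. finite (supp u)})" using lowF by (auto intro!: bdd_belowI)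
  have s0: "supp (\<lambda>_. 0) = {}" by (simp add: supp_def grad_def)
  have F0: "F (\<lambda>_. 0) = 0" by (simp add: F_def energy_def s0)
  have "(\<lambda>_. 0) \<in> {u. finite (supp u)}" using s0 by simp
  then have ne: "F ` {u. finite (supp u)} \<noteq> {}"
    unfolding image_is_empty by (intro notI) (simp only: empty_iff)
  have IF: "I \<le> F u" if "finite (supp u)" for u
    unfolding I_def using bdd that by (intro cInf_lower) auto
  \<comment> \<open>If a near minimiser has \<open>F u > 0\<close>, the zero displacement is a
    better one. The sign of \<open>F u\<close> later gives
    \<open>energy angle u \<le> 0\<close>.\<close>
  have "\<exists>u. finite (supp u) \<and> F u \<le> 0 \<and> F u \<le> I + \<epsilon>"
  proof -
    obtain u where u: "finite (supp u)" "F u < I + \<epsilon>"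
      using cInf_lessD[OF ne, of "I + \<epsilon>"] eps unfolding I_def by auto
    show ?thesis
    proof (cases "F u \<le> 0")
      case True
      then show ?thesis using u by (intro exI[of _ u]) auto
    next
      case False
      then show ?thesis using F0 s0 u by (intro exI[of _ "\<lambda>_. 0"]) auto
    qed
  qed
  then obtain u where u: "finite (supp u)" "F u \<le> 0" "F u \<le> I + \<epsilon>" by blast
  have "energy (\<lambda>x. angle x + u x) v \<ge> - \<epsilon> * (1 + real (card (supp v)))" if v: "finite (supp v)" for v
  proof -
    define S where "S = supp u \<union> supp v"
    define w where "w = (\<lambda>x. u x + v x)"
    have S: "finite S" "supp u \<subseteq> S" "supp v \<subseteq> S" using u v by (auto simp: S_def)
    have Sw: "supp w \<subseteq> S" using supp_add[of u v] by (simp add: w_def S_def)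
    have fw: "finite (supp w)" using Sw S finite_subset by blast
    have "energy (\<lambda>x. angle x + u x) v = energy angle w - energy angle u"
      unfolding energy_superset[OF S(1,3)] energy_superset[OF S(1) Sw] energy_superset[OF S(1,2)]
        sum_subtractf[symmetric] by (simp add: w_def add.assoc)
    moreover have "I \<le> F w" by (rule IF[OF fw])
    moreover have "card (supp w) \<le> card (supp u) + card (supp v)"
      using card_mono[OF S(1) Sw] card_Un_le[of "supp u" "supp v"] unfolding S_def by linarith
    then have "\<epsilon> * real (card (supp w)) \<le> \<epsilon> * (real (card (supp u)) + real (card (supp v)))"
      using eps by (intro mult_left_mono) auto
    ultimately show ?thesis using u(3) unfolding F_def by (simp add: algebra_simps)
  qed
  moreover have "energy angle u \<le> 0" 
    using u(2) eps mult_nonneg_nonneg[of \<epsilon> "real (card (supp u))"] unfolding F_def by linarith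
  ultimately show ?thesis using u unfolding almost_min_def by blast
qed

lemma eshift_simps: "src (eshift p e) = src e + p" "tgt (eshift p e) = tgt e + p"
  by (cases e; cases "snd e"; simp add: eshift_def)+

lemma grad_shift: "grad (\<lambda>x. y (x + p)) e = grad y (eshift p e)"
  by (simp add: grad_def eshift_simps)

lemma almost_min_shift:
  assumes "almost_min \<epsilon> y" shows "almost_min \<epsilon> (\<lambda>x. y (x + p))"
  unfolding almost_min_def
proof (intro allI impI)
  fix v assume v: "finite (supp v)"
  define w where "w = (\<lambda>x. v (x - p))"
  have dw: "grad w (eshift p e) = grad v e" for e by (simp add: w_def grad_def eshift_simps)
  have inj: "inj (eshift p)" by (auto simp: inj_on_def eshift_def prod_eq_iff)
  have surj: "e = eshift p (eshift (- p) e)" for e by (simp add: eshift_def prod_eq_iff)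
  have sw: "supp w = eshift p ` supp v"
  proof (intro equalityI subsetI)
    fix e assume "e \<in> supp w"
    then have "eshift (- p) e \<in> supp v" using surj[of e] dw[of "eshift (- p) e"] by (simp add: supp_def)
    then show "e \<in> eshift p ` supp v" using surj by blast
  qed (auto simp: supp_def dw)
  have "energy (\<lambda>x. y (x + p)) v = energy y w"
    unfolding energy_def sw grad_shift by (subst sum.reindex) (use inj in \<open>auto simp: dw inj_on_def inj_def\<close>)
  moreover have "finite (supp w)" "card (supp w) = card (supp v)"
    unfolding sw using v inj by (auto intro!: card_image simp: inj_on_def inj_def)
  ultimately show "- \<epsilon> * (1 + real (card (supp v))) \<le> energy (\<lambda>x. y (x + p)) v"
    using assms unfolding almost_min_def by metis
qed

end

section \<open>Energy concentration at cores\<close>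

definition strain :: "(lpt \<Rightarrow> real) \<Rightarrow> edge \<Rightarrow> real" where
  "strain y e = wrap (grad y e)"

text \<open>The boundary of the lattice square of half-side s. The strict bounds exclude the edges
  that start at the end of a side and leave the square.\<close>

definition ring_edges :: "nat \<Rightarrow> edge set" where
  "ring_edges s = {e \<in> edges s. (snd e = E0 \<and> \<bar>snd (fst e)\<bar> = int s \<and> fst (fst e) < int s) \<or>
                   (snd e = E1 \<and> \<bar>fst (fst e)\<bar> = int s \<and> snd (fst e) < int s)}"

lemma ring_edges_subset: "ring_edges s \<subseteq> edges s" and finite_ring_edges [simp]: "finite (ring_edges s)"
  by (auto simp: ring_edges_def)

lemma ring_edges_disjoint: "s \<noteq> t \<Longrightarrow> ring_edges s \<inter> ring_edges t = {}"
  by (auto simp: ring_edges_def)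

definition grid :: "nat \<Rightarrow> nat \<Rightarrow> nat \<Rightarrow> lpt" where
  "grid s i j = (int i - int s, int j - int s)"

lemma grid_add: "grid s i j + (1, 0) = grid s (Suc i) j" "grid s i j + (0, 1) = grid s i (Suc j)"
  by (auto simp: grid_def)

lemma grid_inj: "grid s i j = grid s i' j' \<longleftrightarrow> i = i' \<and> j = j'"
  by (auto simp: grid_def)

lemma supn_grid: "i \<le> 2 * s \<Longrightarrow> j \<le> 2 * s \<Longrightarrow> supn (grid s i j) \<le> int s"
  by (auto simp: grid_def supn_def)

lemma Box_grid: "supn x \<le> int s \<Longrightarrow> \<exists>i\<le>2 * s. \<exists>j\<le>2 * s. x = grid s i j"
  by (rule exI[of _ "nat (fst x + int s)"], rule conjI, force simp: supn_def,
      rule exI[of _ "nat (snd x + int s)"], cases x) (auto simp: grid_def supn_def)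

lemma ring_edges_sum:
  fixes g :: "edge \<Rightarrow> real"
  assumes "s \<ge> 1" "\<And>e. g e \<ge> 0"
  shows "(\<Sum>i<2 * s. g (grid s i 0, E0)) + (\<Sum>i<2 * s. g (grid s i (2 * s), E0))
       + (\<Sum>j<2 * s. g (grid s 0 j, E1)) + (\<Sum>j<2 * s. g (grid s (2 * s) j, E1)) \<le> (\<Sum>e\<in>ring_edges s. g e)"
proof -
  define A1 A2 A3 A4 where
    "A1 = (\<lambda>i. (grid s i 0, E0)) ` {..<2 * s}" and "A2 = (\<lambda>i. (grid s i (2 * s), E0)) ` {..<2 * s}" and
    "A3 = (\<lambda>i. (grid s 0 i, E1)) ` {..<2 * s}" and "A4 = (\<lambda>i. (grid s (2 * s) i, E1)) ` {..<2 * s}"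
  note Adefs = A1_def A2_def A3_def A4_def
  have "(\<Sum>i<2 * s. g (grid s i 0, E0)) + (\<Sum>i<2 * s. g (grid s i (2 * s), E0))
       + (\<Sum>j<2 * s. g (grid s 0 j, E1)) + (\<Sum>j<2 * s. g (grid s (2 * s) j, E1))
      = sum g A1 + sum g A2 + sum g A3 + sum g A4"
    unfolding Adefs by (subst (1 2 3 4) sum.reindex) (auto simp: inj_on_def grid_inj)
  also have "\<dots> = sum g (A1 \<union> A2 \<union> A3 \<union> A4)"
    using assms(1) by (subst sum.union_disjoint; (subst sum.union_disjoint)?; (subst sum.union_disjoint)?)
      (auto simp: Adefs grid_inj)
  also have "\<dots> \<le> (\<Sum>e\<in>ring_edges s. g e)"
  proof (rule sum_mono2)
    show "A1 \<union> A2 \<union> A3 \<union> A4 \<subseteq> ring_edges s"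
      using assms(1) by (auto simp: Adefs ring_edges_def grid_def mem_edges supn_def)
  qed (use assms in auto)
  finally show ?thesis .
qed

definition inner_edges :: "nat \<Rightarrow> edge set" where
  "inner_edges s = (\<lambda>(i, j). (grid s i j, E0)) ` ({..<2 * s} \<times> {..2 * s})
           \<union> (\<lambda>(i, j). (grid s i j, E1)) ` ({..2 * s} \<times> {..<2 * s})
           \<union> (\<lambda>(i, j). (grid s i j, E2)) ` ({..<2 * s} \<times> {..<2 * s})"

lemma finite_inner_edges [simp]: "finite (inner_edges s)"
  by (simp add: inner_edges_def)

lemma inner_edges_subset: "inner_edges s \<subseteq> edges s"
  by (auto simp: inner_edges_def mem_edges supn_grid)

lemma inner_edges_sum:
  fixes g :: "edge \<Rightarrow> real"
  shows "(\<Sum>e\<in>inner_edges s. g e) = (\<Sum>i<2 * s. \<Sum>j\<le>2 * s. g (grid s i j, E0)) + (\<Sum>i\<le>2 * s. \<Sum>j<2 * s. g (grid s i j, E1))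
     + (\<Sum>i<2 * s. \<Sum>j<2 * s. g (grid s i j, E2))"
  unfolding inner_edges_def
  by (subst sum.union_disjoint; (subst sum.union_disjoint)?)
    (auto simp: sum.reindex inj_on_def grid_inj sum.cartesian_product case_prod_unfold)

lemma inner_edges_endpoints:
  assumes "e \<in> inner_edges s" shows "supn (src e) \<le> int s" "supn (tgt e) \<le> int s"
  using assms by (auto simp: inner_edges_def grid_add supn_grid)

lemma inner_edges_iff: "e \<in> inner_edges s \<longleftrightarrow> supn (src e) \<le> int s \<and> supn (tgt e) \<le> int s"
proof
  assume a: "supn (src e) \<le> int s \<and> supn (tgt e) \<le> int s"
  obtain x d where e: "e = (x, d)" by fastforce
  define i j where "i = nat (fst x + int s)" and "j = nat (snd x + int s)"
  show "e \<in> inner_edges s"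
  proof (cases d)
    case E0
    then have "e = (grid s i j, E0)" "i < 2 * s" "j \<le> 2 * s"
      using a e by (cases x; auto simp: grid_def i_def j_def supn_def)+
    then show ?thesis by (auto simp: inner_edges_def)
  next
    case E1
    then have "e = (grid s i j, E1)" "i \<le> 2 * s" "j < 2 * s"
      using a e by (cases x; auto simp: grid_def i_def j_def supn_def)+
    then show ?thesis by (auto simp: inner_edges_def)
  next
    case E2
    then have "e = (grid s i j, E2)" "i < 2 * s" "j < 2 * s"
      using a e by (cases x; auto simp: grid_def i_def j_def supn_def)+
    then show ?thesis by (auto simp: inner_edges_def)
  qed
qed (use inner_edges_endpoints in auto)

text \<open>Cauchy-Schwarz on the three sides: a charge of modulus at least 1 forces squared strain
  at least 1/3 on its triangle.\<close>

lemma curl_sum_squares: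
  fixes a :: "edge \<Rightarrow> real"
  assumes "\<bar>curl a T\<bar> \<ge> 1" "fst T = 0" "s \<ge> 2"
  shows "(\<Sum>e\<in>inner_edges s. (a e)\<^sup>2) \<ge> 1/3"
proof -
  have three: "(x + y - z)\<^sup>2 \<le> 3 * (x\<^sup>2 + y\<^sup>2 + z\<^sup>2)" for x y z :: real
    using zero_le_power2[of "x - y"] zero_le_power2[of "x + z"] zero_le_power2[of "y + z"]
    by (simp add: power2_eq_square algebra_simps)
  have "1 \<le> (curl a T)\<^sup>2" using assms(1) by (metis abs_1 abs_le_square_iff one_power2)
  moreover have "(curl a T)\<^sup>2 \<le> 3 * (\<Sum>e\<in>inner_edges s. (a e)\<^sup>2)"
  proof (cases "snd T")
    case True
    then have T: "T = (0, True)" using assms by (simp add: prod_eq_iff)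
    have "(curl a T)\<^sup>2 \<le> 3 * ((a (0, E0))\<^sup>2 + (a (0, E2))\<^sup>2 + (a (0, E1))\<^sup>2)"
      unfolding T curl.simps by (rule three)
    also have "\<dots> = 3 * (\<Sum>e\<in>{(0, E0), (0, E2), (0, E1)}. (a e)\<^sup>2)" by simp
    also have "\<dots> \<le> 3 * (\<Sum>e\<in>inner_edges s. (a e)\<^sup>2)"
      using assms(3) by (intro mult_left_mono sum_mono2) (auto simp: inner_edges_iff zero_prod_def supn_def)
    finally show ?thesis .
  next
    case False
    then have T: "T = (0, False)" using assms by (simp add: prod_eq_iff)
    have "(curl a T)\<^sup>2 = (- curl a T)\<^sup>2" by simp
    also have "- curl a T = a ((0, 1), E0) + a (0, E2) - a ((1, 0), E1)"
      unfolding T curl.simps by simp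
    also have "(\<dots>)\<^sup>2 \<le> 3 * ((a ((0, 1), E0))\<^sup>2 + (a (0, E2))\<^sup>2 + (a ((1, 0), E1))\<^sup>2)"
      by (rule three)
    also have "\<dots> = 3 * (\<Sum>e\<in>{((0, 1), E0), (0, E2), ((1, 0), E1)}. (a e)\<^sup>2)" by simp
    also have "\<dots> \<le> 3 * (\<Sum>e\<in>inner_edges s. (a e)\<^sup>2)"
      using assms(3) by (intro mult_left_mono sum_mono2) (auto simp: inner_edges_iff zero_prod_def supn_def)
    finally show ?thesis .
  qed
  ultimately show ?thesis by linarith
qed

lemma strain_Ints: "grad y e - strain y e \<in> \<int>"
  by (simp add: strain_def wrap_Ints)

lemma path_sum_Ints:
  assumes "\<And>i. f (Suc i) - f i - a i \<in> \<int>"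
  shows "f n - f 0 - (\<Sum>i<n. a i) \<in> (\<int> :: real set)"
proof (induction n)
  case (Suc n)
  have "f (Suc n) - f 0 - (\<Sum>i<Suc n. a i) = (f n - f 0 - (\<Sum>i<n. a i)) + (f (Suc n) - f n - a n)"
    by simp
  then show ?case using Suc assms[of n] by (simp only: Ints_add)
qed simp

context potential
begin

text \<open>The bound 1/4 keeps the variation of the boundary lift below 1. The other bound keeps
  the energy of the patch below \<mu> / 12, where 612 = 3 * 204 is the constant of
  \<open>coons_energy\<close> with the diagonal edges included. A core costs at least \<mu> / 6, so
  removing it gains more than the tolerance \<mu> / 24.\<close>

definition eta :: real where "eta = min (1/4) (\<mu> / (12 * 612 * Cp))"

lemma eta_pos: "eta > 0"
  using mu Cp by (simp add: eta_def)

text \<open>Below the threshold the boundary carries no circulation and its values lift to a real function of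
  small oscillation; the Coons patch of this lift fills the box with less energy than a core costs.\<close>
lemma ring_edges_energy_ge:
  assumes am: "almost_min \<epsilon> y" and eps: "\<epsilon> > 0" and T: "fst T = 0" "curl (strain y) T \<noteq> 0"
    and s: "s \<ge> 2" and small: "\<epsilon> * (1 + 3 * (2 * real s + 1)\<^sup>2) \<le> \<mu> / 24"
  shows "2 * real s * (\<Sum>e\<in>ring_edges s. (strain y e)\<^sup>2) \<ge> eta"
proof (rule ccontr)
  define rho where "rho = (\<Sum>e\<in>ring_edges s. (strain y e)\<^sup>2)"
  assume "\<not> ?thesis"
  then have rho_eta: "2 * real s * rho < eta" by (simp add: rho_def)
  define n where "n = 2 * s"
  have n0: "n > 0" using s by (simp add: n_def)
  define \<alpha> where "\<alpha> = strain y"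
  define B where "B i = (\<Sum>k<i. \<alpha> (grid s k 0, E0))" for i
  define L where "L j = (\<Sum>k<j. \<alpha> (grid s 0 k, E1))" for j
  define T' where "T' i = L n + (\<Sum>k<i. \<alpha> (grid s k n, E0))" for i
  define R where "R j = B n + (\<Sum>k<j. \<alpha> (grid s n k, E1))" for j
  define w where "w i j = y (grid s i j)" for i j
  have step0: "w (Suc i) j - w i j - \<alpha> (grid s i j, E0) \<in> \<int>" for i j
    using strain_Ints[of y "(grid s i j, E0)"] by (simp add: \<alpha>_def w_def grad_def grid_add)
  have step1: "w i (Suc j) - w i j - \<alpha> (grid s i j, E1) \<in> \<int>" for i j
    using strain_Ints[of y "(grid s i j, E1)"] by (simp add: \<alpha>_def w_def grad_def grid_add)
  have iB: "w i 0 - w 0 0 - B i \<in> \<int>" for i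
    unfolding B_def using path_sum_Ints[of "\<lambda>i. w i 0" "\<lambda>k. \<alpha> (grid s k 0, E0)" i] step0 by blast
  have iL: "w 0 j - w 0 0 - L j \<in> \<int>" for j
    unfolding L_def using path_sum_Ints[of "\<lambda>j. w 0 j" "\<lambda>k. \<alpha> (grid s 0 k, E1)" j] step1 by blast
  have iT: "w i n - w 0 0 - T' i \<in> \<int>" for i
  proof -
    have "w i n - w 0 n - (\<Sum>k<i. \<alpha> (grid s k n, E0)) \<in> \<int>"
      using path_sum_Ints[of "\<lambda>i. w i n" "\<lambda>k. \<alpha> (grid s k n, E0)" i] step0 by blast
    from Ints_add[OF this iL[of n]] show ?thesis by (simp add: T'_def algebra_simps)
  qed
  have iR: "w n j - w 0 0 - R j \<in> \<int>" for j
  proof -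
    have "w n j - w n 0 - (\<Sum>k<j. \<alpha> (grid s n k, E1)) \<in> \<int>"
      using path_sum_Ints[of "\<lambda>j. w n j" "\<lambda>k. \<alpha> (grid s n k, E1)" j] step1 by blast
    from Ints_add[OF this iB[of n]] show ?thesis by (simp add: R_def algebra_simps)
  qed
  have dB: "B (Suc i) - B i = \<alpha> (grid s i 0, E0)" "T' (Suc i) - T' i = \<alpha> (grid s i n, E0)"
    "L (Suc i) - L i = \<alpha> (grid s 0 i, E1)" "R (Suc i) - R i = \<alpha> (grid s n i, E1)" for i
    by (simp_all add: B_def T'_def L_def R_def)
  define r4 where "r4 = variation2 n B + variation2 n T' + variation2 n L + variation2 n R"
  have r4: "r4 \<le> rho"
    unfolding r4_def rho_def variation2_def dB n_def \<alpha>_def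
    using ring_edges_sum[of s "\<lambda>e. (strain y e)\<^sup>2"] s by simp
  have r40: "0 \<le> r4" unfolding r4_def by (simp add: variation_bounds)
  define V where "V = variation n B + variation n T' + variation n L + variation n R"
  have "V\<^sup>2 \<le> 4 * ((variation n B)\<^sup>2 + (variation n T')\<^sup>2 + (variation n L)\<^sup>2 + (variation n R)\<^sup>2)"
    unfolding V_def by (rule four_squares)
  also have "\<dots> \<le> 4 * (real n * r4)"
    using variation_bounds(3)[of n B] variation_bounds(3)[of n T']
      variation_bounds(3)[of n L] variation_bounds(3)[of n R] unfolding r4_def by (simp add: algebra_simps)
  also have "\<dots> \<le> 4 * (2 * real s * rho)"
    using r4 by (simp add: n_def mult_left_mono)
  also have "\<dots> < 1" using rho_eta by (simp add: eta_def)
  finally have "V\<^sup>2 < 1\<^sup>2" by simp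
  then have V1: "V < 1" by (rule power_less_imp_less_base) simp
  \<comment> \<open>The two ways along the boundary to the opposite corner give values that differ
    by an integer. As the variation is below 1, they agree, and the lift is single valued.\<close>
  have "R n - T' n \<in> \<int>" using Ints_diff[OF iT[of n] iR[of n]] by simp
  moreover have "B 0 = 0" "L 0 = 0" "R 0 = B n" "T' 0 = L n"
    by (simp_all add: B_def L_def R_def T'_def)
  then have "\<bar>R n - T' n\<bar> < 1"
    using abs_diff_le_variation[of n n B] abs_diff_le_variation[of n n T']
      abs_diff_le_variation[of n n L] abs_diff_le_variation[of n n R] V1
    unfolding V_def variation_def by linarith
  ultimately have "R n = T' n" using Ints_abs_less_1 by fastforce
  then have c: "B 0 = L 0" "B n = R 0" "T' 0 = L n" "T' n = R n"
    by (simp_all add: B_def L_def R_def T'_def)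
  define P where "P = coons n B T' L R"
  note bd = coons_boundary[OF c n0, folded P_def]
  define Px where "Px x = w 0 0 + P (nat (fst x + int s)) (nat (snd x + int s))" for x :: lpt
  have Px: "Px (grid s i j) = w 0 0 + P i j" for i j by (simp add: Px_def grid_def)
  \<comment> \<open>Only values strictly inside the square are replaced. On its boundary
    \<open>y\<close> and \<open>Px\<close> agree modulo 1, so inside the square \<psi> does not
    distinguish \<open>grad z\<close> from \<open>grad Px\<close>.\<close>
  define v where "v x = (if supn x < int s then Px x - y x else 0)" for x
  define z where "z = (\<lambda>x. y x + v x)"
  have zP: "z x - Px x \<in> \<int>" if x: "supn x \<le> int s" for x
  proof (cases "supn x < int s")
    case True
    then show ?thesis by (simp add: z_def v_def)
  next
    case False
    obtain i j where ij: "i \<le> n" "j \<le> n" "x = grid s i j" using Box_grid[OF x] unfolding n_def by auto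
    have "i = 0 \<or> i = n \<or> j = 0 \<or> j = n"
      using False ij x by (auto simp: grid_def supn_def n_def)
    then have "w i j - w 0 0 - P i j \<in> \<int>"
      using iB[of i] iL[of j] iT[of i] iR[of j] bd by auto
    then show ?thesis using False ij Px by (simp add: z_def v_def w_def algebra_simps)
  qed
  have supp_v: "supp v \<subseteq> inner_edges s"
  proof
    fix e assume e: "e \<in> supp v"
    have st: "supn (src e) \<le> supn (tgt e) + 1" "supn (tgt e) \<le> supn (src e) + 1"
      by (cases e; cases "snd e"; auto simp: supn_def)+
    show "e \<in> inner_edges s"
    proof (rule ccontr)
      assume "e \<notin> inner_edges s"
      then have "v (src e) = 0" "v (tgt e) = 0" using st by (auto simp: inner_edges_iff v_def)
      then show False using e by (simp add: supp_def grad_def)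
    qed
  qed
  have finv: "finite (supp v)" by (rule finite_subset[OF supp_v finite_inner_edges])
  have "card (supp v) \<le> card (edges s)"
    by (rule card_mono[OF finite_edges order_trans[OF supp_v inner_edges_subset]])
  then have "real (card (supp v)) \<le> real (card (edges s))" by (simp only: of_nat_le_iff)
  also have "\<dots> = 3 * (2 * real s + 1)\<^sup>2" by (simp add: card_edges add.commute)
  finally have "real (card (supp v)) \<le> 3 * (2 * real s + 1)\<^sup>2" .
  then have "\<epsilon> * (1 + real (card (supp v))) \<le> \<epsilon> * (1 + 3 * (2 * real s + 1)\<^sup>2)"
    using eps by (intro mult_left_mono) auto
  moreover have "- \<epsilon> * (1 + real (card (supp v))) \<le> energy y v"
    using am finv unfolding almost_min_def by simp
  ultimately have energy: "energy y v \<ge> - (\<mu> / 24)" using small by linarith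
  have dz: "\<psi> (grad z e) \<le> Cp * (grad Px e)\<^sup>2" if "e \<in> inner_edges s" for e
  proof -
    have "grad z e - grad Px e = (z (tgt e) - Px (tgt e)) - (z (src e) - Px (src e))"
      by (simp add: grad_def)
    also have "\<dots> \<in> \<int>" by (rule Ints_diff[OF zP zP]) (use inner_edges_endpoints[OF that] in auto)
    finally have "\<psi> (grad z e) = \<psi> (grad Px e)" by (rule per_Ints)
    then show ?thesis using upper by simp
  qed
  have "energy y v = (\<Sum>e\<in>inner_edges s. \<psi> (grad z e)) - (\<Sum>e\<in>inner_edges s. \<psi> (grad y e))"
    unfolding energy_superset[OF finite_inner_edges supp_v] z_def by (simp add: sum_subtractf)
  moreover have "(\<Sum>e\<in>inner_edges s. \<psi> (grad z e)) \<le> Cp * (\<Sum>e\<in>inner_edges s. (grad Px e)\<^sup>2)"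
    unfolding sum_distrib_left by (intro sum_mono dz)
  moreover have "(\<Sum>e\<in>inner_edges s. (grad Px e)\<^sup>2) \<le> 612 * (2 * real s * rho)"
  proof -
    define S0 where "S0 = (\<Sum>i<n. \<Sum>j\<le>n. (P (Suc i) j - P i j)\<^sup>2)"
    define S1 where "S1 = (\<Sum>i\<le>n. \<Sum>j<n. (P i (Suc j) - P i j)\<^sup>2)"
    have d0: "grad Px (grid s i j, E0) = P (Suc i) j - P i j"
      and d1: "grad Px (grid s i j, E1) = P i (Suc j) - P i j"
      and d2: "grad Px (grid s i j, E2) = P i (Suc j) - P (Suc i) j" for i j
      by (simp_all add: grad_def grid_add Px)
    have "(P i (Suc j) - P (Suc i) j)\<^sup>2 \<le> 2 * (P (Suc i) j - P i j)\<^sup>2 + 2 * (P i (Suc j) - P i j)\<^sup>2" for i j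
      using zero_le_power2[of "(P (Suc i) j - P i j) + (P i (Suc j) - P i j)"]
      by (simp add: power2_eq_square algebra_simps)
    then have "(\<Sum>i<n. \<Sum>j<n. (P i (Suc j) - P (Suc i) j)\<^sup>2)
      \<le> (\<Sum>i<n. \<Sum>j<n. 2 * (P (Suc i) j - P i j)\<^sup>2 + 2 * (P i (Suc j) - P i j)\<^sup>2)"
      by (intro sum_mono)
    also have "\<dots> = 2 * (\<Sum>i<n. \<Sum>j<n. (P (Suc i) j - P i j)\<^sup>2) + 2 * (\<Sum>i<n. \<Sum>j<n. (P i (Suc j) - P i j)\<^sup>2)"
      by (simp add: sum.distrib sum_distrib_left)
    also have "(\<Sum>i<n. \<Sum>j<n. (P (Suc i) j - P i j)\<^sup>2) \<le> S0"
      unfolding S0_def by (intro sum_mono sum_mono2) auto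
    also have "(\<Sum>i<n. \<Sum>j<n. (P i (Suc j) - P i j)\<^sup>2) \<le> S1"
      unfolding S1_def by (intro sum_mono2) (auto intro!: sum_nonneg)
    finally have "(\<Sum>e\<in>inner_edges s. (grad Px e)\<^sup>2) \<le> 3 * (S0 + S1)"
      unfolding inner_edges_sum d0 d1 d2 n_def[symmetric] S0_def[symmetric] S1_def[symmetric] by simp
    also have "S0 + S1 \<le> 204 * real n * r4"
      unfolding S0_def S1_def P_def by (rule coons_energy[OF c n0 r4_def])
    also have "\<dots> \<le> 204 * real n * rho" using r4 by (intro mult_left_mono) auto
    finally show ?thesis by (simp add: n_def)
  qed
  then have "Cp * (\<Sum>e\<in>inner_edges s. (grad Px e)\<^sup>2) \<le> Cp * (612 * (2 * real s * rho))"
    using Cp by (intro mult_left_mono) auto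
  moreover have "Cp * (612 * (2 * real s * rho)) < \<mu> / 12"
  proof -
    have "2 * real s * rho < \<mu> / (12 * 612 * Cp)" using rho_eta by (simp add: eta_def)
    then show ?thesis using Cp by (simp add: field_simps)
  qed
  moreover have "(\<Sum>e\<in>inner_edges s. \<psi> (grad y e)) \<ge> \<mu> / 6"
  proof -
    have "curl (strain y) T \<in> \<int>" by (rule curl_Ints_congruent) (rule strain_Ints)
    then have "\<bar>curl (strain y) T\<bar> \<ge> 1" using T(2) Ints_abs_less_1 by force
    then have "1/3 \<le> (\<Sum>e\<in>inner_edges s. (strain y e)\<^sup>2)" using curl_sum_squares T s by blast
    then have "\<mu> / 2 * (1/3) \<le> \<mu> / 2 * (\<Sum>e\<in>inner_edges s. (strain y e)\<^sup>2)" using mu by (intro mult_left_mono) auto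
    also have "\<dots> \<le> (\<Sum>e\<in>inner_edges s. \<psi> (grad y e))"
      unfolding sum_distrib_left strain_def by (intro sum_mono psi_ge)
    finally show ?thesis by simp
  qed
  ultimately show False using energy mu by linarith
qed

definition core_energy :: "nat \<Rightarrow> real" where "core_energy r = (\<Sum>s=2..r. eta / (2 * real s))"

text \<open>Every square ring around the core costs at least \<open>eta / (2 * real s)\<close>, and
  rings of different size share no edge, so that the costs add up to a harmonic sum.\<close>

lemma box_energy_ge:
  assumes am: "almost_min \<epsilon> y" and eps: "\<epsilon> > 0" and T: "curl (strain y) T \<noteq> 0"
    and small: "\<epsilon> * (1 + 3 * (2 * real r + 1)\<^sup>2) \<le> \<mu> / 24"
  shows "(\<Sum>e\<in>eshift (fst T) ` edges r. (strain y e)\<^sup>2) \<ge> core_energy r"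
proof -
  define p where "p = fst T"
  define y' where "y' = (\<lambda>x. y (x + p))"
  have wr': "strain y' e = strain y (eshift p e)" for e
    by (simp add: strain_def y'_def grad_shift)
  have am': "almost_min \<epsilon> y'" unfolding y'_def by (rule almost_min_shift[OF am])
  have cr': "curl (strain y') (0, snd T) = curl (strain y) T"
    by (cases T; cases "snd T") (auto simp: wr' eshift_def p_def add_ac)
  have ringge: "eta / (2 * real s) \<le> (\<Sum>e\<in>ring_edges s. (strain y' e)\<^sup>2)" if "s \<in> {2..r}" for s
  proof -
    have "3 * (2 * real s + 1)\<^sup>2 \<le> 3 * (2 * real r + 1)\<^sup>2"
      using that by (intro mult_left_mono power_mono) auto
    then have "\<epsilon> * (1 + 3 * (2 * real s + 1)\<^sup>2) \<le> \<epsilon> * (1 + 3 * (2 * real r + 1)\<^sup>2)"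
      using eps by (intro mult_left_mono) auto
    then have "\<epsilon> * (1 + 3 * (2 * real s + 1)\<^sup>2) \<le> \<mu> / 24"
      using small by linarith
    then have "2 * real s * (\<Sum>e\<in>ring_edges s. (strain y' e)\<^sup>2) \<ge> eta"
      using ring_edges_energy_ge[OF am' eps, of "(0, snd T)" s] T cr' that by simp
    then show ?thesis using that by (simp add: field_simps)
  qed
  have "core_energy r \<le> (\<Sum>s=2..r. \<Sum>e\<in>ring_edges s. (strain y' e)\<^sup>2)"
    unfolding core_energy_def by (intro sum_mono ringge)
  also have "\<dots> = (\<Sum>e\<in>(\<Union>s\<in>{2..r}. ring_edges s). (strain y' e)\<^sup>2)"
    by (rule sum.UNION_disjoint[symmetric]) (use ring_edges_disjoint in auto)
  also have "\<dots> \<le> (\<Sum>e\<in>edges r. (strain y' e)\<^sup>2)"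
    using ring_edges_subset by (intro sum_mono2) (force simp: mem_edges)+
  also have "\<dots> = (\<Sum>e\<in>eshift p ` edges r. (strain y e)\<^sup>2)"
    unfolding wr' by (subst sum.reindex) (auto simp: inj_on_def eshift_def prod_eq_iff)
  finally show ?thesis unfolding p_def .
qed

lemma core_energy_unbounded: "\<exists>r\<ge>1. core_energy r \<ge> C"
proof -
  have "\<not> summable (\<lambda>n. eta / (2 * real n))"
  proof
    assume "summable (\<lambda>n. eta / (2 * real n))"
    then have "summable (\<lambda>n. 2 / eta * (eta / (2 * real n)))" by (rule summable_mult)
    moreover have "2 / eta * (eta / (2 * real n)) = inverse (real n)" for n
      using eta_pos by (simp add: inverse_eq_divide)
    ultimately show False using not_summable_harmonic[where ?'a=real] by simp
  qed
  then have ns: "\<not> summable (\<lambda>n. eta / (2 * real (n + 2)))"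
    by (subst summable_iff_shift[of _ 2])
  have "\<exists>m. (\<Sum>n<m. eta / (2 * real (n + 2))) > max C 0"
  proof (rule ccontr)
    assume "\<not> ?thesis"
    then have le: "(\<Sum>n<m. eta / (2 * real (n + 2))) \<le> max C 0" for m by (simp only: not_ex not_less)
    have "summable (\<lambda>n. eta / (2 * real (n + 2)))"
      by (rule bounded_imp_summable[where B="max C 0"])
        (use eta_pos le in \<open>simp_all only: lessThan_Suc_atMost[symmetric], simp_all\<close>)
    then show False using ns by simp
  qed
  then obtain m where m: "(\<Sum>n<m. eta / (2 * real (n + 2))) > max C 0" by blast
  have "core_energy (m + 1) = (\<Sum>n<m. eta / (2 * real (n + 2)))"
    unfolding core_energy_def by (rule sum.reindex_bij_witness[of _ "\<lambda>n. n + 2" "\<lambda>n. n - 2"]) auto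
  then show ?thesis using m by (intro exI[of _ "m + 1"]) auto
qed

end

section \<open>Comparison with the single dislocation\<close>

definition tshift :: "lpt \<Rightarrow> tri \<Rightarrow> tri" where "tshift p T = (fst T + p, snd T)"

lemma curl_shift: "curl (\<lambda>e. a (eshift p e)) T = curl a (tshift p T)"
  by (cases T; cases "snd T") (auto simp: eshift_def tshift_def add_ac)

lemma inj_eshift: "inj_on (eshift p) A"
  by (auto simp: inj_on_def eshift_def prod_eq_iff)

lemma eshift_inverse: "eshift p (eshift (- p) e) = e" "eshift (- p) (eshift p e) = e"
  by (simp_all add: eshift_def prod_eq_iff)

lemma edges_mono: "M \<le> N \<Longrightarrow> edges M \<subseteq> edges N"
  by (auto simp: mem_edges)

lemma sum_cube_le:
  assumes "finite S" shows "(\<Sum>e\<in>S. 1 / (rad e)^3) \<le> 27"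
proof -
  obtain N where "S \<subseteq> edges N" using exists_edges_superset[OF assms] by blast
  then have "(\<Sum>e\<in>S. 1 / (rad e)^3) \<le> (\<Sum>e\<in>edges N. 1 / (rad e)^3)"
    by (intro sum_mono2) auto
  then show ?thesis using sum_edges_cube[of N] by linarith
qed

lemma aform_square_le: "(aform e)\<^sup>2 \<le> 4 / (rad e)\<^sup>2"
proof -
  have "(aform e)\<^sup>2 \<le> (2 / rad e)\<^sup>2" using aform_decay[of e] by (intro abs_le_square_iff[THEN iffD1]) simp
  then show ?thesis by (simp add: power_divide)
qed

lemma sum_aform_cube_le:
  assumes "finite S" shows "(\<Sum>e\<in>S. \<bar>aform e\<bar>^3) \<le> 216"
proof -
  have "(\<Sum>e\<in>S. \<bar>aform e\<bar>^3) \<le> (\<Sum>e\<in>S. 8 * (1 / (rad e)^3))"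
  proof (rule sum_mono)
    fix e
    have "\<bar>aform e\<bar>^3 \<le> (2 / rad e)^3" using aform_decay[of e] by (intro power_mono) auto
    then show "\<bar>aform e\<bar>^3 \<le> 8 * (1 / (rad e)^3)" by (simp add: power_divide)
  qed
  also have "\<dots> = 8 * (\<Sum>e\<in>S. 1 / (rad e)^3)" by (simp add: sum_distrib_left)
  finally show ?thesis using sum_cube_le[OF assms] by linarith
qed

text \<open>The shifted box exceeds the original one by a boundary layer of O(Q N) edges, on which
  the squared form is O(1 / N^2). The threshold makes the excess 144 Q / N at most 1.\<close>

lemma sum_aform_shift:
  "\<exists>N0. \<forall>N\<ge>N0. (\<Sum>e\<in>edges N. (aform (eshift p e))\<^sup>2) \<le> (\<Sum>e\<in>edges N. (aform e)\<^sup>2) + 1"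
proof -
  define Q where "Q = nat (supn p)"
  have Q: "int Q = supn p" by (simp add: Q_def)
  have "(\<Sum>e\<in>edges N. (aform (eshift p e))\<^sup>2) \<le> (\<Sum>e\<in>edges N. (aform e)\<^sup>2) + 1"
    if N: "N \<ge> 144 * Q + Q + 1" for N
  proof -
    have sub: "eshift p ` edges N \<subseteq> edges (N + Q)"
    proof
      fix e assume "e \<in> eshift p ` edges N"
      then obtain e' where "e' \<in> edges N" "e = eshift p e'" by blast
      then show "e \<in> edges (N + Q)" using supn_add[of "fst e'" p] Q by (simp add: mem_edges eshift_def)
    qed
    have "(\<Sum>e\<in>edges N. (aform (eshift p e))\<^sup>2) = (\<Sum>e\<in>eshift p ` edges N. (aform e)\<^sup>2)"
      by (simp add: sum.reindex[OF inj_eshift])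
    also have "\<dots> \<le> (\<Sum>e\<in>edges (N + Q). (aform e)\<^sup>2)" using sub by (intro sum_mono2) auto
    also have "\<dots> = (\<Sum>e\<in>edges N. (aform e)\<^sup>2) + (\<Sum>e\<in>edges (N + Q) - edges N. (aform e)\<^sup>2)"
      by (subst sum.subset_diff[OF edges_mono[of N "N + Q"]]) auto
    also have "(\<Sum>e\<in>edges (N + Q) - edges N. (aform e)\<^sup>2) \<le> (\<Sum>e\<in>edges (N + Q) - edges N. 4 / (real N)\<^sup>2)"
    proof (rule sum_mono)
      fix e assume "e \<in> edges (N + Q) - edges N"
      then have "supn (fst e) > int N" by (auto simp: mem_edges)
      then have "rad e \<ge> real N" unfolding rad_def by linarith
      then have "4 / (rad e)\<^sup>2 \<le> 4 / (real N)\<^sup>2" using N by (intro divide_left_mono power_mono) auto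
      then show "(aform e)\<^sup>2 \<le> 4 / (real N)\<^sup>2" using aform_square_le[of e] by linarith
    qed
    also have "\<dots> = real (card (edges (N + Q) - edges N)) * (4 / (real N)\<^sup>2)" by simp
    also have "real (card (edges (N + Q) - edges N)) = 3 * ((2 * (real N + real Q) + 1)\<^sup>2 - (2 * real N + 1)\<^sup>2)"
      by (subst card_Diff_subset)
         (auto simp: edges_mono card_edges of_nat_diff power_mono algebra_simps)
    also have "\<dots> = 6 * real Q * (4 * real N + 2 * real Q + 2)"
      by (simp add: power2_eq_square algebra_simps)
    also have "\<dots> * (4 / (real N)\<^sup>2) \<le> 6 * real Q * (6 * real N) * (4 / (real N)\<^sup>2)"
      using N by (intro mult_right_mono mult_left_mono) auto
    also have "\<dots> = 144 * real Q / real N" using N by (simp add: power2_eq_square field_simps)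
    also have "\<dots> \<le> 1"
    proof -
      have "real (144 * Q) \<le> real N" using N unfolding of_nat_le_iff by linarith
      then show ?thesis using N by simp
    qed
    finally show ?thesis by simp
  qed
  then show ?thesis by blast
qed

context potential
begin

definition C1 :: real where "C1 = 432 * Ct / \<mu> + 1"

text \<open>The sign of the energy compares \<psi> on \<open>grad y\<close> with \<psi> on the angle
  form. Estimating the first by (\<psi>5) and the second by \<open>cubic\<close> leaves the cubic
  sum, which is at most 216 = 8 * 27; hence 432 Ct / \<mu> in \<open>C1\<close>. The added 1 pays
  for the translation by p.\<close>

lemma energy_compare:
  assumes u: "finite (supp u)" "energy angle u \<le> 0" and y: "y = (\<lambda>x. angle (x + p) + u (x + p))"
  shows "\<exists>N0. \<forall>N\<ge>N0. (\<Sum>e\<in>edges N. (strain y e)\<^sup>2) \<le> (\<Sum>e\<in>edges N. (aform e)\<^sup>2) + C1"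
proof -
  obtain N1 where N1: "\<And>N. N \<ge> N1 \<Longrightarrow> (\<Sum>e\<in>edges N. (aform (eshift p e))\<^sup>2) \<le> (\<Sum>e\<in>edges N. (aform e)\<^sup>2) + 1"
    using sum_aform_shift[of p] by blast
  have "finite (eshift (- p) ` supp u)" using u by simp
  then obtain N2 where N2: "\<And>N. N \<ge> N2 \<Longrightarrow> eshift (- p) ` supp u \<subseteq> edges N"
    using exists_edges_superset by blast
  have "(\<Sum>e\<in>edges N. (strain y e)\<^sup>2) \<le> (\<Sum>e\<in>edges N. (aform e)\<^sup>2) + C1" if N: "N \<ge> max N1 N2" for N
  proof -
    define S where "S = eshift p ` edges N"
    have finS: "finite S" by (simp add: S_def)
    have "supp u \<subseteq> S"
    proof
      fix e assume "e \<in> supp u"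
      then have "eshift (- p) e \<in> edges N" using N2[of N] N by auto
      then show "e \<in> S" unfolding S_def using eshift_inverse(1)[of p e] by (metis imageI)
    qed
    then have "energy angle u = (\<Sum>e\<in>S. \<psi> (grad (\<lambda>x. angle x + u x) e)) - (\<Sum>e\<in>S. \<psi> (grad angle e))"
      using energy_superset[OF finS] by (simp add: sum_subtractf)
    then have "(\<Sum>e\<in>S. \<psi> (grad (\<lambda>x. angle x + u x) e)) \<le> (\<Sum>e\<in>S. \<psi> (aform e))"
      using u(2) psi_wrap[of "grad angle e" for e] by (simp add: wrap_angle)
    moreover have "(\<Sum>e\<in>S. \<psi> (grad (\<lambda>x. angle x + u x) e)) = (\<Sum>e\<in>edges N. \<psi> (grad y e))"
      unfolding S_def sum.reindex[OF inj_eshift] using grad_shift[of "\<lambda>x. angle x + u x" p] by (simp add: y)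
    moreover have "\<mu> / 2 * (\<Sum>e\<in>edges N. (strain y e)\<^sup>2) \<le> (\<Sum>e\<in>edges N. \<psi> (grad y e))"
      unfolding sum_distrib_left strain_def by (intro sum_mono psi_ge)
    moreover have "(\<Sum>e\<in>S. \<psi> (aform e)) \<le> (\<Sum>e\<in>S. \<mu> / 2 * (aform e)\<^sup>2 + Ct * \<bar>aform e\<bar>^3)"
      by (intro sum_mono cubic) (rule order_trans[OF aform_le], simp)
    moreover have "\<dots> = \<mu> / 2 * (\<Sum>e\<in>S. (aform e)\<^sup>2) + Ct * (\<Sum>e\<in>S. \<bar>aform e\<bar>^3)"
      by (simp add: sum.distrib sum_distrib_left)
    moreover have "Ct * (\<Sum>e\<in>S. \<bar>aform e\<bar>^3) \<le> Ct * 216"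
      using sum_aform_cube_le[OF finS] Ct by (intro mult_left_mono) auto
    ultimately have "\<mu> / 2 * (\<Sum>e\<in>edges N. (strain y e)\<^sup>2) \<le> \<mu> / 2 * (\<Sum>e\<in>S. (aform e)\<^sup>2) + Ct * 216"
      by linarith
    then have "(\<Sum>e\<in>edges N. (strain y e)\<^sup>2) \<le> (\<Sum>e\<in>S. (aform e)\<^sup>2) + 432 * Ct / \<mu>"
      using mu by (simp add: field_simps)
    also have "(\<Sum>e\<in>S. (aform e)\<^sup>2) = (\<Sum>e\<in>edges N. (aform (eshift p e))\<^sup>2)"
      unfolding S_def by (simp add: sum.reindex[OF inj_eshift])
    finally show ?thesis using N1[of N] N unfolding C1_def by simp
  qed
  then show ?thesis by blast
qed

end

section \<open>Dyadic decomposition of the logarithm\<close>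

definition clog :: "nat \<Rightarrow> tri \<Rightarrow> real" where
  "clog M T = min (logd T) (real M * ln 2)"

text \<open>The part of the logarithm gained between the radii 2^k and 2^(k + 1): zero inside the
  annulus and \<open>ln 2\<close> beyond it.\<close>

definition slab :: "nat \<Rightarrow> tri \<Rightarrow> real" where
  "slab k T = min (max (logd T - real k * ln 2) 0) (ln 2)"

lemma logd_nonneg: "logd T \<ge> 0"
  by (simp add: logd_def)

lemma clog_slab: "clog M T = (\<Sum>k<M. slab k T)"
proof (induction M)
  case 0
  then show ?case using logd_nonneg[of T] by (simp add: clog_def)
next
  case (Suc M)
  have "clog (Suc M) T = clog M T + slab M T"
    unfolding clog_def slab_def using ln2_ge_two_thirds by (simp add: min_def max_def algebra_simps)
  then show ?case using Suc by simp
qed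

lemma cmod_le_logd: "cmod (cen T) \<le> 2^k \<Longrightarrow> logd T \<le> real k * ln 2"
proof -
  assume "cmod (cen T) \<le> 2^k"
  then have "max 1 (cmod (cen T)) \<le> 2^k" by simp
  then have "ln (max 1 (cmod (cen T))) \<le> ln (2^k)" by (subst ln_le_cancel_iff) auto
  then show ?thesis by (simp add: logd_def ln_realpow)
qed

lemma cmod_ge_logd: "cmod (cen T) \<ge> 2^k \<Longrightarrow> logd T \<ge> real k * ln 2"
proof -
  assume "cmod (cen T) \<ge> 2^k"
  then have "2^k \<le> max 1 (cmod (cen T))" by simp
  then have "ln (2^k) \<le> ln (max 1 (cmod (cen T)))" by (subst ln_le_cancel_iff) auto
  then show ?thesis by (simp add: logd_def ln_realpow)
qed

lemma slab_inside: "cmod (cen T) \<le> 2^k \<Longrightarrow> slab k T = 0"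
  using cmod_le_logd[of T k] by (simp add: slab_def)

lemma slab_outside: "cmod (cen T) \<ge> 2^Suc k \<Longrightarrow> slab k T = ln 2"
  using cmod_ge_logd[of "Suc k" T] by (simp add: slab_def algebra_simps)

lemma slab_diff_le: "\<bar>slab k T - slab k T'\<bar> \<le> \<bar>logd T - logd T'\<bar>"
  unfolding slab_def by (simp add: min_def max_def)

lemma clog_diff_le: "\<bar>clog M T - clog M T'\<bar> \<le> \<bar>logd T - logd T'\<bar>"
  unfolding clog_def by (simp add: min_def)

lemma slab_mono: "logd T \<le> logd T' \<Longrightarrow> slab k T \<le> slab k T'"
  unfolding slab_def by (simp add: min_def max_def)

text \<open>Each slab is a nondecreasing function of \<open>logd\<close>, and all of them together
  form a truncation of \<open>logd\<close>; so no partial sum varies more than \<open>logd\<close>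
  itself.\<close>

lemma bad_slabs_diff:
  assumes "Bad \<subseteq> {..<M}"
  shows "\<bar>(\<Sum>k\<in>Bad. slab k T) - (\<Sum>k\<in>Bad. slab k T')\<bar> \<le> \<bar>logd T - logd T'\<bar>"
proof -
  have key: "\<bar>(\<Sum>k\<in>Bad. slab k T) - (\<Sum>k\<in>Bad. slab k T')\<bar> \<le> \<bar>logd T - logd T'\<bar>"
    if "logd T \<le> logd T'" for T T'
  proof -
    have d0: "0 \<le> slab k T' - slab k T" for k using slab_mono[OF that, of k] by simp
    have "\<bar>(\<Sum>k\<in>Bad. slab k T) - (\<Sum>k\<in>Bad. slab k T')\<bar> = (\<Sum>k\<in>Bad. slab k T' - slab k T)"
      using sum_nonneg[of Bad "\<lambda>k. slab k T' - slab k T"] d0 by (simp add: sum_subtractf)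
    also have "\<dots> \<le> (\<Sum>k<M. slab k T' - slab k T)"
      using assms d0 by (intro sum_mono2) auto
    also have "\<dots> = clog M T' - clog M T" by (simp add: clog_slab sum_subtractf)
    also have "\<dots> \<le> \<bar>logd T - logd T'\<bar>" using clog_diff_le[of M T' T] by linarith
    finally show ?thesis .
  qed
  show ?thesis
    using key[of T T'] key[of T' T] by (cases "logd T \<le> logd T'") (auto simp: abs_minus_commute)
qed

definition C3 :: real where "C3 = 326700"

text \<open>Dirichlet energy is scale invariant in two dimensions: a slab varies only on O(4^k)
  edges of its annulus, where \<open>logd\<close> changes by O(2^(-k)). The constant
  \<open>C3\<close> is 363 * 900, a count of edges times a squared increment.\<close>

lemma slab_gradient_sum:
  assumes "finite S"
  shows "(\<Sum>e\<in>S. \<bar>slab k (lft e) - slab k (rgt e)\<bar> * \<bar>logd (lft e) - logd (rgt e)\<bar>) \<le> C3"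
proof -
  define x where "x = (2::real)^k"
  have x1: "x \<ge> 1" by (simp add: x_def)
  define A where "A = {e\<in>S. slab k (lft e) \<noteq> slab k (rgt e)}"
  have inA: "e \<in> edges (4 * 2^k + 1)" "rad e \<ge> x / 5" if e: "e \<in> A" for e
  proof -
    define a b where "a = cmod (cen (lft e))" and "b = cmod (cen (rgt e))"
    define m where "m = real_of_int (supn (fst e))"
    have ne: "slab k (lft e) \<noteq> slab k (rgt e)" using e by (simp add: A_def)
    have sm: "real_of_int (supn (fst (lft e))) \<ge> m - 1" "real_of_int (supn (fst (rgt e))) \<ge> m - 1"
      "real_of_int (supn (fst (lft e))) \<le> m + 1" "real_of_int (supn (fst (rgt e))) \<le> m + 1"
      using lft_rgt_supn[of e] unfolding m_def by linarith+
    have lo: "4/5 * (m - 1) - 3/5 \<le> a" "4/5 * (m - 1) - 3/5 \<le> b"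
      using cmod_cen_supn[of "lft e"] cmod_cen_supn[of "rgt e"] sm(1,2) unfolding a_def b_def by argo+
    have up: "a \<le> 2 * (m + 1) + 3/5" "b \<le> 2 * (m + 1) + 3/5"
      using cmod_cen_le[of "lft e"] cmod_cen_le[of "rgt e"] sm(3,4) unfolding a_def b_def by argo+
    have "\<not> (a \<ge> 2 * x \<and> b \<ge> 2 * x)"
      using slab_outside[of k "lft e"] slab_outside[of k "rgt e"] ne
      by (auto simp: a_def b_def x_def)
    then have "a < 2 * x \<or> b < 2 * x" by linarith
    then have "4/5 * (m - 1) - 3/5 < 2 * x"
      using lo by auto
    then have "m \<le> 4 * x + 1" using x1 by argo
    then have "real_of_int (supn (fst e)) \<le> real_of_int (int (4 * 2^k + 1))" unfolding m_def x_def by simp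
    then show "e \<in> edges (4 * 2^k + 1)" unfolding mem_edges of_int_le_iff .
    have "\<not> (a \<le> x \<and> b \<le> x)"
      using slab_inside[of "lft e" k] slab_inside[of "rgt e" k] ne
      by (auto simp: a_def b_def x_def)
    then have "a > x \<or> b > x" by linarith
    then have "2 * (m + 1) + 3/5 > x"
      using up by auto
    then show "rad e \<ge> x / 5" using x1 unfolding rad_def m_def by argo
  qed
  have term_le: "\<bar>slab k (lft e) - slab k (rgt e)\<bar> * \<bar>logd (lft e) - logd (rgt e)\<bar> \<le> 900 / x\<^sup>2" if "e \<in> A" for e
  proof -
    have "6 / rad e \<le> 6 / (x / 5)" using inA(2)[OF that] x1 by (intro divide_left_mono) auto
    then have g: "\<bar>logd (lft e) - logd (rgt e)\<bar> \<le> 30 / x" using logd_diff_rad[of e] by simp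
    have "\<bar>slab k (lft e) - slab k (rgt e)\<bar> * \<bar>logd (lft e) - logd (rgt e)\<bar> \<le> (30 / x) * (30 / x)"
      using g slab_diff_le[of k "lft e" "rgt e"] x1 by (intro mult_mono) auto
    then show ?thesis by (simp add: power2_eq_square)
  qed
  have "card A \<le> card (edges (4 * 2^k + 1))" using inA by (intro card_mono) auto
  then have "real (card A) \<le> real (card (edges (4 * 2^k + 1)))" by (simp only: of_nat_le_iff)
  also have "\<dots> = 3 * (8 * x + 3)\<^sup>2" by (simp add: card_edges x_def algebra_simps)
  also have "\<dots> \<le> 3 * (11 * x)\<^sup>2" using x1 by (intro mult_left_mono power_mono) auto
  finally have cA: "real (card A) \<le> 363 * x\<^sup>2" by (simp add: power_mult_distrib)
  have "(\<Sum>e\<in>S. \<bar>slab k (lft e) - slab k (rgt e)\<bar> * \<bar>logd (lft e) - logd (rgt e)\<bar>)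
      = (\<Sum>e\<in>A. \<bar>slab k (lft e) - slab k (rgt e)\<bar> * \<bar>logd (lft e) - logd (rgt e)\<bar>)"
    by (rule sum.mono_neutral_right) (use assms in \<open>auto simp: A_def\<close>)
  also have "\<dots> \<le> real (card A) * (900 / x\<^sup>2)"
    using term_le by (intro sum_bounded_above) auto
  also have "\<dots> \<le> 363 * x\<^sup>2 * (900 / x\<^sup>2)" using cA by (intro mult_right_mono) auto
  also have "\<dots> = C3" using x1 by (simp add: C3_def)
  finally show ?thesis .
qed

text \<open>One factor of the square is bounded by the increment of \<open>logd\<close> and only the
  other is expanded. The result is linear in the number of slabs, which the comparison with the cost
  of cores requires.\<close>

lemma bad_gradient_sum:
  assumes "finite S" "Bad \<subseteq> {..<M}"
  shows "(\<Sum>e\<in>S. ((\<Sum>k\<in>Bad. slab k (lft e)) - (\<Sum>k\<in>Bad. slab k (rgt e)))\<^sup>2) \<le> C3 * real (card Bad)"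
proof -
  have finB: "finite Bad" using assms(2) finite_subset by blast
  have "((\<Sum>k\<in>Bad. slab k (lft e)) - (\<Sum>k\<in>Bad. slab k (rgt e)))\<^sup>2
      \<le> (\<Sum>k\<in>Bad. \<bar>slab k (lft e) - slab k (rgt e)\<bar> * \<bar>logd (lft e) - logd (rgt e)\<bar>)" for e
  proof -
    define z where "z = (\<Sum>k\<in>Bad. slab k (lft e)) - (\<Sum>k\<in>Bad. slab k (rgt e))"
    have "\<bar>z\<bar> \<le> (\<Sum>k\<in>Bad. \<bar>slab k (lft e) - slab k (rgt e)\<bar>)"
      unfolding z_def sum_subtractf[symmetric] by (rule sum_abs)
    then have "\<bar>z\<bar> * \<bar>z\<bar> \<le> (\<Sum>k\<in>Bad. \<bar>slab k (lft e) - slab k (rgt e)\<bar>) * \<bar>logd (lft e) - logd (rgt e)\<bar>"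
      using bad_slabs_diff[OF assms(2), of "lft e" "rgt e"] unfolding z_def[symmetric]
      by (intro mult_mono) (auto intro: sum_nonneg)
    then show ?thesis by (simp add: z_def power2_eq_square sum_distrib_right)
  qed
  then have "(\<Sum>e\<in>S. ((\<Sum>k\<in>Bad. slab k (lft e)) - (\<Sum>k\<in>Bad. slab k (rgt e)))\<^sup>2)
      \<le> (\<Sum>e\<in>S. \<Sum>k\<in>Bad. \<bar>slab k (lft e) - slab k (rgt e)\<bar> * \<bar>logd (lft e) - logd (rgt e)\<bar>)"
    by (intro sum_mono)
  also have "\<dots> = (\<Sum>k\<in>Bad. \<Sum>e\<in>S. \<bar>slab k (lft e) - slab k (rgt e)\<bar> * \<bar>logd (lft e) - logd (rgt e)\<bar>)"
    by (rule sum.swap)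
  also have "\<dots> \<le> (\<Sum>k\<in>Bad. C3)" by (intro sum_mono slab_gradient_sum assms)
  finally show ?thesis by (simp add: mult.commute)
qed

lemma curl_cong:
  assumes "\<And>e. supn (fst e) \<ge> supn (fst T) - 1 \<Longrightarrow> a e = b e"
  shows "curl a T = curl b T"
proof (cases T)
  case (Pair x c)
  have "supn (x + (1, 0)) \<ge> supn x - 1" "supn (x + (0, 1)) \<ge> supn x - 1"
    by (auto simp: supn_def)
  then show ?thesis using assms Pair by (cases c) auto
qed

lemma exists_pow2_ge: "\<exists>M0. \<forall>M\<ge>M0. (2::real)^M \<ge> C"
proof -
  obtain M0 where "C < (2::real)^M0" using real_arch_pow[of 2 C] by auto
  moreover have "(2::real)^M0 \<le> 2^M" if "M \<ge> M0" for M using that by (intro power_increasing) auto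
  ultimately show ?thesis by (meson less_imp_le order_trans)
qed

lemma Young: "x * y \<le> x\<^sup>2 / 8 + 2 * y\<^sup>2" for x y :: real
  using zero_le_power2[of "x - 4 * y"] by (simp add: power2_eq_square algebra_simps)

lemma slab_far:
  assumes "T \<notin> tris (2 * 2^M)" "k < M" shows "slab k T = ln 2"
proof (rule slab_outside)
  have "real_of_int (supn (fst T)) \<ge> 2 * 2^M + 1"
    using assms(1) of_int_le_iff[of "2 * 2^M + 1" "supn (fst T)", where ?'a=real] by (simp add: mem_tris)
  then have "cmod (cen T) \<ge> 4/5 * (2 * 2^M + 1) - 3/5" using cmod_cen_supn[of T] by argo
  moreover have "(1::real) \<le> 2^M" by simp
  ultimately have "cmod (cen T) \<ge> 2^M" by argo
  moreover have "(2::real)^Suc k \<le> 2^M" using assms(2) by (intro power_increasing) auto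
  ultimately show "2^Suc k \<le> cmod (cen T)" by linarith
qed

context potential
begin

lemma far_field:
  assumes u: "finite (supp u)" and y: "y = (\<lambda>x. angle (x + p) + u (x + p))"
  shows "\<exists>N1. \<forall>e. e \<notin> edges N1 \<longrightarrow> strain y e = aform (eshift p e)"
proof -
  have "finite (eshift (- p) ` supp u)" using u by simp
  from exists_edges_superset[OF this] obtain N1 where N1: "eshift (- p) ` supp u \<subseteq> edges N1" by auto
  have "strain y e = aform (eshift p e)" if "e \<notin> edges N1" for e
  proof -
    have "eshift p e \<notin> supp u"
    proof
      assume "eshift p e \<in> supp u"
      then have "eshift (- p) (eshift p e) \<in> edges N1" using N1 by (auto dest: subsetD)
      then show False using that by (simp add: eshift_inverse)
    qed
    then have "grad u (eshift p e) = 0" by (simp add: supp_def)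
    then have "grad y e = grad angle (eshift p e)"
      unfolding y by (simp add: grad_def eshift_simps)
    then show ?thesis by (simp add: strain_def wrap_angle)
  qed
  then show ?thesis by blast
qed

text \<open>Far out the strain is that of a translated single dislocation, and a difference of
  finite support has total curl 0.\<close>

lemma finite_charges:
  assumes u: "finite (supp u)" and y: "y = (\<lambda>x. angle (x + p) + u (x + p))"
  shows "\<exists>N2. \<forall>N\<ge>N2. {T. curl (strain y) T \<noteq> 0} \<subseteq> tris N \<and> (\<Sum>T\<in>tris N. curl (strain y) T) = 1"
proof -
  obtain N1 where N1: "\<And>e. e \<notin> edges N1 \<Longrightarrow> strain y e = aform (eshift p e)" using far_field[OF assms] by blast
  define N2 where "N2 = N1 + 2 + nat (supn p)"
  have crs: "curl (\<lambda>e. aform (eshift p e)) T = (if T = (- p, True) then 1 else 0)" for T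
    unfolding curl_shift curl_aform by (auto simp: tshift_def prod_eq_iff)
  have "{T. curl (strain y) T \<noteq> 0} \<subseteq> tris N \<and> (\<Sum>T\<in>tris N. curl (strain y) T) = 1" if N: "N \<ge> N2" for N
  proof
    have pT: "(- p, True) \<in> tris N" using N by (simp add: mem_tris N2_def)
    show "{T. curl (strain y) T \<noteq> 0} \<subseteq> tris N"
    proof (rule subsetI, rule ccontr)
      fix T assume T: "T \<in> {T. curl (strain y) T \<noteq> 0}" "T \<notin> tris N"
      then have "supn (fst T) > int N" by (simp add: mem_tris)
      then have "curl (strain y) T = curl (\<lambda>e. aform (eshift p e)) T"
        using N by (intro curl_cong N1) (auto simp: mem_edges N2_def)
      also have "\<dots> = 0" using crs T pT by auto
      finally show False using T by simp
    qed
    have "(\<Sum>T\<in>tris N. curl (\<lambda>e. strain y e - aform (eshift p e)) T) = 0"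
      by (rule sum_curl_finite_support[of N1]) (use N1 N in \<open>auto simp: N2_def\<close>)
    then have "(\<Sum>T\<in>tris N. curl (strain y) T) = (\<Sum>T\<in>tris N. curl (\<lambda>e. aform (eshift p e)) T)"
      by (simp add: curl_diff sum_subtractf)
    also have "\<dots> = 1" unfolding crs using pT by simp
    finally show "(\<Sum>T\<in>tris N. curl (strain y) T) = 1" .
  qed
  then show ?thesis by blast
qed

text \<open>Centred at the origin, because the configuration will be translated so that the core
  found by \<open>cluster_descent\<close> lies there. The radii 2^k and 2^(k + 1) bound the annulus
  on which \<open>slab k\<close> varies.\<close>

definition good_scale :: "(lpt \<Rightarrow> real) \<Rightarrow> nat \<Rightarrow> bool" where
  "good_scale y k \<longleftrightarrow> (\<exists>S\<subseteq>{T. curl (strain y) T \<noteq> 0}. (\<Sum>T\<in>S. curl (strain y) T) \<ge> 1 \<and>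
     (\<forall>T\<in>S. cmod (cen T) \<le> 2^k) \<and> (\<forall>T. curl (strain y) T \<noteq> 0 \<longrightarrow> T \<notin> S \<longrightarrow> cmod (cen T) \<ge> 2^Suc k))"

text \<open>What results from solving G \<le> C1 + 2 (G / 8 + 69985) + 2 (G / 8 + C3 nb) for G in
  \<open>gamma_bound\<close>: 69985 is 2592 * 27 + 1, and 279940 is four times that.\<close>

definition C4 :: real where "C4 = 2 * C1 + 279940 + 4 * C3"

lemma C4_pos: "C4 > 0"
  using Ct mu by (simp add: C4_def C1_def C3_def add_pos_pos)

text \<open>On a good scale no core is cut by the annulus, so the pairing with the slab only sees
  the total charge of the cluster inside, which is at least the net charge 1.\<close>
lemma good_scale_pairing:
  assumes good: "good_scale y k" and k: "k < M"
    and sub: "{T. curl (strain y) T \<noteq> 0} \<subseteq> tris (Suc (2 * 2^M))"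
    and tot: "(\<Sum>T\<in>tris (Suc (2 * 2^M)). curl (strain y) T) = 1"
  shows "(\<Sum>e\<in>edges (Suc (2 * 2^M)). (strain y e - aform e) * (slab k (lft e) - slab k (rgt e))) \<le> 0"
proof -
  define N where "N = Suc (2 * 2^M)"
  define X where "X = {T. curl (strain y) T \<noteq> 0}"
  have XN: "X \<subseteq> tris N" "finite X" using sub finite_subset[OF sub] by (auto simp: X_def N_def)
  have z: "(0, True) \<in> tris N" by (simp add: mem_tris)
  obtain S where S: "S \<subseteq> X" "(\<Sum>T\<in>S. curl (strain y) T) \<ge> 1" "\<And>T. T \<in> S \<Longrightarrow> cmod (cen T) \<le> 2^k"
     "\<And>T. T \<in> X \<Longrightarrow> T \<notin> S \<Longrightarrow> cmod (cen T) \<ge> 2^Suc k"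
    using good unfolding good_scale_def X_def by blast
  have X1: "(\<Sum>T\<in>X. curl (strain y) T) = 1"
    unfolding tot[symmetric] N_def[symmetric]
    by (rule sum.mono_neutral_left) (use XN in \<open>auto simp: X_def\<close>)
  have crg: "curl (\<lambda>e. strain y e - aform e) T = curl (strain y) T - (if T = (0, True) then 1 else 0)" for T
    by (simp add: curl_diff curl_aform)
  have "(\<Sum>T\<in>tris N. curl (\<lambda>e. strain y e - aform e) T) = 0"
    unfolding crg sum_subtractf using tot z by (simp add: N_def)
  then have "(\<Sum>e\<in>edges N. (strain y e - aform e) * (slab k (lft e) - slab k (rgt e)))
      = (\<Sum>T\<in>tris N. slab k T * curl (\<lambda>e. strain y e - aform e) T)"
    unfolding N_def by (intro summation_by_parts_const[where c="ln 2"] slab_far[OF _ k])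
  also have "\<dots> = (\<Sum>T\<in>tris N. slab k T * curl (strain y) T) - (\<Sum>T\<in>tris N. if T = (0, True) then slab k T else 0)"
    unfolding crg right_diff_distrib sum_subtractf by (simp add: if_distrib cong: if_cong)
  also have "(\<Sum>T\<in>tris N. if T = (0, True) then slab k T else 0) = 0"
    using z slab_inside[of "(0, True)" k] by simp
  also have "(\<Sum>T\<in>tris N. slab k T * curl (strain y) T) = (\<Sum>T\<in>X. slab k T * curl (strain y) T)"
    by (rule sum.mono_neutral_right) (use XN in \<open>auto simp: X_def\<close>)
  also have "\<dots> = (\<Sum>T\<in>X - S. slab k T * curl (strain y) T) + (\<Sum>T\<in>S. slab k T * curl (strain y) T)"
    using S(1) XN by (simp add: sum.subset_diff)
  also have "(\<Sum>T\<in>S. slab k T * curl (strain y) T) = 0"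
    using S(3) slab_inside by (intro sum.neutral) auto
  also have "(\<Sum>T\<in>X - S. slab k T * curl (strain y) T) = (\<Sum>T\<in>X - S. ln 2 * curl (strain y) T)"
    using S(4) slab_outside by (intro sum.cong) auto
  also have "\<dots> = ln 2 * (1 - (\<Sum>T\<in>S. curl (strain y) T))"
    using X1 S(1) XN by (simp add: sum_diff flip: sum_distrib_left)
  finally have "(\<Sum>e\<in>edges N. (strain y e - aform e) * (slab k (lft e) - slab k (rgt e)))
      = ln 2 * (1 - (\<Sum>T\<in>S. curl (strain y) T))" by simp
  also have "\<dots> \<le> 0" using S(2) by (intro mult_nonneg_nonpos) auto
  finally show ?thesis unfolding N_def .
qed

text \<open>After expanding the square of strain = \<open>aform\<close> + \<gamma>,
  \<open>energy_compare\<close> bounds the squared norm G of \<gamma> by \<open>C1\<close> minus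
  twice its pairing with \<open>aform\<close>. There \<open>aform\<close> is replaced by the
  truncated conjugate logarithm. The good slabs have a favourable sign; the error of the replacement
  and the bad slabs are absorbed at the cost of G / 8 each.\<close>

lemma gamma_bound:
  assumes u: "finite (supp u)" "energy angle u \<le> 0" and y: "y = (\<lambda>x. angle (x + p) + u (x + p))"
    and nb: "\<And>M. real (card {k. k < M \<and> \<not> good_scale y k}) \<le> nb"
  shows "(\<Sum>e\<in>edges N'. (strain y e - aform e)\<^sup>2) \<le> C4 * (1 + nb)"
proof -
  obtain N0 where N0: "\<And>N. N \<ge> N0 \<Longrightarrow> (\<Sum>e\<in>edges N. (strain y e)\<^sup>2) \<le> (\<Sum>e\<in>edges N. (aform e)\<^sup>2) + C1"
    using energy_compare[OF u y] by blast
  obtain N1 where N1: "\<And>e. e \<notin> edges N1 \<Longrightarrow> strain y e = aform (eshift p e)" using far_field[OF u(1) y] by blast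
  obtain N2 where N2: "\<And>N. N \<ge> N2 \<Longrightarrow> {T. curl (strain y) T \<noteq> 0} \<subseteq> tris N \<and> (\<Sum>T\<in>tris N. curl (strain y) T) = 1"
    using finite_charges[OF u(1) y] by blast
  obtain Cq where Cq: "Cq > 0" "\<And>e. \<bar>aform (eshift p e) - aform e\<bar> \<le> Cq / (rad e)\<^sup>2"
    using aform_shift_diff[of p] by blast
  \<comment> \<open>The truncation radius 2^M must lie beyond the perturbed edges (N1) and its box
    must contain all charges (N2) and be large enough for the energy comparison (N0) and the claim
    (N'). The factor 37632 = 3 * 7^2 * 256 makes the errors \<delta> sum to at most 1.\<close>
  obtain M where M: "(2::real)^M \<ge> 37632 * Cq + 4 * (real N1 + 3) + real N0 + real N2 + real N' + 2"
    using exists_pow2_ge by blast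
  define x where "x = (2::real)^M"
  define N where "N = Suc (2 * 2^M)"
  have Nx: "real N = 2 * x + 1" by (simp add: N_def x_def)
  have x2: "x \<ge> 2" "x \<ge> 37632 * Cq" "x \<ge> 4 * (real N1 + 3)" "real N0 \<le> real N" "real N2 \<le> real N" "real N' \<le> real N"
  proof -
    have "0 \<le> real N0" "0 \<le> real N1" "0 \<le> real N2" "0 \<le> real N'" by simp_all
    then show "x \<ge> 2" "x \<ge> 37632 * Cq" "x \<ge> 4 * (real N1 + 3)"
      "real N0 \<le> real N" "real N2 \<le> real N" "real N' \<le> real N"
      using M Cq(1) unfolding Nx x_def[symmetric] by argo+
  qed
  define \<gamma> where "\<gamma> e = strain y e - aform e" for e
  define G where "G = (\<Sum>e\<in>edges N. (\<gamma> e)\<^sup>2)"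
  define c where "c = sqrt 3 / (2 * pi)"
  have c: "0 \<le> c" "c \<le> 1/3" using sqrt3_2pi by (simp_all add: c_def)
  define bM where "bM e = c * (clog M (rgt e) - clog M (lft e))" for e
  define \<delta> where "\<delta> = 256 * Cq / x^3"
  \<comment> \<open>Where the truncation is inactive, \<open>bM\<close> is \<open>lform\<close>, and
    Young's inequality splits off the quadratic error. Elsewhere the edge is so far out that
    \<gamma> is only the effect of a translation: the product is O(2^(-3 M)), on O(4^M)
    edges.\<close>
  have err: "- (aform e - bM e) * \<gamma> e \<le> ((\<gamma> e)\<^sup>2 / 8 + 2592 * (1 / (rad e)^3)) + \<delta>" for e
  proof (cases "logd (lft e) \<le> real M * ln 2 \<and> logd (rgt e) \<le> real M * ln 2")
    case True
    then have "bM e = lform e" by (simp add: bM_def lform_def clog_def c_def min_def)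
    then have "\<bar>aform e - bM e\<bar> \<le> 36 / (rad e)\<^sup>2" using aform_lform by simp
    then have "\<bar>- (aform e - bM e) * \<gamma> e\<bar> \<le> 36 / (rad e)\<^sup>2 * \<bar>\<gamma> e\<bar>"
      unfolding abs_mult by (intro mult_right_mono) auto
    also have "\<dots> = \<bar>\<gamma> e\<bar> * (36 / (rad e)\<^sup>2)" by simp
    also have "\<dots> \<le> \<bar>\<gamma> e\<bar>\<^sup>2 / 8 + 2 * (36 / (rad e)\<^sup>2)\<^sup>2" by (rule Young)
    also have "2 * (36 / (rad e)\<^sup>2)\<^sup>2 = 2592 * (1 / (rad e)^4)" by (simp add: power_divide)
    also have "1 / (rad e)^4 \<le> 1 / (rad e)^3"
      using rad_ge1[of e] by (intro divide_left_mono power_increasing) auto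
    finally have "\<bar>- (aform e - bM e) * \<gamma> e\<bar> \<le> (\<gamma> e)\<^sup>2 / 8 + 2592 * (1 / (rad e)^3)" by simp
    moreover have "\<delta> \<ge> 0" using Cq(1) x2(1) by (simp add: \<delta>_def)
    ultimately show ?thesis by linarith
  next
    case False
    then have "cmod (cen (lft e)) > x \<or> cmod (cen (rgt e)) > x"
      using cmod_le_logd[of "lft e" M] cmod_le_logd[of "rgt e" M] unfolding x_def by linarith
    moreover have "real_of_int (supn (fst (lft e))) \<le> real_of_int (supn (fst e)) + 1"
       "real_of_int (supn (fst (rgt e))) \<le> real_of_int (supn (fst e)) + 1"
      using lft_rgt_supn[of e] by linarith+
    then have "cmod (cen (lft e)) \<le> 2 * rad e + 3/5" "cmod (cen (rgt e)) \<le> 2 * rad e + 3/5"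
      using cmod_cen_le[of "lft e"] cmod_cen_le[of "rgt e"] unfolding rad_def by argo+
    ultimately have "2 * rad e + 3/5 > x" by auto
    then have nrx: "rad e \<ge> x / 4" using x2(1) by argo
    then have "rad e - 1 > real N1" using x2(3) by argo
    then have "e \<notin> edges N1" unfolding mem_edges rad_def by simp
    then have "\<gamma> e = aform (eshift p e) - aform e" using N1 by (simp add: \<gamma>_def)
    then have g: "\<bar>\<gamma> e\<bar> \<le> Cq / (rad e)\<^sup>2" using Cq(2) by simp
    have "\<bar>bM e\<bar> = c * \<bar>clog M (rgt e) - clog M (lft e)\<bar>" using c by (simp add: bM_def abs_mult)
    also have "\<dots> \<le> 1/3 * (6 / rad e)"
      using c clog_diff_le[of M "rgt e" "lft e"] logd_diff_rad[of e]
      by (intro mult_mono) (auto simp: abs_minus_commute)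
    finally have "\<bar>bM e\<bar> \<le> 2 / rad e" by simp
    then have "\<bar>aform e - bM e\<bar> \<le> 2 / rad e + 2 / rad e"
      using aform_decay[of e] abs_triangle_ineq4[of "aform e" "bM e"] by linarith
    then have "\<bar>aform e - bM e\<bar> \<le> 4 / rad e" by simp
    then have "\<bar>aform e - bM e\<bar> * \<bar>\<gamma> e\<bar> \<le> 4 / rad e * (Cq / (rad e)\<^sup>2)"
      using g by (intro mult_mono) auto
    also have "\<dots> = 4 * Cq / (rad e)^3" by (simp add: power2_eq_square power3_eq_cube)
    also have "\<dots> \<le> 4 * Cq / (x / 4)^3"
      using nrx x2(1) Cq(1) by (intro divide_left_mono power_mono) auto
    also have "\<dots> = \<delta>" by (simp add: \<delta>_def power_divide)
    finally have "- (aform e - bM e) * \<gamma> e \<le> \<delta>"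
      using abs_ge_self[of "- (aform e - bM e) * \<gamma> e"] by (simp add: abs_mult abs_minus_commute)
    moreover have "0 \<le> (\<gamma> e)\<^sup>2 / 8 + 2592 * (1 / (rad e)^3)" by simp
    ultimately show ?thesis by linarith
  qed
  have "real (card (edges N)) = 3 * (4 * x + 3)\<^sup>2" by (simp add: card_edges N_def x_def algebra_simps)
  also have "\<dots> \<le> 3 * (7 * x)\<^sup>2" using x2(1) by (intro mult_left_mono power_mono) auto
  finally have "real (card (edges N)) * \<delta> \<le> 3 * (7 * x)\<^sup>2 * \<delta>"
    using Cq(1) x2(1) by (intro mult_right_mono) (auto simp: \<delta>_def)
  also have "\<dots> = 37632 * Cq / x" using x2(1) by (simp add: \<delta>_def power2_eq_square power3_eq_cube)
  also have "\<dots> \<le> 1" using x2(1,2) by simp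
  finally have cd: "real (card (edges N)) * \<delta> \<le> 1" .
  have "(\<Sum>e\<in>edges N. - (aform e - bM e) * \<gamma> e)
      \<le> (\<Sum>e\<in>edges N. ((\<gamma> e)\<^sup>2 / 8 + 2592 * (1 / (rad e)^3)) + \<delta>)" by (intro sum_mono err)
  also have "\<dots> = G / 8 + 2592 * (\<Sum>e\<in>edges N. 1 / (rad e)^3) + real (card (edges N)) * \<delta>"
    by (simp add: sum.distrib G_def sum_distrib_left sum_divide_distrib)
  also have "\<dots> \<le> G / 8 + 2592 * 27 + 1" using sum_edges_cube[of N] cd by linarith
  finally have part1: "(\<Sum>e\<in>edges N. - (aform e - bM e) * \<gamma> e) \<le> G / 8 + 69985" by simp
  define Bad where "Bad = {k. k < M \<and> \<not> good_scale y k}"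
  have Bad: "Bad \<subseteq> {..<M}" "finite Bad" by (auto simp: Bad_def)
  define F where "F T = (\<Sum>k\<in>Bad. slab k T)" for T
  have N2': "{T. curl (strain y) T \<noteq> 0} \<subseteq> tris (Suc (2 * 2^M))" "(\<Sum>T\<in>tris (Suc (2 * 2^M)). curl (strain y) T) = 1"
    using N2[of N] x2(5) unfolding N_def by auto
  have "(\<Sum>e\<in>edges N. \<gamma> e * (clog M (lft e) - clog M (rgt e)))
      = (\<Sum>k<M. \<Sum>e\<in>edges N. \<gamma> e * (slab k (lft e) - slab k (rgt e)))"
    unfolding clog_slab sum_subtractf[symmetric] sum_distrib_left by (rule sum.swap)
  also have "\<dots> = (\<Sum>k\<in>{..<M} - Bad. \<Sum>e\<in>edges N. \<gamma> e * (slab k (lft e) - slab k (rgt e)))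
      + (\<Sum>k\<in>Bad. \<Sum>e\<in>edges N. \<gamma> e * (slab k (lft e) - slab k (rgt e)))"
    using Bad by (simp add: sum.subset_diff)
  also have "(\<Sum>k\<in>{..<M} - Bad. \<Sum>e\<in>edges N. \<gamma> e * (slab k (lft e) - slab k (rgt e))) \<le> 0"
    unfolding \<gamma>_def N_def by (intro sum_nonpos good_scale_pairing N2') (auto simp: Bad_def)
  also have "(\<Sum>k\<in>Bad. \<Sum>e\<in>edges N. \<gamma> e * (slab k (lft e) - slab k (rgt e)))
      = (\<Sum>e\<in>edges N. \<gamma> e * (F (lft e) - F (rgt e)))"
    unfolding F_def sum_subtractf[symmetric] sum_distrib_left by (rule sum.swap)
  finally have "(\<Sum>e\<in>edges N. \<gamma> e * (clog M (lft e) - clog M (rgt e))) \<le> (\<Sum>e\<in>edges N. \<gamma> e * (F (lft e) - F (rgt e)))"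
    by simp
  then have "c * (\<Sum>e\<in>edges N. \<gamma> e * (clog M (lft e) - clog M (rgt e))) \<le> c * (\<Sum>e\<in>edges N. \<gamma> e * (F (lft e) - F (rgt e)))"
    using c by (intro mult_left_mono)
  also have "\<dots> = (\<Sum>e\<in>edges N. \<gamma> e * (c * (F (lft e) - F (rgt e))))"
    by (simp add: sum_distrib_left mult_ac)
  also have "\<dots> \<le> (\<Sum>e\<in>edges N. (\<gamma> e)\<^sup>2 / 8 + 2 * (c * (F (lft e) - F (rgt e)))\<^sup>2)"
    by (intro sum_mono Young)
  also have "\<dots> = G / 8 + 2 * c\<^sup>2 * (\<Sum>e\<in>edges N. (F (lft e) - F (rgt e))\<^sup>2)"
    by (simp add: sum.distrib G_def sum_distrib_left sum_divide_distrib power_mult_distrib mult_ac)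
  also have "\<dots> \<le> G / 8 + 1 * (C3 * real (card Bad))"
  proof -
    have "c\<^sup>2 \<le> (1/3)\<^sup>2" using c by (intro power_mono) auto
    then have "2 * c\<^sup>2 \<le> 1" by (simp add: power2_eq_square)
    moreover have "(\<Sum>e\<in>edges N. (F (lft e) - F (rgt e))\<^sup>2) \<le> C3 * real (card Bad)"
      unfolding F_def by (rule bad_gradient_sum[OF finite_edges Bad(1)])
    ultimately show ?thesis by (intro add_left_mono mult_mono) (auto intro: sum_nonneg)
  qed
  also have "\<dots> \<le> G / 8 + C3 * nb" using nb[of M] unfolding Bad_def by (simp add: C3_def)
  finally have part2: "c * (\<Sum>e\<in>edges N. \<gamma> e * (clog M (lft e) - clog M (rgt e))) \<le> G / 8 + C3 * nb" .
  have eq: "(\<Sum>e\<in>edges N. - (aform e * \<gamma> e))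
    = (\<Sum>e\<in>edges N. - (aform e - bM e) * \<gamma> e) + c * (\<Sum>e\<in>edges N. \<gamma> e * (clog M (lft e) - clog M (rgt e)))"
    unfolding sum_distrib_left sum.distrib[symmetric]
    by (intro sum.cong) (auto simp: bM_def algebra_simps)
  have "(strain y e)\<^sup>2 = (aform e)\<^sup>2 + (\<gamma> e)\<^sup>2 + 2 * (aform e * \<gamma> e)" for e
    by (simp add: \<gamma>_def power2_eq_square algebra_simps)
  then have "(\<Sum>e\<in>edges N. (strain y e)\<^sup>2) = (\<Sum>e\<in>edges N. (aform e)\<^sup>2) + G + 2 * (\<Sum>e\<in>edges N. aform e * \<gamma> e)"
    by (simp add: sum.distrib G_def sum_distrib_left)
  then have "G \<le> C1 + 2 * (\<Sum>e\<in>edges N. - (aform e * \<gamma> e))"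
    using N0[of N] x2(4) by (simp add: sum_negf)
  then have "G \<le> C1 + 2 * (G / 8 + 69985) + 2 * (G / 8 + C3 * nb)"
    unfolding eq using part1 part2 by argo
  then have "G \<le> 2 * C1 + 279940 + 4 * C3 * nb" by (simp add: field_simps)
  also have "\<dots> \<le> C4 * (1 + nb)"
  proof -
    have nb0: "0 \<le> nb" using nb[of 0] by simp
    have "0 \<le> (2 * C1 + 279940) * nb" using Ct mu nb0 by (intro mult_nonneg_nonneg) (auto simp: C1_def)
    then show ?thesis unfolding C4_def by (simp add: algebra_simps C3_def)
  qed
  finally have "G \<le> C4 * (1 + nb)" .
  moreover have "(\<Sum>e\<in>edges N'. (strain y e - aform e)\<^sup>2) \<le> G"
    unfolding G_def \<gamma>_def using x2(6) by (intro sum_mono2 edges_mono) auto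
  ultimately show ?thesis by linarith
qed

end

section \<open>Counting well separated cores\<close>

context potential
begin

text \<open>The boxes around the cores are disjoint and carry \<open>core_energy r\<close> each;
  half of it must appear in \<gamma>, up to the square of \<open>aform\<close>. Beyond
  \<open>edges (4 * r)\<close> a box has O(r^2) edges with squared form O(1 / r^2), at most 27 per
  core in total; the remaining edges contribute at most a fixed finite sum.\<close>

lemma core_count:
  assumes am: "almost_min \<epsilon> y" and eps: "\<epsilon> > 0" and r: "r \<ge> 1"
    and small: "\<epsilon> * (1 + 3 * (2 * real r + 1)\<^sup>2) \<le> \<mu> / 24"
    and Y: "finite Y" "\<And>T. T \<in> Y \<Longrightarrow> curl (strain y) T \<noteq> 0"
    and sep: "\<And>T T'. T \<in> Y \<Longrightarrow> T' \<in> Y \<Longrightarrow> T \<noteq> T' \<Longrightarrow> supn (fst T - fst T') > 2 * int r"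
    and G: "\<And>N. (\<Sum>e\<in>edges N. (strain y e - aform e)\<^sup>2) \<le> G"
  shows "real (card Y) * (core_energy r / 2 - 27) \<le> G + (\<Sum>e\<in>edges (4 * r). (aform e)\<^sup>2)"
proof -
  define bx where "bx T = eshift (fst T) ` edges r" for T :: tri
  define U where "U = (\<Union>T\<in>Y. bx T)"
  have finb: "finite (bx T)" for T by (simp add: bx_def)
  have finU: "finite U" using Y finb by (simp add: U_def)
  have cardb: "card (bx T) = 3 * (2 * r + 1)\<^sup>2" for T
    by (simp add: bx_def card_image[OF inj_eshift] card_edges)
  have disj: "bx T \<inter> bx T' = {}" if "T \<in> Y" "T' \<in> Y" "T \<noteq> T'" for T T'
  proof (rule ccontr)
    assume "bx T \<inter> bx T' \<noteq> {}"
    then obtain e0 where e0: "e0 \<in> eshift (fst T) ` edges r" "e0 \<in> eshift (fst T') ` edges r"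
      unfolding bx_def by blast
    obtain e1 where e1: "e1 \<in> edges r" "e0 = eshift (fst T) e1" using e0(1) by (rule imageE)
    obtain e2 where e2: "e2 \<in> edges r" "e0 = eshift (fst T') e2" using e0(2) by (rule imageE)
    have e: "e1 \<in> edges r" "e2 \<in> edges r" "eshift (fst T) e1 = eshift (fst T') e2" using e1 e2 by simp_all
    then have "fst T - fst T' = fst e2 - fst e1" by (simp add: eshift_def algebra_simps)
    then have "supn (fst T - fst T') \<le> supn (fst e2) + supn (fst e1)" using supn_diff by metis
    then show False using sep[OF that] e by (simp add: mem_edges)
  qed
  have sumU: "(\<Sum>e\<in>U. g e) = (\<Sum>T\<in>Y. \<Sum>e\<in>bx T. g e)" for g :: "edge \<Rightarrow> real"
    unfolding U_def by (rule sum.UNION_disjoint) (use Y finb disj in auto)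
  obtain N where N: "U \<subseteq> edges N" using exists_edges_superset[OF finU] by auto
  have "(\<Sum>e\<in>U. (strain y e - aform e)\<^sup>2) \<le> (\<Sum>e\<in>edges N. (strain y e - aform e)\<^sup>2)"
    using N by (intro sum_mono2) auto
  then have up: "(\<Sum>e\<in>U. (strain y e - aform e)\<^sup>2) \<le> G" using G[of N] by linarith
  have "(strain y e - aform e)\<^sup>2 \<ge> (strain y e)\<^sup>2 / 2 - (aform e)\<^sup>2" for e
    using zero_le_power2[of "strain y e - 2 * aform e"] by (simp add: power2_eq_square algebra_simps)
  then have "(\<Sum>e\<in>U. (strain y e)\<^sup>2 / 2 - (aform e)\<^sup>2) \<le> (\<Sum>e\<in>U. (strain y e - aform e)\<^sup>2)" by (intro sum_mono)
  then have lo: "(\<Sum>e\<in>U. (strain y e)\<^sup>2) / 2 - (\<Sum>e\<in>U. (aform e)\<^sup>2) \<le> G"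
    using up by (simp add: sum_subtractf sum_divide_distrib)
  have "real (card Y) * core_energy r = (\<Sum>T\<in>Y. core_energy r)" by simp
  also have "\<dots> \<le> (\<Sum>T\<in>Y. \<Sum>e\<in>bx T. (strain y e)\<^sup>2)"
    unfolding bx_def by (intro sum_mono box_energy_ge[OF am eps _ small] Y)
  finally have HU: "real (card Y) * core_energy r \<le> (\<Sum>e\<in>U. (strain y e)\<^sup>2)" by (simp add: sumU)
  have "(\<Sum>e\<in>U. (aform e)\<^sup>2) = (\<Sum>e\<in>U \<inter> edges (4 * r). (aform e)\<^sup>2) + (\<Sum>e\<in>U - edges (4 * r). (aform e)\<^sup>2)"
    using sum.Int_Diff[OF finU] by blast
  also have "(\<Sum>e\<in>U \<inter> edges (4 * r). (aform e)\<^sup>2) \<le> (\<Sum>e\<in>edges (4 * r). (aform e)\<^sup>2)"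
    by (intro sum_mono2) auto
  also have "(\<Sum>e\<in>U - edges (4 * r). (aform e)\<^sup>2) \<le> (\<Sum>e\<in>U - edges (4 * r). 1 / (4 * (real r)\<^sup>2))"
  proof (rule sum_mono)
    fix e assume "e \<in> U - edges (4 * r)"
    then have "supn (fst e) > int (4 * r)" by (simp add: mem_edges)
    then have "rad e \<ge> 4 * real r" unfolding rad_def by linarith
    then have "4 / (rad e)\<^sup>2 \<le> 4 / (4 * real r)\<^sup>2"
      using r by (intro divide_left_mono power_mono mult_pos_pos) auto
    also have "\<dots> = 1 / (4 * (real r)\<^sup>2)" by (simp add: power_mult_distrib)
    finally show "(aform e)\<^sup>2 \<le> 1 / (4 * (real r)\<^sup>2)" using aform_square_le[of e] by linarith
  qed
  also have "\<dots> \<le> real (card U) * (1 / (4 * (real r)\<^sup>2))"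
    using finU by (simp add: card_mono divide_right_mono)
  also have "card U \<le> card Y * (3 * (2 * r + 1)\<^sup>2)"
    unfolding U_def using card_UN_le[OF Y(1), of bx] by (simp add: cardb)
  also have "real (card Y * (3 * (2 * r + 1)\<^sup>2)) * (1 / (4 * (real r)\<^sup>2)) \<le> real (card Y) * 27"
  proof -
    have "(2 * real r + 1)\<^sup>2 \<le> (3 * real r)\<^sup>2" using r by (intro power_mono) auto
    then have "3 * (2 * real r + 1)\<^sup>2 / (4 * (real r)\<^sup>2) \<le> 3 * (9 * (real r)\<^sup>2) / (4 * (real r)\<^sup>2)"
      by (intro divide_right_mono) (auto simp: power_mult_distrib)
    also have "\<dots> \<le> 27" using r by simp
    finally have "real (card Y) * (3 * (2 * real r + 1)\<^sup>2 / (4 * (real r)\<^sup>2)) \<le> real (card Y) * 27"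
      by (intro mult_left_mono) auto
    then show ?thesis by (simp add: mult_ac add_ac)
  qed
  finally have "(\<Sum>e\<in>U. (aform e)\<^sup>2) \<le> (\<Sum>e\<in>edges (4 * r). (aform e)\<^sup>2) + real (card Y) * 27"
    by (simp add: mult_right_mono divide_right_mono)
  then show ?thesis using lo HU by (simp add: algebra_simps)
qed

end

lemma cen_diff_le: "cmod (cen T - cen T') \<le> 2 * of_int (supn (fst T - fst T')) + 3/5"
proof -
  have "cen T - cen T' \<in> {lpos (fst T - fst T'), lpos (fst T - fst T') + offs, lpos (fst T - fst T') - offs}"
    by (cases T; cases T'; cases "snd T"; cases "snd T'") (auto simp: lpos_diff)
  then show ?thesis
    using cmod_lpos_le[of "fst T - fst T'"] offs_le norm_triangle_ineq[of "lpos (fst T - fst T')" offs]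
      norm_triangle_ineq4[of "lpos (fst T - fst T')" offs] by auto
qed

text \<open>A maximal separated set of cores, with every core attached to a member within 2 r of it;
  the fibres have diameter at most 10 r. Clustering can thus start with as many clusters as there
  are separated cores, the quantity that \<open>core_count\<close> controls, however many cores
  there are.\<close>

lemma separated_net:
  fixes X :: "tri set"
  assumes X: "finite X" and r: "r \<ge> 1"
  shows "\<exists>Y\<subseteq>X. (\<forall>T\<in>Y. \<forall>T'\<in>Y. T \<noteq> T' \<longrightarrow> supn (fst T - fst T') > 2 * int r) \<and>
    (\<exists>P. partition_on X P \<and> card P = card Y \<and> spread cen P \<le> 10 * real r * real (card P))"
proof -
  define sep where "sep Y \<longleftrightarrow> (\<forall>T\<in>Y. \<forall>T'\<in>Y. T \<noteq> T' \<longrightarrow> supn (fst T - fst T') > 2 * int r)" for Y :: "tri set"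
  have fin: "finite {Y. Y \<subseteq> X \<and> sep Y}" using X by simp
  have ne: "{Y. Y \<subseteq> X \<and> sep Y} \<noteq> {}" by (auto simp: sep_def intro!: exI[of _ "{}"])
  obtain Y where Y: "Y \<subseteq> X" "sep Y" and max: "\<And>Z. Z \<subseteq> X \<Longrightarrow> sep Z \<Longrightarrow> card Z \<le> card Y"
  proof -
    have "Max (card ` {Y. Y \<subseteq> X \<and> sep Y}) \<in> card ` {Y. Y \<subseteq> X \<and> sep Y}"
      using fin ne by (intro Max_in) auto
    then obtain Y where "Y \<subseteq> X" "sep Y" "card Y = Max (card ` {Y. Y \<subseteq> X \<and> sep Y})" by auto
    moreover have "card Z \<le> Max (card ` {Y. Y \<subseteq> X \<and> sep Y})" if "Z \<subseteq> X" "sep Z" for Z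
      using fin that by (intro Max_ge) auto
    ultimately show ?thesis using that by metis
  qed
  have finY: "finite Y" using Y X finite_subset by blast
  have "\<exists>T'\<in>Y. supn (fst T - fst T') \<le> 2 * int r" if T: "T \<in> X" for T
  proof (rule ccontr)
    assume a: "\<not> ?thesis"
    then have "sep (insert T Y)" using Y(2) supn_commute unfolding sep_def by (metis insert_iff not_le)
    moreover have "T \<notin> Y" using a by fastforce
    ultimately show False using max[of "insert T Y"] T Y finY by simp
  qed
  then obtain f where f: "\<And>T. T \<in> X \<Longrightarrow> f T \<in> Y" "\<And>T. T \<in> X \<Longrightarrow> supn (fst T - fst (f T)) \<le> 2 * int r"
    by metis
  have fid: "f T = T" if "T \<in> Y" for T
    using that Y f[of T] unfolding sep_def by (metis not_le subsetD)
  define fib where "fib T = {S \<in> X. f S = T}" for T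
  have selfib: "T \<in> fib T" if "T \<in> Y" for T using that fid Y by (auto simp: fib_def)
  have inj: "inj_on fib Y"
    by (rule inj_onI) (metis (mono_tags, lifting) fib_def mem_Collect_eq selfib)
  have part: "partition_on X (fib ` Y)"
  proof (rule partition_onI)
    show "\<Union> (fib ` Y) = X" using f by (auto simp: fib_def)
    show "disjnt p q" if "p \<in> fib ` Y" "q \<in> fib ` Y" "p \<noteq> q" for p q
      using that by (auto simp: fib_def disjnt_def)
    show "{} \<notin> fib ` Y" using selfib by fastforce
  qed
  have diam: "diameter (cen ` fib T) \<le> 10 * real r" if "T \<in> Y" for T
  proof -
    have "dist (cen A) (cen B) \<le> 10 * real r" if AB: "A \<in> fib T" "B \<in> fib T" for A B
    proof -
      have "supn (fst A - fst B) \<le> supn (fst A - fst T) + supn (fst B - fst T)"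
        using supn_diff[of "fst A - fst T" "fst B - fst T"] by simp
      also have "\<dots> \<le> 4 * int r" using AB f(2)[of A] f(2)[of B] by (auto simp: fib_def)
      finally have "real_of_int (supn (fst A - fst B)) \<le> 4 * real r" by linarith
      moreover have "1 \<le> real r" using r by simp
      ultimately show ?thesis using cen_diff_le[of A B] unfolding dist_norm by argo
    qed
    then show ?thesis
      unfolding diameter_def using selfib[OF that] by (auto intro!: cSUP_least)
  qed
  have "spread cen (fib ` Y) = (\<Sum>T\<in>Y. diameter (cen ` fib T))"
    unfolding spread_def by (simp add: sum.reindex[OF inj])
  also have "\<dots> \<le> real (card Y) * (10 * real r)" using diam by (intro sum_bounded_above) auto
  finally have "spread cen (fib ` Y) \<le> 10 * real r * real (card (fib ` Y))"
    by (simp add: card_image[OF inj] mult_ac)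
  then show ?thesis using Y part card_image[OF inj] unfolding sep_def by blast
qed

lemma cen_tshift: "cen (tshift p T) = cen T + lpos p"
  by (cases T; cases "snd T") (auto simp: tshift_def lpos_add)

lemma tshift_inverse: "tshift p (tshift (- p) T) = T" "tshift (- p) (tshift p T) = T"
  by (simp_all add: tshift_def prod_eq_iff)

lemma inj_tshift: "inj_on (tshift p) A"
  by (auto simp: inj_on_def tshift_def prod_eq_iff)

section \<open>The bound that is uniform in the penalty\<close>

context potential
begin

lemma curl_strain_Ints: "curl (strain y) T \<in> \<int>"
  by (rule curl_Ints_congruent) (rule strain_Ints)

text \<open>\<open>gamma_bound\<close> grows with slope 16 C4 in the number n of net points, while
  \<open>core_count\<close> bounds n times \<open>core_energy r / 2 - 27\<close> by the same
  quantity plus a constant. The choice of r makes this factor at least 16 C4 + 1, so n is bounded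
  independently of \<epsilon>.\<close>

lemma uniform_bound:
  "\<exists>G \<epsilon>0. \<epsilon>0 > 0 \<and> (\<forall>\<epsilon>. 0 < \<epsilon> \<longrightarrow> \<epsilon> \<le> \<epsilon>0 \<longrightarrow>
     (\<exists>y. almost_min \<epsilon> y \<and> (\<forall>N. (\<Sum>e\<in>edges N. (strain y e - aform e)\<^sup>2) \<le> G)))"
proof -
  obtain r where r: "r \<ge> 1" "core_energy r \<ge> 2 * (27 + 16 * C4 + 1)" using core_energy_unbounded by blast
  \<comment> \<open>Makes 3 * 2^k0 at least the fibre diameter 10 r of the net, as the start of the
    clustering requires. All scales below k0 are simply counted as bad.\<close>
  obtain k0 :: nat where k0: "(2::real)^k0 \<ge> 12 * real r" using exists_pow2_ge by blast
  define K7 where "K7 = (\<Sum>e\<in>edges (4 * r). (aform e)\<^sup>2)"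
  define G where "G = C4 * (1 + (real k0 + 16 * (C4 * (1 + real k0) + K7)))"
  define den where "den = 1 + 3 * (2 * real r + 1)\<^sup>2"
  have den: "den > 0" by (simp add: den_def add_pos_nonneg)
  define \<epsilon>0 where "\<epsilon>0 = \<mu> / 24 / den"
  have "\<exists>y. almost_min \<epsilon> y \<and> (\<forall>N. (\<Sum>e\<in>edges N. (strain y e - aform e)\<^sup>2) \<le> G)"
    if eps: "0 < \<epsilon>" "\<epsilon> \<le> \<epsilon>0" for \<epsilon>
  proof -
    have small: "\<epsilon> * (1 + 3 * (2 * real r + 1)\<^sup>2) \<le> \<mu> / 24"
      using eps(2) den unfolding \<epsilon>0_def den_def[symmetric] by (simp add: field_simps)
    obtain u where u: "finite (supp u)" "energy angle u \<le> 0" and am: "almost_min \<epsilon> (\<lambda>x. angle x + u x)"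
      using exists_almost_min[OF eps(1)] by blast
    define y0 where "y0 = (\<lambda>x. angle x + u x)"
    have y00: "y0 = (\<lambda>x. angle (x + 0) + u (x + 0))" by (simp add: y0_def)
    define X where "X = {T. curl (strain y0) T \<noteq> 0}"
    obtain N2 where N2: "X \<subseteq> tris N2" "(\<Sum>T\<in>tris N2. curl (strain y0) T) = 1"
      using finite_charges[OF u(1) y00] unfolding X_def by blast
    have finX: "finite X" using N2(1) by (rule finite_subset) simp
    define b where "b T = \<lfloor>curl (strain y0) T\<rfloor>" for T
    have b: "real_of_int (b T) = curl (strain y0) T" for T
      unfolding b_def using curl_strain_Ints[of y0 T] by (auto elim!: Ints_cases)
    have "real_of_int (sum b X) = (\<Sum>T\<in>X. curl (strain y0) T)" by (simp add: b)
    also have "\<dots> = (\<Sum>T\<in>tris N2. curl (strain y0) T)"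
      by (rule sum.mono_neutral_left) (use N2 in \<open>auto simp: X_def\<close>)
    finally have "real_of_int (sum b X) = of_int 1" using N2(2) by (simp only: of_int_1)
    then have bX: "sum b X = 1" by (simp only: of_int_eq_iff)
    obtain Y P where Y: "Y \<subseteq> X" "\<And>T T'. T \<in> Y \<Longrightarrow> T' \<in> Y \<Longrightarrow> T \<noteq> T' \<Longrightarrow> supn (fst T - fst T') > 2 * int r"
      and P: "partition_on X P" "card P = card Y" "spread cen P \<le> 10 * real r * real (card P)"
      using separated_net[OF finX r(1)] by blast
    define n where "n = real (card Y)"
    \<comment> \<open>The factor 3 leaves room for moving from the centre of \<open>x\<close> to the
      new origin, a distance of at most 3/5: for z = 2^(k0 + k), at least 12, one has 3 z / 4 + 3/5
      \<le> z and 3 z - 3/5 \<ge> 2 z, the two radii of \<open>good_scale\<close>.\<close>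
    define l where "l = 3 * (2::real)^k0"
    have l: "l > 0" "10 * real r \<le> l" using k0 r(1) by (auto simp: l_def)
    have sp: "spread cen P \<le> l * real (card P)"
      using P(3) mult_right_mono[OF l(2), of "real (card P)"] by simp
    obtain x where x: "x \<in> X" and bad: "\<And>K. real (card {k. k \<le> K \<and> \<not> (\<exists>S\<subseteq>X. sum b S \<ge> 1 \<and>
        (\<forall>q\<in>S. dist (cen q) (cen x) \<le> l * 2^k / 4) \<and> (\<forall>q\<in>X - S. dist (cen q) (cen x) > l * 2^k))})
      \<le> 16 * real (card P)"
      using cluster_descent[OF finX _ P(1) l(1) sp, of b] bX by auto
    define p where "p = fst x"
    define y where "y = (\<lambda>x. angle (x + p) + u (x + p))"
    have ydef: "y = (\<lambda>x. y0 (x + p))" by (simp add: y_def y0_def)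
    have wry: "strain y = (\<lambda>e. strain y0 (eshift p e))" by (auto simp: strain_def ydef grad_shift)
    have cry: "curl (strain y) T = curl (strain y0) (tshift p T)" for T unfolding wry by (rule curl_shift)
    have amy: "almost_min \<epsilon> y" unfolding ydef using almost_min_shift am[folded y0_def] by blast
    have cx: "cmod (cen x - lpos p) \<le> 3/5" using offs_le unfolding p_def by (cases x; cases "snd x") auto
    have good: "good_scale y (k0 + k)" if S: "S \<subseteq> X" "sum b S \<ge> 1"
        "\<forall>q\<in>S. dist (cen q) (cen x) \<le> l * 2^k / 4" "\<forall>q\<in>X - S. dist (cen q) (cen x) > l * 2^k" for k S
    proof -
      define z where "z = (2::real)^(k0 + k)"
      have lz: "l * 2^k = 3 * z" by (simp add: l_def z_def power_add)
      have "(1::real) \<le> 2^k" by simp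
      then have "12 * 1 \<le> z" unfolding z_def power_add using k0 r(1) by (intro mult_mono[of 12 "2^k0" 1 "2^k", simplified]) auto
      then have z12: "z \<ge> 12" by simp
      have cq: "cen (tshift (- p) q) = (cen q - cen x) + (cen x - lpos p)" for q
        by (simp add: cen_tshift lpos_diff[of 0 p, simplified])
      have in1: "cmod (cen (tshift (- p) q)) \<le> z" if "q \<in> S" for q
      proof -
        have "cmod (cen q - cen x) \<le> 3 * z / 4" using S(3) that lz by (auto simp: dist_norm)
        then show ?thesis using norm_triangle_ineq[of "cen q - cen x" "cen x - lpos p"] cx z12
          unfolding cq by argo
      qed
      have out1: "cmod (cen (tshift (- p) q)) \<ge> 2 * z" if "q \<in> X" "q \<notin> S" for q
      proof -
        have "cmod (cen q - cen x) > 3 * z" using S(4) that lz by (auto simp: dist_norm)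
        then show ?thesis using norm_diff_ineq[of "cen q - cen x" "cen x - lpos p"] cx z12
          unfolding cq by argo
      qed
      have Xiff: "curl (strain y) T \<noteq> 0 \<longleftrightarrow> tshift p T \<in> X" for T by (simp add: X_def cry)
      show ?thesis
        unfolding good_scale_def
      proof (intro exI[of _ "tshift (- p) ` S"] conjI ballI allI impI)
        show "tshift (- p) ` S \<subseteq> {T. curl (strain y) T \<noteq> 0}" using S(1) by (auto simp: Xiff tshift_inverse)
        have "(\<Sum>T\<in>tshift (- p) ` S. curl (strain y) T) = (\<Sum>T\<in>S. curl (strain y0) T)"
          by (subst sum.reindex[OF inj_tshift]) (simp add: cry tshift_inverse)
        also have "\<dots> = real_of_int (sum b S)" by (simp add: b)
        also have "\<dots> \<ge> of_int 1" using S(2) by (simp only: of_int_le_iff)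
        finally show "1 \<le> (\<Sum>T\<in>tshift (- p) ` S. curl (strain y) T)" by simp
        fix T assume "T \<in> tshift (- p) ` S"
        then show "cmod (cen T) \<le> 2^(k0 + k)" using in1 by (auto simp: z_def)
      next
        fix T assume T: "curl (strain y) T \<noteq> 0" "T \<notin> tshift (- p) ` S"
        then have "tshift p T \<in> X" "tshift p T \<notin> S" using Xiff tshift_inverse(2)[of p T] by (auto intro: rev_image_eqI)
        from out1[OF this] show "2^Suc (k0 + k) \<le> cmod (cen T)" by (simp add: tshift_inverse z_def)
      qed
    qed
    have nbM: "real (card {k. k < M \<and> \<not> good_scale y k}) \<le> real k0 + 16 * n" for M
    proof -
      define B where "B = {k. k \<le> M \<and> \<not> (\<exists>S\<subseteq>X. sum b S \<ge> 1 \<and>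
        (\<forall>q\<in>S. dist (cen q) (cen x) \<le> l * 2^k / 4) \<and> (\<forall>q\<in>X - S. dist (cen q) (cen x) > l * 2^k))}"
      have finB: "finite B" by (simp add: B_def)
      have "{k. k < M \<and> \<not> good_scale y k} \<subseteq> {..<k0} \<union> (\<lambda>j. k0 + j) ` B"
      proof
        fix k assume k: "k \<in> {k. k < M \<and> \<not> good_scale y k}"
        show "k \<in> {..<k0} \<union> (\<lambda>j. k0 + j) ` B"
        proof (cases "k < k0")
          case False
          then have "k = k0 + (k - k0)" by simp
          moreover have "k - k0 \<in> B"
          proof (rule ccontr)
            assume "k - k0 \<notin> B"
            then obtain S where "S \<subseteq> X" "sum b S \<ge> 1"
              "\<forall>q\<in>S. dist (cen q) (cen x) \<le> l * 2^(k - k0) / 4"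
              "\<forall>q\<in>X - S. dist (cen q) (cen x) > l * 2^(k - k0)"
              unfolding B_def using k by fastforce
            from good[OF this] show False using k False by simp
          qed
          ultimately show ?thesis by blast
        qed simp
      qed
      then have "card {k. k < M \<and> \<not> good_scale y k} \<le> card ({..<k0} \<union> (\<lambda>j. k0 + j) ` B)"
        using finB by (intro card_mono) auto
      also have "\<dots> \<le> card {..<k0} + card ((\<lambda>j. k0 + j) ` B)" by (rule card_Un_le)
      also have "card ((\<lambda>j. k0 + j) ` B) \<le> card B" by (rule card_image_le[OF finB])
      finally have "real (card {k. k < M \<and> \<not> good_scale y k}) \<le> real (card {..<k0} + card B)"
        by (simp only: of_nat_le_iff add_left_mono)
      then show ?thesis using bad[of M] unfolding B_def[symmetric] n_def by (simp add: P(2))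
    qed
    have GB: "(\<Sum>e\<in>edges N. (strain y e - aform e)\<^sup>2) \<le> C4 * (1 + (real k0 + 16 * n))" for N
      by (rule gamma_bound[OF u y_def nbM])
    define Y' where "Y' = tshift (- p) ` Y"
    have cardY': "real (card Y') = n" by (simp add: Y'_def n_def card_image[OF inj_tshift])
    have "real (card Y') * (core_energy r / 2 - 27) \<le> C4 * (1 + (real k0 + 16 * n)) + K7"
      unfolding K7_def
    proof (rule core_count[OF amy eps(1) r(1) small _ _ _ GB])
      show "finite Y'" using finite_subset[OF Y(1) finX] by (simp add: Y'_def)
      show "curl (strain y) T \<noteq> 0" if "T \<in> Y'" for T
        using that Y(1) by (auto simp: Y'_def cry tshift_inverse X_def)
      show "2 * int r < supn (fst T - fst T')" if t: "T \<in> Y'" "T' \<in> Y'" "T \<noteq> T'" for T T'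
      proof -
        obtain A B where AB: "A \<in> Y" "B \<in> Y" "T = tshift (- p) A" "T' = tshift (- p) B"
          using t(1,2) unfolding Y'_def by blast
        moreover have "fst T - fst T' = fst A - fst B" using AB by (simp add: tshift_def)
        ultimately show ?thesis using Y(2)[of A B] t(3) by auto
      qed
    qed
    moreover have "n * (16 * C4 + 1) \<le> n * (core_energy r / 2 - 27)"
      using r(2) by (intro mult_left_mono) (auto simp: n_def)
    ultimately have "n * (16 * C4 + 1) \<le> C4 * (1 + (real k0 + 16 * n)) + K7" unfolding cardY' by linarith
    then have "n \<le> C4 * (1 + real k0) + K7" by (simp add: algebra_simps)
    then have "C4 * (1 + (real k0 + 16 * n)) \<le> G"
      unfolding G_def using C4_pos by (intro mult_left_mono) auto
    then show ?thesis using amy GB by (meson order_trans)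
  qed
  moreover have "\<epsilon>0 > 0" using mu den by (simp add: \<epsilon>0_def)
  ultimately show ?thesis by blast
qed

end

section \<open>Passage to the limit\<close>

context potential
begin

text \<open>\<psi> sees displacements only modulo 1, so fractional parts serve as bounded
  representatives. \<open>al\<close> is a limit of strains and need not be \<open>strain y\<close>,
  as \<open>wrap\<close> is discontinuous; it remains congruent to \<open>grad y\<close> because the
  integers are closed.\<close>

lemma exists_limit:
  "\<exists>G y al. (\<forall>v. finite (supp v) \<longrightarrow> energy y v \<ge> 0) \<and> (\<forall>e. \<bar>al e\<bar> \<le> 1/2) \<and>
     (\<forall>e. grad y e - al e \<in> \<int>) \<and> (\<forall>N. (\<Sum>e\<in>edges N. (al e - aform e)\<^sup>2) \<le> G)"
proof -
  obtain G \<epsilon>0 where e0: "\<epsilon>0 > 0" and ex: "\<And>\<epsilon>. 0 < \<epsilon> \<Longrightarrow> \<epsilon> \<le> \<epsilon>0 \<Longrightarrow>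
     \<exists>y. almost_min \<epsilon> y \<and> (\<forall>N. (\<Sum>e\<in>edges N. (strain y e - aform e)\<^sup>2) \<le> G)"
    using uniform_bound by blast
  define \<epsilon> where "\<epsilon> n = \<epsilon>0 * inverse (real (Suc n))" for n
  have eps: "0 < \<epsilon> n" "\<epsilon> n \<le> \<epsilon>0" for n
    using e0 by (auto simp: \<epsilon>_def field_simps)
  have "\<forall>n. \<exists>y. almost_min (\<epsilon> n) y \<and> (\<forall>N. (\<Sum>e\<in>edges N. (strain y e - aform e)\<^sup>2) \<le> G)"
    using ex eps by blast
  then obtain Y where Y: "\<And>n. almost_min (\<epsilon> n) (Y n)" "\<And>n N. (\<Sum>e\<in>edges N. (strain (Y n) e - aform e)\<^sup>2) \<le> G"
    by metis
  \<comment> \<open>Values and strains are put into one countable family so that a single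
    subsequence serves both.\<close>
  define f where "f n z = (case z of Inl x \<Rightarrow> frac (Y n x) | Inr e \<Rightarrow> strain (Y n) e)" for n and z :: "lpt + edge"
  have "countable (UNIV :: edge set)"
    unfolding UNIV_Times_UNIV[symmetric] by (intro countable_SIGMA) (auto intro: countable_finite)
  then have count: "countable (UNIV :: (lpt + edge) set)"
    unfolding UNIV_Plus_UNIV[symmetric] by (intro countable_Plus) auto
  have bdd: "norm (f n z) \<le> 1" for n z
  proof (cases z)
    case (Inl x)
    then show ?thesis using frac_lt_1[of "Y n x"] frac_ge_0[of "Y n x"] by (simp add: f_def)
  next
    case (Inr e)
    then show ?thesis using wrap_bounds[of "grad (Y n) e"] by (simp add: f_def strain_def)
  qed
  obtain k where k: "strict_mono (k :: nat \<Rightarrow> nat)" "\<And>z. \<exists>l. (\<lambda>n. f (k n) z) \<longlonglongrightarrow> l"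
    using function_convergent_subsequence[OF count, of f 1] bdd by (metis UNIV_I)
  then obtain L where L: "\<And>z. (\<lambda>n. f (k n) z) \<longlonglongrightarrow> L z" by metis
  define y where "y x = L (Inl x)" for x
  define al where "al e = L (Inr e)" for e
  have ylim: "(\<lambda>n. frac (Y (k n) x)) \<longlonglongrightarrow> y x" for x using L[of "Inl x"] by (simp add: f_def y_def)
  have alim: "(\<lambda>n. strain (Y (k n)) e) \<longlonglongrightarrow> al e" for e using L[of "Inr e"] by (simp add: f_def al_def)
  define yf where "yf n x = frac (Y (k n) x)" for n x
  have dlim: "(\<lambda>n. grad (yf n) e) \<longlonglongrightarrow> grad y e" for e
    unfolding grad_def yf_def by (intro tendsto_diff ylim)
  have dint: "grad (Y (k n)) e - grad (yf n) e \<in> \<int>" for n e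
  proof -
    have "grad (Y (k n)) e - grad (yf n) e = of_int \<lfloor>Y (k n) (tgt e)\<rfloor> - of_int \<lfloor>Y (k n) (src e)\<rfloor>"
      by (simp add: grad_def yf_def frac_def)
    then show ?thesis by simp
  qed
  have a12: "\<bar>al e\<bar> \<le> 1/2" for e
  proof (rule tendsto_upperbound)
    show "(\<lambda>n. \<bar>strain (Y (k n)) e\<bar>) \<longlonglongrightarrow> \<bar>al e\<bar>" by (intro tendsto_rabs alim)
    show "\<forall>\<^sub>F n in sequentially. \<bar>strain (Y (k n)) e\<bar> \<le> 1/2" 
      unfolding strain_def using wrap_bounds by (intro always_eventually allI)
  qed simp
  have aint: "grad y e - al e \<in> \<int>" for e
  proof (rule Lim_in_closed_set)
    show "closed (\<int> :: real set)" by (rule closed_Ints)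
    show "(\<lambda>n. grad (yf n) e - strain (Y (k n)) e) \<longlonglongrightarrow> grad y e - al e" by (intro tendsto_diff dlim alim)
    show "\<forall>\<^sub>F n in sequentially. grad (yf n) e - strain (Y (k n)) e \<in> \<int>"
    proof (intro always_eventually allI)
      fix n
      have "(grad (Y (k n)) e - strain (Y (k n)) e) - (grad (Y (k n)) e - grad (yf n) e) \<in> \<int>"
        by (rule Ints_diff[OF strain_Ints dint])
      then show "grad (yf n) e - strain (Y (k n)) e \<in> \<int>" by simp
    qed
  qed simp
  have psilim: "(\<lambda>n. \<psi> (grad (Y (k n)) e + d)) \<longlonglongrightarrow> \<psi> (grad y e + d)" for e d
  proof -
    have "(\<lambda>n. \<psi> (grad (yf n) e + d)) \<longlonglongrightarrow> \<psi> (grad y e + d)"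
      using psi_cont by (intro continuous_on_tendsto_compose[of UNIV \<psi>] tendsto_intros dlim) auto
    moreover have "\<psi> (grad (Y (k n)) e + d) = \<psi> (grad (yf n) e + d)" for n
      by (rule per_Ints) (use dint[of n e] in simp)
    ultimately show ?thesis by simp
  qed
  have stable: "energy y v \<ge> 0" if v: "finite (supp v)" for v
  proof (rule LIMSEQ_le)
    show "(\<lambda>n. energy (Y (k n)) v) \<longlonglongrightarrow> energy y v"
      unfolding energy_def using psilim psilim[where d=0] by (intro tendsto_sum tendsto_diff) auto
    have "(\<lambda>n. - (\<epsilon>0 * inverse (real (Suc n))) * (1 + real (card (supp v)))) \<longlonglongrightarrow> - (\<epsilon>0 * 0) * (1 + real (card (supp v)))"
      by (intro tendsto_intros LIMSEQ_inverse_real_of_nat)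
    then have "(\<lambda>n. - \<epsilon> n * (1 + real (card (supp v)))) \<longlonglongrightarrow> 0" by (simp add: \<epsilon>_def)
    from LIMSEQ_subseq_LIMSEQ[OF this k(1)]
    show "(\<lambda>n. - \<epsilon> (k n) * (1 + real (card (supp v)))) \<longlonglongrightarrow> 0" by (simp add: o_def)
    show "\<exists>N. \<forall>n\<ge>N. - \<epsilon> (k n) * (1 + real (card (supp v))) \<le> energy (Y (k n)) v"
      using Y(1) v unfolding almost_min_def by blast
  qed
  have "(\<Sum>e\<in>edges N. (al e - aform e)\<^sup>2) \<le> G" for N
  proof (rule tendsto_upperbound)
    show "(\<lambda>n. \<Sum>e\<in>edges N. (strain (Y (k n)) e - aform e)\<^sup>2) \<longlonglongrightarrow> (\<Sum>e\<in>edges N. (al e - aform e)\<^sup>2)"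
      by (intro tendsto_intros alim)
    show "\<forall>\<^sub>F n in sequentially. (\<Sum>e\<in>edges N. (strain (Y (k n)) e - aform e)\<^sup>2) \<le> G" using Y(2) by simp
  qed simp
  then show ?thesis using stable a12 aint by blast
qed

end

section \<open>Decay and net charge under square-summable perturbations\<close>

locale l2_perturbation =
  fixes al :: "edge \<Rightarrow> real" and G :: real
  assumes al_int: "\<And>T. curl al T \<in> \<int>"
    and al_l2: "\<And>N. (\<Sum>e\<in>edges N. (al e - aform e)\<^sup>2) \<le> G"
begin

text \<open>Chebyshev's inequality for the counting measure.\<close>

lemma finite_large_gamma:
  assumes "\<delta> > 0" shows "finite {e. \<bar>al e - aform e\<bar> \<ge> \<delta>}"
proof (rule finite_if_finite_subsets_card_bdd[THEN conjunct1])
  fix F assume F: "F \<subseteq> {e. \<bar>al e - aform e\<bar> \<ge> \<delta>}" "finite F"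
  obtain N where N: "F \<subseteq> edges N" using exists_edges_superset[OF F(2)] by auto
  have "real (card F) * \<delta>\<^sup>2 = (\<Sum>e\<in>F. \<delta>\<^sup>2)" by simp
  also have "\<dots> \<le> (\<Sum>e\<in>F. (al e - aform e)\<^sup>2)"
  proof (rule sum_mono)
    fix e assume "e \<in> F"
    then have "\<bar>\<delta>\<bar> \<le> \<bar>al e - aform e\<bar>" using F(1) assms by auto
    then show "\<delta>\<^sup>2 \<le> (al e - aform e)\<^sup>2" by (simp only: abs_le_square_iff)
  qed
  also have "\<dots> \<le> (\<Sum>e\<in>edges N. (al e - aform e)\<^sup>2)" using N by (intro sum_mono2) auto
  also have "\<dots> \<le> G" by (rule al_l2)
  finally have "real (card F) \<le> G / \<delta>\<^sup>2" using assms by (simp add: field_simps)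
  then show "card F \<le> nat \<lceil>G / \<delta>\<^sup>2\<rceil>" by linarith
qed

lemma finite_large:
  assumes "\<delta> > 0" shows "finite {e. \<bar>al e\<bar> \<ge> \<delta>}"
proof -
  obtain N :: nat where N: "real N > 4 / \<delta>" using reals_Archimedean2 by blast
  have "{e. \<bar>al e\<bar> \<ge> \<delta>} \<subseteq> {e. \<bar>al e - aform e\<bar> \<ge> \<delta> / 2} \<union> edges N"
  proof
    fix e assume e: "e \<in> {e. \<bar>al e\<bar> \<ge> \<delta>}"
    have "\<bar>al e - aform e\<bar> \<ge> \<delta> / 2" if "e \<notin> edges N"
    proof -
      have "rad e \<ge> real N" using that unfolding mem_edges rad_def by linarith
      then have "rad e \<ge> 4 / \<delta>" using N by linarith
      then have "2 / rad e \<le> \<delta> / 2" using assms by (simp add: field_simps)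
      then have "\<bar>aform e\<bar> \<le> \<delta> / 2" using aform_decay[of e] by linarith
      moreover have "\<delta> \<le> \<bar>al e\<bar>" using e by simp
      ultimately show ?thesis using abs_triangle_ineq2[of "al e" "aform e"] by linarith
    qed
    then show "e \<in> {e. \<bar>al e - aform e\<bar> \<ge> \<delta> / 2} \<union> edges N" by auto
  qed
  moreover have "finite ({e. \<bar>al e - aform e\<bar> \<ge> \<delta> / 2} \<union> edges N)"
    using finite_large_gamma[of "\<delta> / 2"] assms by simp
  ultimately show ?thesis by (rule finite_subset)
qed

text \<open>A nonzero integer circulation needs a side with strain at least 1/3 in modulus; there
  are finitely many such edges, and each borders two triangles.\<close>

lemma finite_curl: "finite {T. curl al T \<noteq> 0}"
proof -
  define F where "F = {e. \<bar>al e\<bar> \<ge> 1/3}"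
  have finF: "finite F" unfolding F_def by (rule finite_large) simp
  have "{T. curl al T \<noteq> 0} \<subseteq> lft ` F \<union> rgt ` F"
  proof
    fix T assume "T \<in> {T. curl al T \<noteq> 0}"
    then have T: "\<bar>curl al T\<bar> \<ge> 1" using al_int[of T] Ints_abs_less_1 by force
    obtain x b where xb: "T = (x, b)" by fastforce
    show "T \<in> lft ` F \<union> rgt ` F"
    proof (cases b)
      case True
      then have "(x, E0) \<in> F \<or> (x, E2) \<in> F \<or> (x, E1) \<in> F"
        using T xb by (auto simp: F_def)
      moreover have "lft (x, E0) = T" "lft (x, E2) = T" "rgt (x, E1) = T" using xb True by auto
      ultimately show ?thesis by (metis UnI1 UnI2 image_eqI)
    next
      case False
      then have "(x + (1, 0), E1) \<in> F \<or> (x + (0, 1), E0) \<in> F \<or> (x, E2) \<in> F"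
        using T xb by (auto simp: F_def)
      moreover have "lft (x + (1, 0), E1) = T" "rgt (x + (0, 1), E0) = T" "rgt (x, E2) = T"
        using xb False by auto
      ultimately show ?thesis by (metis UnI1 UnI2 image_eqI)
    qed
  qed
  then show ?thesis by (rule finite_subset) (simp add: finF)
qed

text \<open>A cutoff that decays logarithmically over \<open>n\<close> dyadic scales has Dirichlet energy of order
  \<open>1 / n\<close>, so a square-summable perturbation carries no net charge.\<close>
lemma total_charge: "(\<Sum>T | curl al T \<noteq> 0. curl al T) = 1"
proof -
  define \<gamma> where "\<gamma> e = al e - aform e" for e
  have crg: "curl \<gamma> T = curl al T - (if T = (0, True) then 1 else 0)" for T
    unfolding \<gamma>_def by (simp add: curl_diff curl_aform)
  define X where "X = insert (0, True) {T. curl al T \<noteq> 0}"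
  have finX: "finite X" using finite_curl by (simp add: X_def)
  have out: "curl \<gamma> T = 0" if "T \<notin> X" for T using that by (auto simp: crg X_def)
  define s where "s = (\<Sum>T\<in>X. curl \<gamma> T)"
  obtain M where M: "(2::real)^M \<ge> Max (insert 0 ((\<lambda>T. cmod (cen T)) ` X))" using exists_pow2_ge by blast
  have inM: "cmod (cen T) \<le> 2^M" if "T \<in> X" for T
    by (rule order_trans[OF Max_ge M]) (use that finX in auto)
  have bound: "s\<^sup>2 * (ln 2)\<^sup>2 * real n \<le> G * C3" for n
  proof (cases "n = 0")
    case False
    \<comment> \<open>Starting at scale M makes \<open>F\<close> vanish on all of \<open>X\<close>.
      Outside, \<open>F\<close> reaches the height n ln 2, so Cauchy-Schwarz opposes a squared
      height of order n^2 to a Dirichlet energy of order n.\<close>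
    define B where "B = {M..<M + n}"
    define N where "N = Suc (2 * 2^(M + n))"
    define F where "F T = (\<Sum>k\<in>B. slab k T)" for T
    define c where "c = real n * ln 2"
    have F0: "F T = 0" if "T \<in> X" for T
      unfolding F_def
    proof (rule sum.neutral, rule ballI)
      fix k assume "k \<in> B"
      then have "(2::real)^M \<le> 2^k" by (auto simp: B_def)
      then show "slab k T = 0" using inM[OF that] by (intro slab_inside) linarith
    qed
    have Fc: "F T = c" if "T \<notin> tris (2 * 2^(M + n))" for T
      unfolding F_def using slab_far[OF that] by (simp add: B_def c_def)
    have XN: "X \<subseteq> tris N"
    proof
      fix T assume "T \<in> X"
      then have "F T \<noteq> c" using F0 False by (simp add: c_def)
      then have "T \<in> tris (2 * 2^(M + n))" using Fc by blast
      then show "T \<in> tris N" by (simp add: mem_tris N_def)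
    qed
    have "(\<Sum>e\<in>edges N. \<gamma> e * (F (lft e) - F (rgt e))) = (\<Sum>e\<in>edges N. \<gamma> e * ((F (lft e) - c) - (F (rgt e) - c)))"
      by simp
    also have "\<dots> = (\<Sum>T\<in>tris N. (F T - c) * curl \<gamma> T)"
      unfolding N_def by (rule summation_by_parts) (simp add: Fc)
    also have "\<dots> = (\<Sum>T\<in>X. (F T - c) * curl \<gamma> T)"
      by (rule sum.mono_neutral_right) (use XN out in auto)
    also have "\<dots> = - c * s" unfolding s_def sum_distrib_left by (intro sum.cong) (auto simp: F0)
    finally have "(c * s)\<^sup>2 = (\<Sum>e\<in>edges N. \<gamma> e * (F (lft e) - F (rgt e)))\<^sup>2" by simp
    also have "\<dots> \<le> (\<Sum>e\<in>edges N. (\<gamma> e)\<^sup>2) * (\<Sum>e\<in>edges N. (F (lft e) - F (rgt e))\<^sup>2)"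
      by (rule Cauchy_Schwarz_ineq_sum)
    also have "\<dots> \<le> G * (C3 * real (card B))"
    proof (rule mult_mono)
      show "(\<Sum>e\<in>edges N. (\<gamma> e)\<^sup>2) \<le> G" unfolding \<gamma>_def by (rule al_l2)
      show "(\<Sum>e\<in>edges N. (F (lft e) - F (rgt e))\<^sup>2) \<le> C3 * real (card B)"
        unfolding F_def by (rule bad_gradient_sum[where M="M + n"]) (auto simp: B_def)
      show "0 \<le> G" using al_l2[of 0] sum_nonneg[of "edges 0" "\<lambda>e. (al e - aform e)\<^sup>2"] by simp
      show "0 \<le> (\<Sum>e\<in>edges N. (F (lft e) - F (rgt e))\<^sup>2)" by (intro sum_nonneg) auto
    qed
    finally have "(s\<^sup>2 * (ln 2)\<^sup>2 * real n) * real n \<le> (G * C3) * real n"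
      by (simp add: c_def B_def power2_eq_square mult_ac)
    then show ?thesis using False by (simp add: mult_le_cancel_right)
  next
    case True
    have "0 \<le> G" using al_l2[of 0] sum_nonneg[of "edges 0" "\<lambda>e. (al e - aform e)\<^sup>2"] by simp
    then show ?thesis using True by (simp add: C3_def)
  qed
  have "s = 0"
  proof (rule ccontr)
    assume "s \<noteq> 0"
    then have pos: "s\<^sup>2 * (ln 2)\<^sup>2 > 0" by simp
    obtain n :: nat where "real n > G * C3 / (s\<^sup>2 * (ln 2)\<^sup>2)" using reals_Archimedean2 by blast
    then have "G * C3 < real n * (s\<^sup>2 * (ln 2)\<^sup>2)" using pos by (simp only: pos_divide_less_eq)
    then show False using bound[of n] by (simp add: mult_ac)
  qed
  then have "(\<Sum>T\<in>X. curl al T) = 1"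
    unfolding s_def crg sum_subtractf using finX by (simp add: X_def)
  moreover have "(\<Sum>T\<in>X. curl al T) = (\<Sum>T | curl al T \<noteq> 0. curl al T)"
    by (rule sum.mono_neutral_right) (use finX in \<open>auto simp: X_def\<close>)
  ultimately show ?thesis by simp
qed

end

section \<open>The potential and the lattice bonds\<close>

text \<open>Taylor's formula of third order on [-1/4, 1/4], which keeps away from the half integers,
  where \<psi> need not be smooth. For larger |x| up to 1/2, |x|^3 is at least 1/64 and a bound for
  \<psi> is enough. Periodicity then gives the quadratic bound for all x.\<close>

lemma potential_exists:
  fixes \<psi> :: "real \<Rightarrow> real" and \<mu> :: real
  assumes cont: "continuous_on UNIV \<psi>"
    and C4: "C4_on (- {x. \<exists>k::int. x = real_of_int k + 1/2}) \<psi>"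
    and psi1: "\<forall>x. \<psi> (x + 1) = \<psi> x"
    and psi3: "\<forall>r. \<psi> r = 0 \<longleftrightarrow> r \<in> \<int>"
    and psi4: "(deriv ^^ 2) \<psi> 0 = \<mu>" "\<mu> > 0"
    and psi5: "\<forall>x\<in>{-1/2..1/2}. \<psi> x \<ge> 1/2 * \<mu> * x\<^sup>2"
  shows "\<exists>Cp Ct. potential \<psi> \<mu> Cp Ct"
proof -
  have lower: "\<psi> x \<ge> \<mu> / 2 * x\<^sup>2" if "\<bar>x\<bar> \<le> 1/2" for x
  proof -
    have "x \<in> {-1/2..1/2}" using that by auto
    then show ?thesis using psi5 by force
  qed
  define S where "S = - {x. \<exists>k::int. x = real_of_int k + 1/2}"
  have inS: "x \<in> S" if "\<bar>x\<bar> < 1/2" for x :: real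
  proof (rule ccontr)
    assume "x \<notin> S"
    then obtain k :: int where k: "x = real_of_int k + 1/2" by (auto simp: S_def)
    then have "k < 0" "k > -1" using that by linarith+
    then show False by simp
  qed
  define d where "d k = (deriv ^^ k) \<psi>" for k
  have der: "(d k has_real_derivative d (Suc k) x) (at x)" if "k < 4" "\<bar>x\<bar> < 1/2" for k x
    using C4 inS[OF that(2)] that(1) unfolding C4_on_def S_def[symmetric] d_def by blast
  have d0: "d 0 = \<psi>" "\<psi> 0 = 0" "d 2 0 = \<mu>" using psi3 psi4 by (auto simp: d_def)
  \<comment> \<open>(\<psi>5) makes 0 a local minimum, so the linear Taylor term vanishes.\<close>
  have d1: "d 1 0 = 0"
  proof (rule DERIV_local_min)
    show "(\<psi> has_real_derivative d 1 0) (at 0)" using der[of 0 0] by (simp add: d0)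
    show "0 < (1/2::real)" by simp
    show "\<forall>y. \<bar>0 - y\<bar> < 1/2 \<longrightarrow> \<psi> 0 \<le> \<psi> y"
    proof (intro allI impI)
      fix y :: real assume "\<bar>0 - y\<bar> < 1/2"
      then have "\<mu> / 2 * y\<^sup>2 \<le> \<psi> y" by (intro lower) simp
      moreover have "0 \<le> \<mu> / 2 * y\<^sup>2" using psi4(2) by simp
      ultimately show "\<psi> 0 \<le> \<psi> y" using d0 by linarith
    qed
  qed
  have "continuous_on {-1/4..1/4} (d 3)"
    by (rule continuous_at_imp_continuous_on) (auto intro!: DERIV_isCont[OF der])
  then have "bounded (d 3 ` {-1/4..1/4})" by (intro compact_imp_bounded compact_continuous_image) auto
  then obtain B where B0: "B > 0" "\<forall>z\<in>d 3 ` {-1/4..1/4}. norm z \<le> B" unfolding bounded_pos by blast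
  have B: "B > 0" "\<And>x. \<bar>x\<bar> \<le> 1/4 \<Longrightarrow> \<bar>d 3 x\<bar> \<le> B"
  proof -
    fix x :: real assume "\<bar>x\<bar> \<le> 1/4"
    then have "x \<in> {-1/4..1/4}" by auto
    then show "\<bar>d 3 x\<bar> \<le> B" using B0(2) by (metis imageI real_norm_def)
  qed (rule B0(1))
  have "continuous_on {-1/2..1/2} \<psi>" using cont by (rule continuous_on_subset) simp
  then have "bounded (\<psi> ` {-1/2..1/2})" by (intro compact_imp_bounded compact_continuous_image) auto
  then obtain K where K0: "K > 0" "\<forall>z\<in>\<psi> ` {-1/2..1/2}. norm z \<le> K" unfolding bounded_pos by blast
  have K: "K > 0" "\<And>x. \<bar>x\<bar> \<le> 1/2 \<Longrightarrow> \<bar>\<psi> x\<bar> \<le> K"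
  proof -
    fix x :: real assume "\<bar>x\<bar> \<le> 1/2"
    then have "x \<in> {-1/2..1/2}" by auto
    then show "\<bar>\<psi> x\<bar> \<le> K" using K0(2) by (metis imageI real_norm_def)
  qed (rule K0(1))
  define Ct where "Ct = B + 64 * K"
  have Ct: "Ct > 0" using B K by (simp add: Ct_def)
  have cubic: "\<psi> x \<le> \<mu> / 2 * x\<^sup>2 + Ct * \<bar>x\<bar>^3" if x: "\<bar>x\<bar> \<le> 1/2" for x
  proof (cases "\<bar>x\<bar> \<le> 1/4")
    case True
    have "\<exists>t. \<bar>t\<bar> \<le> \<bar>x\<bar> \<and> \<psi> x = (\<Sum>m<3. d m 0 / fact m * x ^ m) + d 3 t / fact 3 * x ^ 3"
      by (rule Maclaurin_bi_le) (use der True d0 in auto)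
    then obtain t where t: "\<bar>t\<bar> \<le> \<bar>x\<bar>"
      and eq: "\<psi> x = (\<Sum>m<3. d m 0 / fact m * x ^ m) + d 3 t / fact 3 * x ^ 3" by blast
    have "(\<Sum>m<3. d m 0 / fact m * x ^ m) = \<mu> / 2 * x\<^sup>2"
      using d0 d1 by (simp add: eval_nat_numeral fact_numeral)
    moreover have "d 3 t / fact 3 * x ^ 3 \<le> Ct * \<bar>x\<bar>^3"
    proof -
      have "\<bar>d 3 t\<bar> \<le> B" using B(2) t True by auto
      then have "\<bar>d 3 t / fact 3\<bar> \<le> Ct" using B K by (simp add: Ct_def fact_numeral)
      then have "\<bar>d 3 t / fact 3\<bar> * \<bar>x\<bar>^3 \<le> Ct * \<bar>x\<bar>^3" by (intro mult_right_mono) auto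
      then show ?thesis using abs_ge_self[of "d 3 t / fact 3 * x ^ 3"] by (simp add: abs_mult power_abs)
    qed
    ultimately show ?thesis using eq by linarith
  next
    case False
    then have "(1/4)^3 \<le> \<bar>x\<bar>^3" by (intro power_mono) auto
    then have "K * 64 * (1/4)^3 \<le> K * 64 * \<bar>x\<bar>^3" using K by (intro mult_left_mono) auto
    then have "\<psi> x \<le> 64 * K * \<bar>x\<bar>^3" using K(2)[OF x] by (simp add: power3_eq_cube mult_ac)
    also have "\<dots> \<le> Ct * \<bar>x\<bar>^3" using B by (intro mult_right_mono) (auto simp: Ct_def)
    also have "\<dots> \<le> \<mu> / 2 * x\<^sup>2 + Ct * \<bar>x\<bar>^3" using psi4(2) by simp
    finally show ?thesis .
  qed
  define Cp where "Cp = \<mu> + Ct + 4 * K"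
  have Cp: "Cp > 0" using psi4(2) Ct K by (simp add: Cp_def)
  have upper: "\<psi> x \<le> Cp * x\<^sup>2" for x
  proof (cases "\<bar>x\<bar> \<le> 1/2")
    case True
    have "\<bar>x\<bar>^3 \<le> \<bar>x\<bar>\<^sup>2" using True by (intro power_decreasing) auto
    then have "Ct * \<bar>x\<bar>^3 \<le> Ct * x\<^sup>2" using Ct by simp
    then have "\<psi> x \<le> (\<mu> / 2 + Ct) * x\<^sup>2" using cubic[OF True] by (simp add: algebra_simps)
    also have "\<dots> \<le> Cp * x\<^sup>2" using K psi4(2) by (intro mult_right_mono) (auto simp: Cp_def)
    finally show ?thesis .
  next
    case False
    then have "(1/2)\<^sup>2 \<le> \<bar>x\<bar>\<^sup>2" by (intro power_mono) auto
    then have x4: "1 \<le> 4 * x\<^sup>2" by (simp add: power2_eq_square)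
    have "\<psi> x = \<psi> (wrap x)" using periodic_int[of \<psi> "wrap x" "round x"] psi1 by (simp add: wrap_def)
    also have "\<dots> \<le> K" using K(2)[OF wrap_bounds[of x]] by linarith
    also have "\<dots> \<le> K * (4 * x\<^sup>2)" using K(1) x4 mult_left_mono[of 1 "4 * x\<^sup>2" K] by simp
    also have "\<dots> = 4 * K * x\<^sup>2" by simp
    also have "\<dots> \<le> Cp * x\<^sup>2" using Ct psi4(2) by (intro mult_right_mono) (auto simp: Cp_def)
    finally show ?thesis .
  qed
  have "potential \<psi> \<mu> Cp Ct"
    by standard (use psi1 cont psi4(2) Cp Ct lower upper cubic in auto)
  then show ?thesis by blast
qed

section \<open>Bonds of the lattice as oriented edges\<close>

definition hexdirs :: "lpt set" where
  "hexdirs = {(1, 0), (-1, 0), (0, 1), (0, -1), (-1, 1), (1, -1)}"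

lemma unit_quadratic_form:
  fixes m n :: int
  shows "m\<^sup>2 + m * n + n\<^sup>2 = 1 \<longleftrightarrow> (m, n) \<in> hexdirs"
proof
  assume a: "m\<^sup>2 + m * n + n\<^sup>2 = 1"
  have "(2 * m + n)\<^sup>2 + 3 * n\<^sup>2 = 4 * 1" "(2 * n + m)\<^sup>2 + 3 * m\<^sup>2 = 4 * 1"
    unfolding a[symmetric] by (simp_all add: power2_eq_square algebra_simps)
  then have "3 * n\<^sup>2 \<le> 4" "3 * m\<^sup>2 \<le> 4"
    using zero_le_power2[of "2 * m + n"] zero_le_power2[of "2 * n + m"] by linarith+
  then have "n\<^sup>2 \<le> 1\<^sup>2" "m\<^sup>2 \<le> 1\<^sup>2" by simp_all
  then have "\<bar>n\<bar> \<le> 1" "\<bar>m\<bar> \<le> 1" using abs_le_square_iff[of n 1] abs_le_square_iff[of m 1] by simp_all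
  then have "n = -1 \<or> n = 0 \<or> n = 1" "m = -1 \<or> m = 0 \<or> m = 1" by auto
  then show "(m, n) \<in> hexdirs" using a by (elim disjE) (auto simp: hexdirs_def)
qed (auto simp: hexdirs_def)

lemma dist_pos: "(dist (pos \<xi>) (pos \<eta>))\<^sup>2
    = of_int ((fst (\<eta> - \<xi>))\<^sup>2 + fst (\<eta> - \<xi>) * snd (\<eta> - \<xi>) + (snd (\<eta> - \<xi>))\<^sup>2)"
proof -
  define m n where "m = real_of_int (fst \<eta>) - real_of_int (fst \<xi>)"
    and "n = real_of_int (snd \<eta>) - real_of_int (snd \<xi>)"
  have "(dist (pos \<xi>) (pos \<eta>))\<^sup>2
      = (fst (pos \<xi>) - fst (pos \<eta>))\<^sup>2 + (snd (pos \<xi>) - snd (pos \<eta>))\<^sup>2"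
    by (simp add: dist_prod_def dist_real_def)
  also have "fst (pos \<xi>) - fst (pos \<eta>) = - (m + n / 2)"
    by (simp add: pos_def m_def n_def field_simps)
  also have "snd (pos \<xi>) - snd (pos \<eta>) = - (n * (sqrt 3 / 2))"
    by (simp add: pos_def n_def field_simps)
  finally have "(dist (pos \<xi>) (pos \<eta>))\<^sup>2 = (m + n / 2)\<^sup>2 + (n * (sqrt 3 / 2))\<^sup>2"
    by (simp only: power2_minus)
  also have "\<dots> = m\<^sup>2 + m * n + n\<^sup>2"
    by (simp add: power_mult_distrib power_divide) (simp add: power2_eq_square field_simps)
  finally show ?thesis by (simp add: m_def n_def)
qed

lemma is_bond_iff: "is_bond \<xi> \<eta> \<longleftrightarrow> \<eta> - \<xi> \<in> hexdirs"
proof -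
  have "is_bond \<xi> \<eta> \<longleftrightarrow> (dist (pos \<xi>) (pos \<eta>))\<^sup>2 = 1"
    unfolding is_bond_def by (smt (verit) power2_eq_1_iff zero_le_dist)
  also have "\<dots> \<longleftrightarrow> (fst (\<eta> - \<xi>))\<^sup>2 + fst (\<eta> - \<xi>) * snd (\<eta> - \<xi>) + (snd (\<eta> - \<xi>))\<^sup>2 = 1"
    unfolding dist_pos by (simp only: of_int_eq_1_iff)
  finally show ?thesis unfolding unit_quadratic_form prod.collapse .
qed

lemma bond_edge: "is_bond \<xi> \<eta> \<longleftrightarrow> (\<exists>e. (src e = \<xi> \<and> tgt e = \<eta>) \<or> (tgt e = \<xi> \<and> src e = \<eta>))"
proof
  assume "is_bond \<xi> \<eta>"
  then have "\<eta> - \<xi> \<in> hexdirs" by (simp add: is_bond_iff)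
  then consider "\<eta> = \<xi> + (1, 0)" | "\<xi> = \<eta> + (1, 0)" | "\<eta> = \<xi> + (0, 1)" | "\<xi> = \<eta> + (0, 1)"
    | "\<xi> = (\<xi> - (1, 0)) + (1, 0)" "\<eta> = (\<xi> - (1, 0)) + (0, 1)"
    | "\<eta> = (\<eta> - (1, 0)) + (1, 0)" "\<xi> = (\<eta> - (1, 0)) + (0, 1)"
    unfolding hexdirs_def by (cases \<xi>; cases \<eta>) (auto simp: algebra_simps)
  then show "\<exists>e. (src e = \<xi> \<and> tgt e = \<eta>) \<or> (tgt e = \<xi> \<and> src e = \<eta>)"
  proof cases
    case 1 then show ?thesis by (intro exI[of _ "(\<xi>, E0)"]) simp
  next
    case 2 then show ?thesis by (intro exI[of _ "(\<eta>, E0)"]) simp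
  next
    case 3 then show ?thesis by (intro exI[of _ "(\<xi>, E1)"]) simp
  next
    case 4 then show ?thesis by (intro exI[of _ "(\<eta>, E1)"]) simp
  next
    case 5 then show ?thesis by (intro exI[of _ "(\<xi> - (1, 0), E2)"]) simp
  next
    case 6 then show ?thesis by (intro exI[of _ "(\<eta> - (1, 0), E2)"]) simp
  qed
next
  have "is_bond (src e) (tgt e)" "is_bond (tgt e) (src e)" for e
    by (cases e; cases "snd e"; auto simp: is_bond_iff hexdirs_def)+
  then show "\<exists>e. (src e = \<xi> \<and> tgt e = \<eta>) \<or> (tgt e = \<xi> \<and> src e = \<eta>) \<Longrightarrow> is_bond \<xi> \<eta>" by blast
qed

lemma edge_unique:
  "src e = src e' \<Longrightarrow> tgt e = tgt e' \<Longrightarrow> e = e'"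
  "src e = tgt e' \<Longrightarrow> tgt e = src e' \<Longrightarrow> False"
  by (cases e; cases e'; cases "snd e"; cases "snd e'"; cases "fst e"; cases "fst e'"; auto)+

lemma inj_src_tgt: "inj_on (\<lambda>e. (src e, tgt e)) A" "inj_on (\<lambda>e. (tgt e, src e)) A"
  by (rule inj_onI; erule Pair_inject; rule edge_unique(1); assumption)+

lemma finite_bounded_pos: "finite {\<xi>. norm (pos \<xi>) \<le> C}"
proof -
  define N where "N = nat \<lceil>4 * C + 4\<rceil>"
  have "{\<xi>. norm (pos \<xi>) \<le> C} \<subseteq> Box N"
  proof
    fix \<xi> :: lpt assume "\<xi> \<in> {\<xi>. norm (pos \<xi>) \<le> C}"
    then have n: "norm (pos \<xi>) \<le> C" by simp
    define m n where "m = real_of_int (fst \<xi>)" and "n = real_of_int (snd \<xi>)"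
    have f: "\<bar>1/2 + m + n / 2\<bar> \<le> C"
      using norm_fst_le[of "fst (pos \<xi>)" "snd (pos \<xi>)"] n by (simp add: pos_def m_def n_def)
    have "\<bar>sqrt 3 / 6 + n * sqrt 3 / 2\<bar> \<le> C"
      using norm_snd_le[of "snd (pos \<xi>)" "fst (pos \<xi>)"] n by (simp add: pos_def m_def n_def)
    then have "\<bar>sqrt 3 * (1/6 + n / 2)\<bar> \<le> C" by (simp add: algebra_simps)
    then have "sqrt 3 * \<bar>1/6 + n / 2\<bar> \<le> C" by (simp add: abs_mult)
    moreover have "\<bar>1/6 + n / 2\<bar> \<le> sqrt 3 * \<bar>1/6 + n / 2\<bar>"
      using mult_right_mono[of 1 "sqrt 3" "\<bar>1/6 + n / 2\<bar>"] by simp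
    ultimately have "\<bar>1/6 + n / 2\<bar> \<le> C" by (rule order_trans[rotated])
    then have "\<bar>n\<bar> \<le> 4 * C + 4" "\<bar>m\<bar> \<le> 4 * C + 4" using f by (auto simp: abs_le_iff)
    then have "\<bar>fst \<xi>\<bar> \<le> \<lceil>4 * C + 4\<rceil>" "\<bar>snd \<xi>\<bar> \<le> \<lceil>4 * C + 4\<rceil>"
      unfolding m_def n_def by linarith+
    then show "\<xi> \<in> Box N" unfolding mem_Box supn_def N_def by linarith
  qed
  then show ?thesis by (rule finite_subset) simp
qed

lemma bond_dist_ge:
  assumes "is_bond \<xi> \<eta>" shows "norm (pos \<xi>) \<le> bond_dist \<xi> \<eta> + 1"
proof -
  have "closed (closed_segment (pos \<xi>) (pos \<eta>))" "closed_segment (pos \<xi>) (pos \<eta>) \<noteq> {}" by auto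
  then obtain z where z: "z \<in> closed_segment (pos \<xi>) (pos \<eta>)"
    "infdist 0 (closed_segment (pos \<xi>) (pos \<eta>)) = dist 0 z"
    using infdist_attains_inf by blast
  have "dist (pos \<xi>) z \<le> dist (pos \<xi>) (pos \<eta>)"
    using dist_in_closed_segment[OF z(1)] by (simp add: dist_commute)
  then show ?thesis
    using z(2) assms norm_triangle_sub[of "pos \<xi>" z]
    unfolding bond_dist_def is_bond_def by (simp add: dist_norm)
qed

context potential
begin

text \<open>Bonds have length 1, so bounded distance of the bonds from the origin bounds their
  starting points, and a bounded part of the lattice is finite.\<close>

lemma finite_supp_W0:
  assumes "v \<in> W0" shows "finite (supp v)"
proof -
  obtain R where R: "\<And>\<xi> \<eta>. is_bond \<xi> \<eta> \<Longrightarrow> D v \<xi> \<eta> \<noteq> 0 \<Longrightarrow> bond_dist \<xi> \<eta> \<le> R"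
    using assms unfolding W0_def by blast
  have "src ` supp v \<subseteq> {\<xi>. norm (pos \<xi>) \<le> R + 1}"
  proof
    fix \<xi> assume "\<xi> \<in> src ` supp v"
    then obtain e where e: "e \<in> supp v" "\<xi> = src e" by blast
    have b: "is_bond (src e) (tgt e)" using bond_edge by blast
    have "D v (src e) (tgt e) \<noteq> 0" using e by (simp add: supp_def grad_def D_def)
    then show "\<xi> \<in> {\<xi>. norm (pos \<xi>) \<le> R + 1}"
      using R[OF b] bond_dist_ge[OF b] e by simp
  qed
  then have "finite (src ` supp v)" using finite_bounded_pos finite_subset by blast
  then have fin: "finite ((src ` supp v \<union> (\<lambda>x. x - (1, 0)) ` src ` supp v) \<times> (UNIV :: dir set))" by simp
  have "supp v \<subseteq> (src ` supp v \<union> (\<lambda>x. x - (1, 0)) ` src ` supp v) \<times> UNIV"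
  proof
    fix e assume e: "e \<in> supp v"
    have "fst e = src e \<or> fst e = src e - (1, 0)" by (cases e; cases "snd e") auto
    then have "fst e \<in> src ` supp v \<union> (\<lambda>x. x - (1, 0)) ` src ` supp v" using e by auto
    then show "e \<in> (src ` supp v \<union> (\<lambda>x. x - (1, 0)) ` src ` supp v) \<times> UNIV" by (simp add: mem_Times_iff)
  qed
  then show ?thesis using fin by (rule finite_subset)
qed

text \<open>\<open>energy_diff\<close> runs over ordered pairs, so every edge occurs in both
  orientations; evenness of \<psi> makes the two contributions equal.\<close>

lemma energy_diff_energy:
  assumes even: "\<And>x. \<psi> (- x) = \<psi> x" and fin: "finite (supp v)"
  shows "energy_diff \<psi> y v = 2 * energy y v"
proof -
  define A where "A = (\<lambda>e. (src e, tgt e)) ` supp v"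
  define B where "B = (\<lambda>e. (tgt e, src e)) ` supp v"
  define g where "g b = \<psi> (D y (fst b) (snd b) + D v (fst b) (snd b)) - \<psi> (D y (fst b) (snd b))" for b
  have set: "{(\<xi>, \<eta>). is_bond \<xi> \<eta> \<and> D v \<xi> \<eta> \<noteq> 0} = A \<union> B"
  proof (intro equalityI subsetI)
    fix z assume "z \<in> {(\<xi>, \<eta>). is_bond \<xi> \<eta> \<and> D v \<xi> \<eta> \<noteq> 0}"
    then have z: "is_bond (fst z) (snd z)" "v (snd z) \<noteq> v (fst z)" by (auto simp: D_def)
    obtain e where e: "(src e = fst z \<and> tgt e = snd z) \<or> (tgt e = fst z \<and> src e = snd z)"
      using z(1) bond_edge by blast
    then have "e \<in> supp v" using z(2) by (auto simp: supp_def grad_def)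
    moreover have "z = (src e, tgt e) \<or> z = (tgt e, src e)" using e by (metis prod.collapse)
    ultimately show "z \<in> A \<union> B" unfolding A_def B_def by blast
  next
    fix z assume "z \<in> A \<union> B"
    then obtain e where e: "e \<in> supp v" "z = (src e, tgt e) \<or> z = (tgt e, src e)"
      unfolding A_def B_def by blast
    moreover have "is_bond (src e) (tgt e)" "is_bond (tgt e) (src e)" using bond_edge by blast+
    ultimately show "z \<in> {(\<xi>, \<eta>). is_bond \<xi> \<eta> \<and> D v \<xi> \<eta> \<noteq> 0}"
      by (elim disjE) (simp_all add: supp_def grad_def D_def)
  qed
  have dj: "A \<inter> B = {}" unfolding A_def B_def using edge_unique(2) by auto
  have "energy_diff \<psi> y v = sum g (A \<union> B)" unfolding energy_diff_def set g_def ..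
  also have "\<dots> = sum g A + sum g B" using fin dj by (intro sum.union_disjoint) (auto simp: A_def B_def)
  also have "sum g A = energy y v"
    unfolding A_def energy_def by (simp add: sum.reindex[OF inj_src_tgt(1)] g_def D_def grad_def)
  also have "sum g B = energy y v"
  proof -
    have "\<psi> (a - b + (c - d)) = \<psi> (b - a + (d - c))" "\<psi> (a - b) = \<psi> (b - a)" for a b c d
      using even[of "b - a + (d - c)"] even[of "b - a"] by (simp_all add: algebra_simps)
    then show ?thesis
      unfolding B_def energy_def
      by (simp add: sum.reindex[OF inj_src_tgt(2)] g_def D_def grad_def)
  qed
  finally show ?thesis by simp
qed

end

section \<open>From forms on edges to oriented bonds, cells and cores\<close>

definition antisym :: "(edge \<Rightarrow> real) \<Rightarrow> lpt \<Rightarrow> lpt \<Rightarrow> real" where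
  "antisym a \<xi> \<eta> = (if \<exists>e. src e = \<xi> \<and> tgt e = \<eta> then a (THE e. src e = \<xi> \<and> tgt e = \<eta>)
     else - a (THE e. src e = \<eta> \<and> tgt e = \<xi>))"

text \<open>No edge is the reversal of another and an edge is determined by its end points, so the
  case distinction in \<open>antisym\<close> and both descriptions are unambiguous.\<close>

lemma antisym_edge: "antisym a (src e) (tgt e) = a e" "antisym a (tgt e) (src e) = - a e"
proof -
  have the: "(THE e'. src e' = src e \<and> tgt e' = tgt e) = e" using edge_unique(1) by blast
  have ex: "\<exists>e'. src e' = src e \<and> tgt e' = tgt e" by blast
  show "antisym a (src e) (tgt e) = a e" unfolding antisym_def if_P[OF ex] the ..
  have nex: "\<not> (\<exists>e'. src e' = tgt e \<and> tgt e' = src e)" using edge_unique(2) by blast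
  show "antisym a (tgt e) (src e) = - a e" unfolding antisym_def if_not_P[OF nex] the ..
qed

lemma antisym_simps:
  "antisym a x (x + (1, 0)) = a (x, E0)" "antisym a (x + (1, 0)) x = - a (x, E0)"
  "antisym a x (x + (0, 1)) = a (x, E1)" "antisym a (x + (0, 1)) x = - a (x, E1)"
  "antisym a (x + (1, 0)) (x + (0, 1)) = a (x, E2)" "antisym a (x + (0, 1)) (x + (1, 0)) = - a (x, E2)"
  using antisym_edge[of a "(x, E0)"] antisym_edge[of a "(x, E1)"] antisym_edge[of a "(x, E2)"] by simp_all

fun vtx :: "tri \<Rightarrow> lpt \<times> lpt \<times> lpt" where
  "vtx (x, True) = (x, x + (1, 0), x + (0, 1))"
| "vtx (x, False) = (x + (1, 0), x + (1, 0) + (0, 1), x + (0, 1))"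

definition vset :: "tri \<Rightarrow> lpt set" where
  "vset T = (case vtx T of (a, b, c) \<Rightarrow> {a, b, c})"

definition cyc :: "lpt \<times> lpt \<times> lpt \<Rightarrow> (lpt \<times> lpt \<times> lpt) set" where
  "cyc t = (case t of (a, b, c) \<Rightarrow> {(a, b, c), (b, c, a), (c, a, b)})"

lemma circ_cyc: "(\<xi>, \<zeta>, \<eta>) \<in> cyc (vtx T) \<Longrightarrow> circ (antisym a) \<xi> \<zeta> \<eta> = curl a T"
proof -
  have sw: "x + (1, 0) + (0, 1) = x + (0, 1) + (1, 0)" for x :: lpt by (simp add: add_ac)
  have down: "antisym a (x + (1, 0)) (x + (1, 0) + (0, 1)) = a (x + (1, 0), E1)"
    "antisym a (x + (1, 0) + (0, 1)) (x + (0, 1)) = - a (x + (0, 1), E0)" for x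
    using antisym_simps(3)[of a "x + (1, 0)"] antisym_simps(2)[of a "x + (0, 1)"] by (simp_all only: sw)
  assume c: "(\<xi>, \<zeta>, \<eta>) \<in> cyc (vtx T)"
  obtain x b where T: "T = (x, b)" by (rule prod.exhaust)
  show "circ (antisym a) \<xi> \<zeta> \<eta> = curl a T"
  proof (cases b)
    case True
    have "(\<xi> = x \<and> \<zeta> = x + (1, 0) \<and> \<eta> = x + (0, 1)) \<or> (\<xi> = x + (1, 0) \<and> \<zeta> = x + (0, 1) \<and> \<eta> = x)
        \<or> (\<xi> = x + (0, 1) \<and> \<zeta> = x \<and> \<eta> = x + (1, 0))"
      using c by (simp add: T True cyc_def)
    then show ?thesis by (elim disjE conjE; simp add: T True circ_def antisym_simps)
  next
    case False
    define z where "z = x + (1, 0) + (0, 1)"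
    have "(\<xi> = x + (1, 0) \<and> \<zeta> = z \<and> \<eta> = x + (0, 1)) \<or> (\<xi> = z \<and> \<zeta> = x + (0, 1) \<and> \<eta> = x + (1, 0))
        \<or> (\<xi> = x + (0, 1) \<and> \<zeta> = x + (1, 0) \<and> \<eta> = z)"
      using c unfolding z_def by (simp add: T False cyc_def)
    then show ?thesis
      using down[of x, folded z_def] by (elim disjE conjE; simp add: T False circ_def antisym_simps)
  qed
qed

lemma vset_cyc: "(\<xi>, \<zeta>, \<eta>) \<in> cyc (vtx T) \<Longrightarrow> {\<xi>, \<zeta>, \<eta>} = vset T"
  by (cases "vtx T") (auto simp: cyc_def vset_def)

text \<open>The passage from integer coordinates to the plane is affine with linear part of
  determinant sqrt 3 / 2 > 0, so orientation can be tested on integers.\<close>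

lemma pos_oriented_iff:
  "pos_oriented \<xi> \<zeta> \<eta> \<longleftrightarrow>
    fst (\<zeta> - \<xi>) * snd (\<eta> - \<xi>) - snd (\<zeta> - \<xi>) * fst (\<eta> - \<xi>) > 0"
proof -
  define a b c d where "a = real_of_int (fst (\<zeta> - \<xi>))" and "b = real_of_int (snd (\<zeta> - \<xi>))"
    and "c = real_of_int (fst (\<eta> - \<xi>))" and "d = real_of_int (snd (\<eta> - \<xi>))"
  have "(fst (pos \<zeta>) - fst (pos \<xi>)) * (snd (pos \<eta>) - snd (pos \<xi>))
   - (snd (pos \<zeta>) - snd (pos \<xi>)) * (fst (pos \<eta>) - fst (pos \<xi>))
   = (a + b / 2) * (d * (sqrt 3 / 2)) - (b * (sqrt 3 / 2)) * (c + d / 2)"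
  proof -
    have "fst (pos \<zeta>) - fst (pos \<xi>) = a + b / 2" "fst (pos \<eta>) - fst (pos \<xi>) = c + d / 2"
      "snd (pos \<zeta>) - snd (pos \<xi>) = b * (sqrt 3 / 2)" "snd (pos \<eta>) - snd (pos \<xi>) = d * (sqrt 3 / 2)"
      by (simp_all add: pos_def a_def b_def c_def d_def field_simps)
    then show ?thesis by (simp only:)
  qed
  also have "\<dots> = (sqrt 3 / 2) * (a * d - b * c)" by (simp add: field_simps)
  finally have "pos_oriented \<xi> \<zeta> \<eta> \<longleftrightarrow> (sqrt 3 / 2) * (a * d - b * c) > 0" by (simp only: pos_oriented_def)
  also have "\<dots> \<longleftrightarrow> a * d - b * c > 0" by (simp add: zero_less_mult_iff)
  also have "a * d - b * c = of_int (fst (\<zeta> - \<xi>) * snd (\<eta> - \<xi>) - snd (\<zeta> - \<xi>) * fst (\<eta> - \<xi>))"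
    by (simp add: a_def b_def c_def d_def)
  finally show ?thesis by (simp only: of_int_0_less_iff)
qed

text \<open>The sides leaving the first vertex must be consecutive hexagon directions in
  counterclockwise order. The six possibilities are the three rotations of each of the two kinds of
  triangle.\<close>

lemma cell_iff: "is_cell \<xi> \<zeta> \<eta> \<and> pos_oriented \<xi> \<zeta> \<eta> \<longleftrightarrow> (\<exists>T. (\<xi>, \<zeta>, \<eta>) \<in> cyc (vtx T))"
proof
  assume a: "is_cell \<xi> \<zeta> \<eta> \<and> pos_oriented \<xi> \<zeta> \<eta>"
  define d d' where "d = \<zeta> - \<xi>" and "d' = \<eta> - \<xi>"
  have z: "\<zeta> = \<xi> + d" "\<eta> = \<xi> + d'" by (simp_all add: d_def d'_def)
  have h: "d \<in> hexdirs" "d' - d \<in> hexdirs" "- d' \<in> hexdirs"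
    and o: "fst d * snd d' - snd d * fst d' > 0"
    using a by (simp_all add: is_cell_def is_bond_iff pos_oriented_iff d_def d'_def)
  have "(d, d') \<in> {((1, 0), (0, 1)), ((0, 1), (-1, 1)), ((-1, 1), (-1, 0)), ((-1, 0), (0, -1)),
     ((0, -1), (1, -1)), ((1, -1), (1, 0))}"
  proof -
    have "\<forall>d\<in>hexdirs. \<forall>d'\<in>hexdirs. d' - d \<in> hexdirs \<longrightarrow> fst d * snd d' - snd d * fst d' > 0 \<longrightarrow>
      (d, d') \<in> {((1, 0), (0, 1)), ((0, 1), (-1, 1)), ((-1, 1), (-1, 0)), ((-1, 0), (0, -1)),
        ((0, -1), (1, -1)), ((1, -1), (1, 0))}"
      by (simp add: hexdirs_def)
    moreover have "- d'' \<in> hexdirs" if "d'' \<in> hexdirs" for d'' using that by (auto simp: hexdirs_def)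
    from this[OF h(3)] have "d' \<in> hexdirs" by simp
    ultimately show ?thesis using h(1,2) o by metis
  qed
  then consider "d = (1, 0)" "d' = (0, 1)" | "d = (0, 1)" "d' = (-1, 1)" | "d = (-1, 1)" "d' = (-1, 0)"
    | "d = (-1, 0)" "d' = (0, -1)" | "d = (0, -1)" "d' = (1, -1)" | "d = (1, -1)" "d' = (1, 0)"
    by auto
  then show "\<exists>T. (\<xi>, \<zeta>, \<eta>) \<in> cyc (vtx T)"
  proof cases
    case 1 then show ?thesis using z by (intro exI[of _ "(\<xi>, True)"]) (auto simp: cyc_def)
  next
    case 2 then show ?thesis using z by (intro exI[of _ "(\<xi> - (1, 0), False)"]) (cases \<xi>; auto simp: cyc_def)
  next
    case 3 then show ?thesis using z by (intro exI[of _ "(\<xi> - (1, 0), True)"]) (cases \<xi>; auto simp: cyc_def)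
  next
    case 4 then show ?thesis using z by (intro exI[of _ "(\<xi> - (1, 1), False)"]) (cases \<xi>; auto simp: cyc_def)
  next
    case 5 then show ?thesis using z by (intro exI[of _ "(\<xi> - (0, 1), True)"]) (cases \<xi>; auto simp: cyc_def)
  next
    case 6 then show ?thesis using z by (intro exI[of _ "(\<xi> - (0, 1), False)"]) (cases \<xi>; auto simp: cyc_def)
  qed
next
  assume "\<exists>T. (\<xi>, \<zeta>, \<eta>) \<in> cyc (vtx T)"
  then obtain T where T: "(\<xi>, \<zeta>, \<eta>) \<in> cyc (vtx T)" by blast
  obtain m n b where "T = ((m, n), b)" by (metis prod.exhaust)
  then show "is_cell \<xi> \<zeta> \<eta> \<and> pos_oriented \<xi> \<zeta> \<eta>"
    using T by (cases b) (auto simp: cyc_def is_cell_def is_bond_iff hexdirs_def pos_oriented_iff)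
qed

text \<open>The vertices sum to three times the base point plus (1, 1) or (2, 2); the residue modulo
  3 reveals the kind of triangle.\<close>

lemma inj_vset: "inj vset"
proof (rule injI)
  fix T T' assume eq: "vset T = vset T'"
  have s: "sum fst (vset T) = 3 * fst (fst T) + (if snd T then 1 else 2)"
    "sum snd (vset T) = 3 * snd (fst T) + (if snd T then 1 else 2)" for T
    by (cases T; cases "fst T"; cases "snd T"; auto simp: vset_def)+
  have a: "3 * fst (fst T) + (if snd T then 1 else 2) = 3 * fst (fst T') + (if snd T' then 1 else 2)"
    "3 * snd (fst T) + (if snd T then 1 else 2) = 3 * snd (fst T') + (if snd T' then 1 else (2::int))"
    using s[of T] s[of T'] eq by simp_all
  then have "snd T = snd T'" by (auto split: if_splits) presburger+
  then show "T = T'" using a by (auto simp: prod_eq_iff split: if_splits)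
qed

text \<open>The choice by \<open>SOME\<close> is harmless: by \<open>cell_iff\<close> and
  \<open>inj_vset\<close> every admissible labelling is a rotation of \<open>vtx T\<close>, and all
  rotations have the same circulation.\<close>

lemma tri_circ_vset: "tri_circ (antisym a) (vset T) = curl a T"
proof -
  define Q where "Q C \<longleftrightarrow> (case C of (\<xi>, \<zeta>, \<eta>) \<Rightarrow> vset T = {\<xi>, \<zeta>, \<eta>} \<and> is_cell \<xi> \<zeta> \<eta> \<and> pos_oriented \<xi> \<zeta> \<eta>)" for C
  have "vtx T \<in> cyc (vtx T)" by (cases "vtx T") (simp add: cyc_def)
  moreover obtain k l m where v: "vtx T = (k, l, m)" by (metis prod.exhaust)
  ultimately have v': "(k, l, m) \<in> cyc (vtx T)" by simp
  have "is_cell k l m \<and> pos_oriented k l m" using v' cell_iff by blast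
  then have "Q (vtx T)" using vset_cyc[OF v'] unfolding Q_def v by simp
  then have "Q (SOME C. Q C)" by (rule someI)
  then obtain \<xi> \<zeta> \<eta> where C: "(SOME C. Q C) = (\<xi>, \<zeta>, \<eta>)" "vset T = {\<xi>, \<zeta>, \<eta>}"
    "is_cell \<xi> \<zeta> \<eta>" "pos_oriented \<xi> \<zeta> \<eta>"
    unfolding Q_def by (cases "SOME C. Q C") (auto simp: Q_def)
  then obtain T' where T': "(\<xi>, \<zeta>, \<eta>) \<in> cyc (vtx T')" using cell_iff by blast
  then have "T' = T" using vset_cyc C(2) inj_vset by (metis injD)
  then have "circ (antisym a) \<xi> \<zeta> \<eta> = curl a T" using circ_cyc T' by blast
  then show ?thesis unfolding tri_circ_def Q_def[symmetric] C(1) by simp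
qed

lemma cores_antisym: "cores (antisym a) = vset ` {T. curl a T \<noteq> 0}"
proof (intro equalityI subsetI)
  fix s assume "s \<in> cores (antisym a)"
  then obtain \<xi> \<zeta> \<eta> where s: "s = {\<xi>, \<zeta>, \<eta>}" "is_cell \<xi> \<zeta> \<eta>" "pos_oriented \<xi> \<zeta> \<eta>" "circ (antisym a) \<xi> \<zeta> \<eta> \<noteq> 0"
    unfolding cores_def by blast
  then obtain T where "(\<xi>, \<zeta>, \<eta>) \<in> cyc (vtx T)" using cell_iff by blast
  then show "s \<in> vset ` {T. curl a T \<noteq> 0}" using s circ_cyc vset_cyc by (metis (mono_tags) imageI mem_Collect_eq)
next
  fix s assume "s \<in> vset ` {T. curl a T \<noteq> 0}"
  then obtain T where T: "s = vset T" "curl a T \<noteq> 0" by blast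
  obtain \<xi> \<zeta> \<eta> where v: "vtx T = (\<xi>, \<zeta>, \<eta>)" by (metis prod.exhaust)
  then have c: "(\<xi>, \<zeta>, \<eta>) \<in> cyc (vtx T)" by (simp add: cyc_def)
  have "is_cell \<xi> \<zeta> \<eta> \<and> pos_oriented \<xi> \<zeta> \<eta>" using cell_iff c by blast
  moreover have "s = {\<xi>, \<zeta>, \<eta>}" "circ (antisym a) \<xi> \<zeta> \<eta> \<noteq> 0"
    using vset_cyc[OF c] circ_cyc[OF c] T by simp_all
  ultimately show "s \<in> cores (antisym a)" unfolding cores_def by blast
qed

theorem theorem3p3:
  fixes \<psi> :: "real \<Rightarrow> real" and \<mu> :: real
  assumes cont: "continuous_on UNIV \<psi>"
    and C4: "C4_on (- {x. \<exists>k::int. x = real_of_int k + 1/2}) \<psi>"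
    and psi1: "\<forall>x. \<psi> (x + 1) = \<psi> x"
    and psi2a: "\<forall>x. \<psi> (- x) = \<psi> x"
    and psi2b: "\<forall>x. \<psi> (1/2 + (- x)) = \<psi> (1/2 + x)"
    and psi3: "\<forall>r. \<psi> r = 0 \<longleftrightarrow> r \<in> \<int>"
    and psi4: "(deriv ^^ 2) \<psi> 0 = \<mu>" "\<mu> > 0"
    and psi5: "\<forall>x\<in>{-1/2..1/2}. \<psi> x \<ge> 1/2 * \<mu> * x\<^sup>2"
  shows "\<exists>y :: lpt \<Rightarrow> real. globally_stable \<psi> y \<and> has_burgers y 1"
proof -
  obtain Cp Ct where "potential \<psi> \<mu> Cp Ct"
    using potential_exists[OF cont C4 psi1 psi3 psi4 psi5] by blast
  then interpret potential \<psi> \<mu> Cp Ct .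
  obtain G y al where stable: "\<And>v. finite (supp v) \<Longrightarrow> energy y v \<ge> 0" and a12: "\<And>e. \<bar>al e\<bar> \<le> 1/2"
    and aint: "\<And>e. grad y e - al e \<in> \<int>" and l2: "\<And>N. (\<Sum>e\<in>edges N. (al e - aform e)\<^sup>2) \<le> G"
    using exists_limit by blast
  interpret l2_perturbation al G
    by standard (use l2 curl_Ints_congruent[of y al] aint in auto)
  have "globally_stable \<psi> y"
    unfolding globally_stable_def
    using energy_diff_energy psi2a stable finite_supp_W0 by simp
  moreover have "has_burgers y 1"
    unfolding has_burgers_def
  proof (intro exI[of _ "antisym al"] conjI)
    show "antisym al \<in> Dclass y"
    proof -
      have "antisym al \<xi> \<eta> \<in> {-1/2..1/2} \<and> antisym al \<eta> \<xi> = - antisym al \<xi> \<eta> \<and> D y \<xi> \<eta> - antisym al \<xi> \<eta> \<in> \<int>"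
        if b: "is_bond \<xi> \<eta>" for \<xi> \<eta>
      proof -
        obtain e where e: "(src e = \<xi> \<and> tgt e = \<eta>) \<or> (tgt e = \<xi> \<and> src e = \<eta>)" using b bond_edge by blast
        have "- (grad y e - al e) \<in> \<int>" "grad y e - al e \<in> \<int>" using aint[of e] by (simp_all only: Ints_minus)
        then show ?thesis
          using e antisym_edge[of al e] a12[of e] by (auto simp: D_def grad_def abs_le_iff algebra_simps)
      qed
      then show ?thesis unfolding Dclass_def by blast
    qed
    show "decays (antisym al)"
      unfolding decays_def
    proof (intro allI impI)
      fix \<epsilon> :: real assume "\<epsilon> > 0"
      then have fin: "finite {e. \<bar>al e\<bar> \<ge> \<epsilon>}" by (rule finite_large)
      define V where "V = (\<lambda>e. bond_dist (src e) (tgt e)) ` {e. \<bar>al e\<bar> \<ge> \<epsilon>}"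
      define R where "R = Max (insert 0 V)"
      have bR: "bond_dist (src e) (tgt e) \<le> R" if "\<bar>al e\<bar> \<ge> \<epsilon>" for e
        unfolding R_def using that fin by (intro Max_ge) (auto simp: V_def)
      have "\<bar>antisym al \<xi> \<eta>\<bar> < \<epsilon>" if b: "is_bond \<xi> \<eta> \<and> bond_dist \<xi> \<eta> > R" for \<xi> \<eta>
      proof -
        obtain e where e: "(src e = \<xi> \<and> tgt e = \<eta>) \<or> (tgt e = \<xi> \<and> src e = \<eta>)" using b bond_edge by blast
        then have "bond_dist (src e) (tgt e) > R"
          using b unfolding bond_dist_def by (auto simp: closed_segment_commute)
        then have "\<bar>al e\<bar> < \<epsilon>" using bR[of e] by linarith
        then show ?thesis using e antisym_edge[of al e] by auto
      qed
      then show "\<exists>R. \<forall>\<xi> \<eta>. is_bond \<xi> \<eta> \<and> bond_dist \<xi> \<eta> > R \<longrightarrow> \<bar>antisym al \<xi> \<eta>\<bar> < \<epsilon>" by blast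
    qed
    show "finite (cores (antisym al))" unfolding cores_antisym using finite_curl by simp
    have "(\<Sum>T\<in>cores (antisym al). tri_circ (antisym al) T) = (\<Sum>T | curl al T \<noteq> 0. curl al T)"
      unfolding cores_antisym by (subst sum.reindex) (auto simp: tri_circ_vset intro: inj_on_subset[OF inj_vset])
    then show "(\<Sum>T\<in>cores (antisym al). tri_circ (antisym al) T) = 1" using total_charge by simp
  qed
  ultimately show ?thesis by blast
qed

end
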